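(* Let $\varepsilon>0$ and let $F$ be a graph on $r$ vertices with $t$ edges. If $\delta_F\geq 1/2$ or $F$ has a bridge, then let $\delta^T_F=\delta_F$, and otherwise let $\delta^T_F=1/2$. Then there is some $n_0$ such that the following holds for all $n\geq n_0$. Suppose $\mathfrak{G}$ is a graph collection on $[rn]$ with $|\mathfrak{G}|=tn$ and $\delta(\mathfrak{G})\geq (\delta^T_F+\varepsilon)rn$. Then $\mathfrak{G}$ contains a transversal which is an $F$-factor.
   Context: A graph collection on a set $V$ is a finite sequence $\mathfrak{G}=(G_1,\ldots,G_m)$ of (not necessarily distinct) graphs, each with vertex set $V$; $|\mathfrak{G}|=m$ and $\delta(\mathfrak{G})=\min_{i}\delta(G_i)$. An $m$-edge graph $H$ on $V$ is a $\mathfrak{G}$-transversal (a transversal of $\mathfrak{G}$) if there is an injection $\phi:E(H)\to[m]$ with $e\in E(G_{\phi(e)})$ for all $e\in E(H)$. An $F$-factor of a vertex set is a graph consisting of vertex-disjoint copies of $F$ covering all vertices. For a graph $F$, $\delta_F$ is the smallest real number $\delta$ such that for each $\varepsilon>0$ there is $n_0$ such that for every $n\geq n_0$ with $|F|$ dividing $n$, every $n$-vertex graph with minimum degree at least $(\delta+\varepsilon)n$ contains an $F$-factor. *)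

theory Defs
  imports Complex_Main "HOL-Library.Ramsey"
begin

datatype 'a graph = Graph (verts: "'a set") (edges: "'a set set")

text \<open>Finite simple graphs; \<open>nsets V 2\<close> is the set of two-element subsets of \<open>V\<close>.\<close>

definition is_graph :: "'a graph \<Rightarrow> bool" where
  "is_graph G \<longleftrightarrow> finite (verts G) \<and> edges G \<subseteq> nsets (verts G) 2"

definition degree :: "'a graph \<Rightarrow> 'a \<Rightarrow> nat" where
  "degree G v = card {w \<in> verts G. {v, w} \<in> edges G}"

definition min_degree :: "'a graph \<Rightarrow> nat" where
  "min_degree G = Min (degree G ` verts G)"

definition isomorphic :: "'a graph \<Rightarrow> 'b graph \<Rightarrow> bool" where
  "isomorphic G H \<longleftrightarrow>
     (\<exists>f. bij_betw f (verts G) (verts H) \<and>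
          (\<forall>u\<in>verts G. \<forall>v\<in>verts G. {u, v} \<in> edges G \<longleftrightarrow> {f u, f v} \<in> edges H))"

definition connected_rel :: "'a graph \<Rightarrow> ('a \<times> 'a) set" where
  "connected_rel G = {(u, v). u \<in> verts G \<and> v \<in> verts G \<and> (u, v) \<in> {(x, y). {x, y} \<in> edges G}\<^sup>*}"

definition components :: "'a graph \<Rightarrow> 'a set set" where
  "components G = verts G // connected_rel G"

definition delete_edge :: "'a graph \<Rightarrow> 'a set \<Rightarrow> 'a graph" where
  "delete_edge G e = Graph (verts G) (edges G - {e})"

definition is_bridge :: "'a graph \<Rightarrow> 'a set \<Rightarrow> bool" where
  "is_bridge G e \<longleftrightarrow> e \<in> edges G \<and> card (components G) < card (components (delete_edge G e))"

definition has_bridge :: "'a graph \<Rightarrow> bool" where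
  "has_bridge G \<longleftrightarrow> (\<exists>e. is_bridge G e)"

text \<open>\<open>H\<close> is an \<open>F\<close>-factor of the vertex set \<open>V\<close>; \<open>K\<close> is the set of copies of \<open>F\<close>.\<close>

definition is_factor :: "'a graph \<Rightarrow> 'b set \<Rightarrow> 'b graph \<Rightarrow> bool" where
  "is_factor F V H \<longleftrightarrow>
     (\<exists>K. (\<forall>C\<in>K. is_graph C \<and> isomorphic F C) \<and>
          pairwise (\<lambda>C D. disjnt (verts C) (verts D)) K \<and>
          (\<Union>C\<in>K. verts C) = V \<and>
          H = Graph V (\<Union>C\<in>K. edges C))"

definition contains_factor :: "'a graph \<Rightarrow> 'b graph \<Rightarrow> bool" where
  "contains_factor F G \<longleftrightarrow> (\<exists>H. is_factor F (verts G) H \<and> edges H \<subseteq> edges G)"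

text \<open>Every finite graph is isomorphic to one with vertices in \<^typ>\<open>nat\<close>, so it is enough to
  quantify over those.\<close>

definition factor_threshold_bound :: "'a graph \<Rightarrow> real \<Rightarrow> bool" where
  "factor_threshold_bound F \<delta> \<longleftrightarrow>
     (\<forall>\<epsilon>>0. \<exists>n\<^sub>0::nat. \<forall>n\<ge>n\<^sub>0. card (verts F) dvd n \<longrightarrow>
        (\<forall>G::nat graph. is_graph G \<longrightarrow> card (verts G) = n \<longrightarrow>
           real (min_degree G) \<ge> (\<delta> + \<epsilon>) * real n \<longrightarrow> contains_factor F G))"

text \<open>If \<open>F\<close> has an edge then the least element exists, as shown below. If \<open>F\<close> has no edges then
  every real number is a bound, and the value of \<open>factor_threshold F\<close> is unspecified.\<close>

definition factor_threshold :: "'a graph \<Rightarrow> real" where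
  "factor_threshold F = (LEAST \<delta>. factor_threshold_bound F \<delta>)"

definition transversal_factor_threshold :: "'a graph \<Rightarrow> real" where
  "transversal_factor_threshold F =
     (if factor_threshold F \<ge> 1 / 2 \<or> has_bridge F then factor_threshold F else 1 / 2)"

definition is_graph_collection :: "'a set \<Rightarrow> 'a graph list \<Rightarrow> bool" where
  "is_graph_collection V Gs \<longleftrightarrow> (\<forall>G\<in>set Gs. is_graph G \<and> verts G = V)"

definition collection_min_degree :: "'a graph list \<Rightarrow> nat" where
  "collection_min_degree Gs = Min (min_degree ` set Gs)"

definition is_transversal :: "'a set \<Rightarrow> 'a graph list \<Rightarrow> 'a graph \<Rightarrow> bool" where
  "is_transversal V Gs H \<longleftrightarrow>
     is_graph H \<and> verts H = V \<and> card (edges H) = length Gs \<and>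
     (\<exists>\<phi>. inj_on \<phi> (edges H) \<and> \<phi> ` edges H \<subseteq> {..<length Gs} \<and>
          (\<forall>e\<in>edges H. e \<in> edges (Gs ! \<phi> e)))"

lemma min_degree_less:
  assumes "is_graph G" "verts G \<noteq> {}"
  shows "min_degree G < card (verts G)"
proof -
  obtain v where v: "v \<in> verts G" using assms by blast
  have fin: "finite (verts G)" using assms by (simp add: is_graph_def)
  have "{v, v} \<notin> edges G" using assms by (auto simp: is_graph_def nsets_def)
  then have "{w \<in> verts G. {v, w} \<in> edges G} \<subset> verts G" using v by blast
  then have "degree G v < card (verts G)"
    unfolding degree_def by (rule psubset_card_mono[OF fin])
  moreover have "min_degree G \<le> degree G v"
    unfolding min_degree_def using fin v by simp
  ultimately show ?thesis by simp
qed

lemma factor_threshold_bound_one: "factor_threshold_bound F 1"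
  unfolding factor_threshold_bound_def
proof (intro allI impI exI[of _ 1])
  fix \<epsilon> :: real and n :: nat and G :: "nat graph"
  assume a: "0 < \<epsilon>" "1 \<le> n" "is_graph G" "card (verts G) = n" "(1 + \<epsilon>) * real n \<le> real (min_degree G)"
  have "verts G \<noteq> {}" using a by auto
  then have "real (min_degree G) < real n" using min_degree_less[OF a(3)] a(4) by simp
  moreover have "0 \<le> \<epsilon> * real n" using a by simp
  ultimately show "contains_factor F G" using a(5) by (simp add: algebra_simps)
qed

lemma factor_threshold_bound_nonneg:
  assumes F: "is_graph F" "edges F \<noteq> {}" and b: "factor_threshold_bound F \<delta>"
  shows "\<delta> \<ge> 0"
proof (rule ccontr)
  assume "\<not> \<delta> \<ge> 0"
  then have "- \<delta> > 0" by simp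
  with b obtain n0 where n0': "\<forall>n\<ge>n0. card (verts F) dvd n \<longrightarrow>
      (\<forall>G::nat graph. is_graph G \<longrightarrow> card (verts G) = n \<longrightarrow>
         real (min_degree G) \<ge> (\<delta> + - \<delta>) * real n \<longrightarrow> contains_factor F G)"
    unfolding factor_threshold_bound_def by blast
  have n0: "contains_factor F G"
    if "n \<ge> n0" "card (verts F) dvd n" "is_graph G" "card (verts G) = n" for n and G :: "nat graph"
    using n0'[rule_format, OF that] by simp
  define n where "n = card (verts F) * Suc n0"
  obtain e where e: "e \<in> edges F" using F by blast
  then have "e \<in> nsets (verts F) 2" using F by (auto simp: is_graph_def)
  then obtain u v where uv: "e = {u, v}" "u \<in> verts F" "v \<in> verts F"
    unfolding nsets_def by (auto simp: card_2_iff)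
  have "card (verts F) > 0" using uv F by (auto simp: is_graph_def card_gt_0_iff)
  moreover from this have "1 * Suc n0 \<le> n" unfolding n_def by (intro mult_le_mono1) simp
  ultimately have n: "n \<ge> n0" "n > 0" by simp_all
  have "contains_factor F (Graph {..<n} {})"
    using n0[of n "Graph {..<n} {}"] n by (auto simp: is_graph_def n_def)
  then obtain H where H: "is_factor F {..<n} H" "edges H = {}"
    unfolding contains_factor_def by auto
  then obtain K where K: "\<forall>C\<in>K. is_graph C \<and> isomorphic F C"
      "(\<Union>C\<in>K. verts C) = {..<n}" and "H = Graph {..<n} (\<Union>C\<in>K. edges C)"
    unfolding is_factor_def by blast
  with H have K_edges: "(\<Union>C\<in>K. edges C) = {}" by simp
  have "K \<noteq> {}" using K(2) n by auto
  then obtain C where C: "C \<in> K" by blast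
  then obtain f where "{f u, f v} \<in> edges C"
    using K(1) e uv unfolding isomorphic_def by blast
  then show False using C K_edges by blast
qed

lemma factor_threshold_least:
  assumes F: "is_graph F" "edges F \<noteq> {}"
  shows "factor_threshold_bound F (factor_threshold F)"
    and "factor_threshold_bound F \<delta> \<Longrightarrow> factor_threshold F \<le> \<delta>"
proof -
  define S where "S = {\<delta>. factor_threshold_bound F \<delta>}"
  have bdd: "bdd_below S"
    using factor_threshold_bound_nonneg[OF F] by (auto simp: S_def intro: bdd_belowI[of _ 0])
  have ne: "S \<noteq> {}" using factor_threshold_bound_one by (auto simp: S_def)
  have Inf: "factor_threshold_bound F (Inf S)"
    unfolding factor_threshold_bound_def
  proof (intro allI impI)
    fix \<epsilon> :: real assume "\<epsilon> > 0"
    then obtain d where d: "d \<in> S" "d < Inf S + \<epsilon>"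
      using cInf_lessD[OF ne, of "Inf S + \<epsilon>"] by auto
    have "Inf S + \<epsilon> - d > 0" using d by simp
    with d(1) have "\<exists>n0::nat. \<forall>n\<ge>n0. card (verts F) dvd n \<longrightarrow>
        (\<forall>G::nat graph. is_graph G \<longrightarrow> card (verts G) = n \<longrightarrow>
           real (min_degree G) \<ge> (d + (Inf S + \<epsilon> - d)) * real n \<longrightarrow> contains_factor F G)"
      unfolding S_def factor_threshold_bound_def mem_Collect_eq by blast
    then show "\<exists>n0::nat. \<forall>n\<ge>n0. card (verts F) dvd n \<longrightarrow>
        (\<forall>G::nat graph. is_graph G \<longrightarrow> card (verts G) = n \<longrightarrow>
           real (min_degree G) \<ge> (Inf S + \<epsilon>) * real n \<longrightarrow> contains_factor F G)"
      by simp
  qed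
  have eq: "factor_threshold F = Inf S"
    unfolding factor_threshold_def
    by (rule Least_equality) (use Inf bdd in \<open>auto simp: S_def intro: cInf_lower\<close>)
  show "factor_threshold_bound F (factor_threshold F)" using Inf eq by simp
  show "factor_threshold_bound F \<delta> \<Longrightarrow> factor_threshold F \<le> \<delta>"
    using bdd eq by (auto simp: S_def intro: cInf_lower)
qed

end

theory Submission
  imports Defs "HOL-Combinatorics.Multiset_Permutations" "HOL-Library.FuncSet"
begin

text \<open>For a set \<open>T\<close> of vertices of bounded size, the colours fall into boundedly many classes
  according to the graph which they induce on \<open>T\<close>. Colours of one class can be distributed
  arbitrarily over an ordinary \<open>F\<close>-factor of their common graph on \<open>T\<close>, and for most sets \<open>T\<close> of
  large constant size this graph has such a factor for most colours, because minimum degrees are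
  inherited by random subsets. Applied to the blocks of a random permutation of the vertices, this
  covers almost all vertices and colours.

  The rest is absorbed. Given \<open>r\<close> vertices \<open>Q\<close> and \<open>t\<close> colours \<open>P\<close>, a random pair \<open>(T, D)\<close> has with
  positive probability rainbow \<open>F\<close>-factors both on \<open>(T, D)\<close> and on \<open>(T \<union> Q, D \<union> P)\<close>, where \<open>D\<close> lies
  in a single class: each colour of \<open>P\<close> is used on one edge of a copy of \<open>F\<close> whose other edges have
  colours in \<open>D\<close>, and the remaining vertices have an \<open>F\<close>-factor in the common graph of \<open>D\<close>. Only
  the existence of such copies depends on the case distinction in the threshold. If it is at least
  \<open>1 / 2\<close>, then two graphs above the threshold share many edges, and these extend to complete
  multipartite graphs as in the Erdos--Stone theorem, since the threshold is at least
  \<open>1 - 1 / (\<chi>(F) - 1)\<close>. Otherwise \<open>F\<close> is bipartite and has a bridge, which can be placed on any edge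
  of the special colour.\<close>

section \<open>Rainbow factors\<close>

text \<open>The value \<open>1 / 2\<close> for a bipartite F without bridge has a parity reason. Let
  one colour be two disjoint cliques on the halves of the vertex set and every other colour the
  complete bipartite graph between the halves. In its copy of F, the edge of the first colour would
  lie on a cycle with exactly one edge inside a half and an even number across, an odd cycle. So a
  single colour can block the factor; placing it is the only task that goes beyond the ordinary
  threshold.

  All pieces keep the proportion of \<open>r\<close> vertices to \<open>t\<close> colours, so
  removing them leaves a problem of the same form with smaller \<open>n\<close>. Absorbers are
  reserved before the almost covering, whose leftover cannot be predicted; hence every pair
  \<open>(Q, P)\<close> needs many of them. Order of the constants: the block size \<open>k'\<close>
  from \<epsilon>, the density \<open>\<beta>\<close> of absorbers from \<open>k'\<close>, the
  number \<open>\<mu> * n\<close> of candidates drawn from \<open>\<beta>\<close>, the share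
  \<open>\<eta>\<close> left by the covering from \<open>\<beta> * \<mu>\<close>, and
  \<open>n\<close> last.\<close>

definition tiling :: "'a graph \<Rightarrow> 'b set \<Rightarrow> 'b graph set \<Rightarrow> bool" where
  "tiling F X K \<longleftrightarrow>
     (\<forall>C\<in>K. is_graph C \<and> isomorphic F C) \<and>
     pairwise (\<lambda>C D. disjnt (verts C) (verts D)) K \<and> (\<Union>C\<in>K. verts C) = X"

text \<open>A bijection onto \<open>D\<close> rather than an injection into it: there are exactly as
  many colours as edges in the end, so each colour must be spent. The colour graphs are bare edge
  sets because they are constantly looked at on smaller vertex sets.\<close>

definition rainbow_factor :: "'a graph \<Rightarrow> ('c \<Rightarrow> 'b set set) \<Rightarrow> 'b set \<Rightarrow> 'c set \<Rightarrow> bool" where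
  "rainbow_factor F G X D \<longleftrightarrow>
     (\<exists>K \<phi>. tiling F X K \<and> bij_betw \<phi> (\<Union>C\<in>K. edges C) D \<and> (\<forall>e\<in>(\<Union>C\<in>K. edges C). e \<in> G (\<phi> e)))"

definition degree_into :: "'b set set \<Rightarrow> 'b set \<Rightarrow> 'b \<Rightarrow> nat" where
  "degree_into E X v = card {w \<in> X. {v, w} \<in> E}"

abbreviation simple_edges :: "'b set set \<Rightarrow> bool" where
  "simple_edges E \<equiv> \<forall>e\<in>E. card e = 2"

abbreviation min_degree_ge :: "'b set set \<Rightarrow> 'b set \<Rightarrow> real \<Rightarrow> bool" where
  "min_degree_ge E X d \<equiv> \<forall>v\<in>X. real (degree_into E X v) \<ge> d * real (card X)"

text \<open>\<open>E\<close> stands for the common graph of a class of interchangeable colours and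
  \<open>E'\<close> for the graph of the one colour that has to be placed.\<close>

abbreviation has_special_copy :: "'a graph \<Rightarrow> 'b set \<Rightarrow> 'b set set \<Rightarrow> 'b set set \<Rightarrow> bool" where
  "has_special_copy F X E E' \<equiv> \<exists>C. is_graph C \<and> isomorphic F C \<and> verts C \<subseteq> X \<and>
     (\<exists>e\<in>edges C. e \<in> E' \<and> edges C - {e} \<subseteq> E)"

lemma is_graph_edge:
  assumes "is_graph C" "e \<in> edges C"
  shows "e \<subseteq> verts C" "card e = 2" "e \<noteq> {}"
  using assms by (auto simp: is_graph_def nsets_def)

lemma is_graph_edgeE:
  assumes "is_graph C" "e \<in> edges C"
  obtains u v where "e = {u, v}" "u \<in> verts C" "v \<in> verts C" "u \<noteq> v"
proof -
  have "e \<in> nsets (verts C) 2" using assms by (auto simp: is_graph_def)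
  then show thesis using that by (auto simp: nsets_2_eq)
qed

lemma tiling_edge:
  assumes "tiling F X K" "e \<in> (\<Union>C\<in>K. edges C)"
  shows "e \<subseteq> X \<and> e \<noteq> {}"
proof -
  obtain C where C: "C \<in> K" "e \<in> edges C" using assms(2) by blast
  then have g: "is_graph C" "verts C \<subseteq> X" using assms(1) unfolding tiling_def by auto
  then show ?thesis using is_graph_edge(1,3)[OF g(1) C(2)] by auto
qed

lemma rainbow_factor_empty: "rainbow_factor F G {} {}"
  unfolding rainbow_factor_def tiling_def by (intro exI[of _ "{}"]) (auto simp: bij_betw_def)

text \<open>Edges are nonempty, so an edge inside \<open>X\<close> is never an edge inside
  \<open>Y\<close>, and the two colourings can be merged.\<close>

lemma rainbow_factor_Un:
  assumes "rainbow_factor F G X D" "rainbow_factor F G Y E" "X \<inter> Y = {}" "D \<inter> E = {}"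
  shows "rainbow_factor F G (X \<union> Y) (D \<union> E)"
proof -
  obtain K \<phi> where K: "tiling F X K" "bij_betw \<phi> (\<Union>C\<in>K. edges C) D"
      "\<forall>e\<in>(\<Union>C\<in>K. edges C). e \<in> G (\<phi> e)"
    using assms(1) unfolding rainbow_factor_def by blast
  obtain L \<psi> where L: "tiling F Y L" "bij_betw \<psi> (\<Union>C\<in>L. edges C) E"
      "\<forall>e\<in>(\<Union>C\<in>L. edges C). e \<in> G (\<psi> e)"
    using assms(2) unfolding rainbow_factor_def by blast
  define EK where "EK = (\<Union>C\<in>K. edges C)"
  define EL where "EL = (\<Union>C\<in>L. edges C)"
  define \<theta> where "\<theta> = (\<lambda>e. if e \<in> EK then \<phi> e else \<psi> e)"
  have EK: "e \<subseteq> X \<and> e \<noteq> {}" if "e \<in> EK" for e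
    using that tiling_edge[OF K(1)] by (simp add: EK_def)
  have EL: "e \<subseteq> Y \<and> e \<noteq> {}" if "e \<in> EL" for e
    using that tiling_edge[OF L(1)] by (simp add: EL_def)
  have disj: "EK \<inter> EL = {}" using EK EL assms(3) by blast
  have "bij_betw \<theta> EK D"
    using K(2) unfolding EK_def[symmetric] \<theta>_def by (simp cong: bij_betw_cong)
  moreover have "bij_betw \<theta> EL E"
  proof -
    have "bij_betw \<theta> EL E \<longleftrightarrow> bij_betw \<psi> EL E"
      by (rule bij_betw_cong) (use disj in \<open>auto simp: \<theta>_def\<close>)
    then show ?thesis using L(2) EL_def by simp
  qed
  ultimately have bij: "bij_betw \<theta> (EK \<union> EL) (D \<union> E)"
    using assms(4) by (rule bij_betw_combine)
  have un: "(\<Union>C\<in>K \<union> L. edges C) = EK \<union> EL" by (auto simp: EK_def EL_def)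
  have "tiling F (X \<union> Y) (K \<union> L)"
    unfolding tiling_def
  proof (intro conjI)
    show "\<forall>C\<in>K \<union> L. is_graph C \<and> isomorphic F C"
      using K(1) L(1) unfolding tiling_def by blast
    show "(\<Union>C\<in>K \<union> L. verts C) = X \<union> Y"
      using K(1) L(1) unfolding tiling_def by blast
    have "disjnt (verts C) (verts C')" if "C \<in> K" "C' \<in> L" for C C'
      using K(1) L(1) that assms(3) unfolding tiling_def disjnt_def by blast
    then show "pairwise (\<lambda>C D. disjnt (verts C) (verts D)) (K \<union> L)"
      using K(1) L(1) disjnt_sym unfolding tiling_def pairwise_def by (metis Un_iff)
  qed
  moreover have "\<forall>e\<in>EK \<union> EL. e \<in> G (\<theta> e)"
    using K(3) L(3) disj unfolding EK_def[symmetric] EL_def[symmetric] \<theta>_def by auto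
  ultimately show ?thesis
    unfolding rainbow_factor_def using bij un by metis
qed

lemma isomorphic_card_edges:
  assumes F: "is_graph F" and C: "is_graph C" and iso: "isomorphic F C"
  shows "card (verts C) = card (verts F)" "card (edges C) = card (edges F)"
proof -
  obtain f where f: "bij_betw f (verts F) (verts C)"
      "\<forall>u\<in>verts F. \<forall>v\<in>verts F. {u, v} \<in> edges F \<longleftrightarrow> {f u, f v} \<in> edges C"
    using iso unfolding isomorphic_def by blast
  show "card (verts C) = card (verts F)" using f(1) by (simp add: bij_betw_same_card)
  have sub: "edges F \<subseteq> Pow (verts F)" using is_graph_edge(1)[OF F] by blast
  have inj: "inj_on ((`) f) (edges F)"
    by (rule inj_on_subset[OF inj_on_image_Pow sub]) (use f in \<open>simp add: bij_betw_def\<close>)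
  have "(`) f ` edges F = edges C"
  proof (intro set_eqI iffI)
    fix e assume "e \<in> (`) f ` edges F"
    then obtain d where d: "d \<in> edges F" "e = f ` d" by blast
    obtain u v where "d = {u, v}" "u \<in> verts F" "v \<in> verts F"
      using is_graph_edgeE[OF F d(1)] by metis
    then show "e \<in> edges C" using f(2) d by auto
  next
    fix e assume e: "e \<in> edges C"
    obtain x y where xy: "e = {x, y}" "x \<in> verts C" "y \<in> verts C"
      using is_graph_edgeE[OF C e] by metis
    then obtain u v where "x = f u" "y = f v" "u \<in> verts F" "v \<in> verts F"
      using f(1) unfolding bij_betw_def by (metis imageE)
    then show "e \<in> (`) f ` edges F" using f(2) e xy by (intro image_eqI[of _ _ "{u, v}"]) auto
  qed
  then show "card (edges C) = card (edges F)" using card_image[OF inj] by simp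
qed

lemma copy_of_graph:
  assumes F: "is_graph F" and h: "inj_on h (verts F)"
  defines "C \<equiv> Graph (h ` verts F) ((`) h ` edges F)"
  shows "is_graph C" "isomorphic F C"
proof -
  have *: "\<exists>u v. d = {u, v} \<and> u \<in> verts F \<and> v \<in> verts F \<and> u \<noteq> v" if "d \<in> edges F" for d
    using is_graph_edgeE[OF F that] by metis
  have "(`) h ` edges F \<subseteq> nsets (h ` verts F) 2"
  proof
    fix e assume "e \<in> (`) h ` edges F"
    then obtain d where d: "d \<in> edges F" "e = h ` d" by blast
    obtain u v where "d = {u, v}" "u \<in> verts F" "v \<in> verts F" "u \<noteq> v" using *[OF d(1)] by blast
    then show "e \<in> nsets (h ` verts F) 2" using d h by (auto dest: inj_onD)
  qed
  then show "is_graph C" using F by (simp add: C_def is_graph_def)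
  have sub: "edges F \<subseteq> Pow (verts F)" using is_graph_edge(1)[OF F] by blast
  have "{h u, h v} \<in> (`) h ` edges F \<longleftrightarrow> {u, v} \<in> edges F" if "u \<in> verts F" "v \<in> verts F" for u v
  proof
    assume "{h u, h v} \<in> (`) h ` edges F"
    then obtain d where d: "d \<in> edges F" "h ` {u, v} = h ` d" by auto
    have "{u, v} = d"
      by (rule inj_onD[OF inj_on_image_Pow[OF h] d(2)]) (use d(1) sub that in auto)
    then show "{u, v} \<in> edges F" using d by simp
  next
    assume "{u, v} \<in> edges F"
    then show "{h u, h v} \<in> (`) h ` edges F" by (intro image_eqI[of _ _ "{u, v}"]) auto
  qed
  then show "isomorphic F C"
    unfolding isomorphic_def C_def using h by (intro exI[of _ h]) (auto simp: bij_betw_def)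
qed

lemma tiling_card:
  assumes F: "is_graph F" and r: "card (verts F) > 0" and X: "finite X" and K: "tiling F X K"
  shows "card X = card (verts F) * card K"
    "card (\<Union>C\<in>K. edges C) = card (edges F) * card K"
    "finite (\<Union>C\<in>K. edges C)"
proof -
  have C: "is_graph C" "card (verts C) = card (verts F)" "card (edges C) = card (edges F)"
    "finite (edges C)" "verts C \<noteq> {}" if "C \<in> K" for C
  proof -
    show g: "is_graph C" using K that unfolding tiling_def by blast
    show "card (verts C) = card (verts F)" "card (edges C) = card (edges F)"
      using isomorphic_card_edges[OF F g] K that unfolding tiling_def by blast+
    then show "verts C \<noteq> {}" using r by auto
    show "finite (edges C)"
      using g finite_subset[of "edges C" "Pow (verts C)"] is_graph_edge(1)[OF g]
      by (auto simp: is_graph_def)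
  qed
  have disj: "verts C \<inter> verts D = {}" if "C \<in> K" "D \<in> K" "C \<noteq> D" for C D
    using K that unfolding tiling_def pairwise_def disjnt_def by blast
  have un: "(\<Union>C\<in>K. verts C) = X" using K unfolding tiling_def by blast
  have "inj_on verts K" using C(5) disj by (metis inf.idem inj_onI)
  moreover have "verts ` K \<subseteq> Pow X" using un by blast
  ultimately have finK: "finite K"
    using X by (meson finite_Pow_iff finite_subset finite_imageD)
  have "card X = (\<Sum>C\<in>K. card (verts C))"
    unfolding un[symmetric] using finK disj C(1) by (intro card_UN_disjoint) (auto simp: is_graph_def)
  then show "card X = card (verts F) * card K" using C(2) by simp
  have edisj: "edges C \<inter> edges D = {}" if "C \<in> K" "D \<in> K" "C \<noteq> D" for C D
  proof -
    have "e \<subseteq> verts C \<and> e \<noteq> {}" if "e \<in> edges C" for e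
      using is_graph_edge(1,3)[OF C(1)[OF \<open>C \<in> K\<close>] that] by blast
    moreover have "e \<subseteq> verts D" if "e \<in> edges D" for e
      using is_graph_edge(1)[OF C(1)[OF \<open>D \<in> K\<close>] that] by blast
    ultimately show ?thesis using disj[OF that] by blast
  qed
  have "card (\<Union>C\<in>K. edges C) = (\<Sum>C\<in>K. card (edges C))"
    using finK edisj C by (intro card_UN_disjoint) auto
  then show "card (\<Union>C\<in>K. edges C) = card (edges F) * card K" using C(3) by simp
  show "finite (\<Union>C\<in>K. edges C)" using finK C by auto
qed

text \<open>All colours of \<open>D\<close> contain \<open>E\<close> on \<open>X\<close>, so any
  bijection between the edges of the tiling and \<open>D\<close> will do. The condition on the
  number of colours is written as a product to avoid division.\<close>

lemma rainbow_factor_same_graph: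
  assumes F: "is_graph F" and r: "card (verts F) > 0" and X: "finite X" and K: "tiling F X K"
    and sub: "(\<Union>C\<in>K. edges C) \<subseteq> E"
    and D: "finite D" "\<And>c e. c \<in> D \<Longrightarrow> e \<in> E \<Longrightarrow> e \<subseteq> X \<Longrightarrow> e \<in> G c"
    and card: "card D * card (verts F) = card (edges F) * card X"
  shows "rainbow_factor F G X D"
proof -
  note T = tiling_card[OF F r X K]
  have "card D * card (verts F) = card (\<Union>C\<in>K. edges C) * card (verts F)"
    using card unfolding T(1,2) by (simp only: mult_ac)
  then have "card (\<Union>C\<in>K. edges C) = card D" using r mult_right_cancel by (metis less_irrefl)
  then obtain \<phi> where \<phi>: "bij_betw \<phi> (\<Union>C\<in>K. edges C) D"
    using finite_same_card_bij[OF T(3) D(1)] by blast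
  have "e \<in> G (\<phi> e)" if "e \<in> (\<Union>C\<in>K. edges C)" for e
  proof (rule D(2))
    show "\<phi> e \<in> D" using \<phi> that by (auto simp: bij_betw_def)
    show "e \<in> E" using sub that by blast
    show "e \<subseteq> X" using tiling_edge[OF K that] by blast
  qed
  then show ?thesis unfolding rainbow_factor_def using K \<phi> by blast
qed

lemma tiling_singleton:
  "is_graph C \<Longrightarrow> isomorphic F C \<Longrightarrow> tiling F (verts C) {C}"
  by (auto simp: tiling_def)

text \<open>\<open>p\<close> is put on \<open>e\<close>; the other colours are interchangeable on
  the remaining edges.\<close>

lemma rainbow_factor_special_copy:
  assumes F: "is_graph F" and C: "is_graph C" "isomorphic F C"
    and e: "e \<in> edges C" "e \<in> G p" and sub: "edges C - {e} \<subseteq> E"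
    and D: "finite D" "p \<notin> D" "card D + 1 = card (edges F)" "\<And>c f. c \<in> D \<Longrightarrow> f \<in> E \<Longrightarrow> f \<subseteq> verts C \<Longrightarrow> f \<in> G c"
  shows "rainbow_factor F G (verts C) (insert p D)"
proof -
  have fin: "finite (edges C)"
    using C finite_subset[of "edges C" "Pow (verts C)"] is_graph_edge(1)[OF C(1)]
    by (auto simp: is_graph_def)
  have "card (edges C - {e}) = card D"
    using isomorphic_card_edges(2)[OF F C] D(3) e fin by simp
  then obtain \<phi> where \<phi>: "bij_betw \<phi> (edges C - {e}) D"
    using finite_same_card_bij fin D(1) by blast
  define \<psi> where "\<psi> = \<phi>(e := p)"
  have "bij_betw \<psi> (edges C - {e}) D \<longleftrightarrow> bij_betw \<phi> (edges C - {e}) D"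
    by (rule bij_betw_cong) (auto simp: \<psi>_def)
  moreover have "bij_betw \<psi> {e} {p}" by (simp add: \<psi>_def)
  ultimately have "bij_betw \<psi> ((edges C - {e}) \<union> {e}) (D \<union> {p})"
    using \<phi> D(2) by (intro bij_betw_combine) auto
  then have bij: "bij_betw \<psi> (edges C) (insert p D)"
    using e(1) by (simp add: insert_absorb)
  have "f \<in> G (\<psi> f)" if "f \<in> edges C" for f
  proof (cases "f = e")
    case True then show ?thesis using e by (simp add: \<psi>_def)
  next
    case False
    then have "\<phi> f \<in> D" using \<phi> that by (auto simp: bij_betw_def)
    then show ?thesis
      using False D(4) sub that is_graph_edge(1)[OF C(1)] by (auto simp: \<psi>_def)
  qed
  then show ?thesis
    unfolding rainbow_factor_def using tiling_singleton[OF C] bij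
    by (intro exI[of _ "{C}"] exI[of _ \<psi>]) auto
qed

lemma degree_into_Diff:
  assumes "finite B" "finite X"
  shows "real (degree_into E (X - B) v) \<ge> real (degree_into E X v) - real (card B)"
proof -
  have "degree_into E X v \<le> card ({w \<in> X - B. {v, w} \<in> E} \<union> B)"
    unfolding degree_into_def using assms by (intro card_mono) auto
  also have "\<dots> \<le> degree_into E (X - B) v + card B"
    unfolding degree_into_def by (rule card_Un_le)
  finally show ?thesis by linarith
qed

lemma degree_into_mono:
  "finite Y \<Longrightarrow> X \<subseteq> Y \<Longrightarrow> E \<subseteq> E' \<Longrightarrow> degree_into E X v \<le> degree_into E' Y v"
  unfolding degree_into_def by (rule card_mono) auto

lemma degree_into_le: "finite X \<Longrightarrow> degree_into E X v \<le> card X"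
  unfolding degree_into_def by (rule card_mono) auto

text \<open>The second demand on a threshold besides \<open>factor_threshold_bound\<close>: a
  prescribed colour can always be placed. Isolating it keeps the case distinction out of the rest of
  the argument.\<close>

definition special_copy_bound :: "'a graph \<Rightarrow> real \<Rightarrow> bool" where
  "special_copy_bound F \<delta> \<longleftrightarrow>
     (\<forall>\<epsilon>>0. \<exists>k\<^sub>0. \<forall>(X::nat set) E E'. finite X \<longrightarrow> k\<^sub>0 \<le> card X \<longrightarrow>
        simple_edges E \<longrightarrow> simple_edges E' \<longrightarrow>
        min_degree_ge E X (\<delta> + \<epsilon>) \<longrightarrow>
        min_degree_ge E' X (\<delta> + \<epsilon>) \<longrightarrow>
        has_special_copy F X E E')"

lemma tiling_of_threshold_bound:
  assumes b: "factor_threshold_bound F \<delta>" and e: "\<epsilon> > 0"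
  shows "\<exists>k\<^sub>0. \<forall>(X::nat set) E. finite X \<longrightarrow> k\<^sub>0 \<le> card X \<longrightarrow> card (verts F) dvd card X \<longrightarrow>
      simple_edges E \<longrightarrow>
      min_degree_ge E X (\<delta> + \<epsilon>) \<longrightarrow>
      (\<exists>K. tiling F X K \<and> (\<Union>C\<in>K. edges C) \<subseteq> E)"
proof -
  obtain n0 where n0: "\<And>n G. n \<ge> n0 \<Longrightarrow> card (verts F) dvd n \<Longrightarrow> is_graph (G::nat graph) \<Longrightarrow>
      card (verts G) = n \<Longrightarrow> real (min_degree G) \<ge> (\<delta> + \<epsilon>) * real n \<Longrightarrow> contains_factor F G"
    using b e unfolding factor_threshold_bound_def by blast
  have "\<exists>K. tiling F X K \<and> (\<Union>C\<in>K. edges C) \<subseteq> E"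
    \<comment> \<open>\<open>Suc n0\<close> makes \<open>X\<close> nonempty, so that
      \<open>min_degree\<close> is a minimum over a nonempty set.\<close>
    if X: "finite X" "Suc n0 \<le> card X" "card (verts F) dvd card X" "simple_edges E"
      and d: "min_degree_ge E X (\<delta> + \<epsilon>)" for X :: "nat set" and E
  proof -
    define G where "G = Graph X {e\<in>E. e \<subseteq> X}"
    have G: "is_graph G"
      using X by (auto simp: G_def is_graph_def nsets_def intro: card_ge_0_finite)
    have deg: "degree G v = degree_into E X v" if "v \<in> X" for v
      unfolding degree_def degree_into_def G_def using that by (auto intro!: arg_cong[of _ _ card])
    have "X \<noteq> {}" using X by auto
    then have "min_degree G \<in> degree G ` X"
      unfolding min_degree_def G_def using X(1) by (simp del: Min_in add: Min_in)
    then have "real (min_degree G) \<ge> (\<delta> + \<epsilon>) * real (card X)" using deg d by auto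
    then have "contains_factor F G" using n0[of "card X" G] X G by (simp add: G_def)
    then obtain H where H: "is_factor F X H" "edges H \<subseteq> {e\<in>E. e \<subseteq> X}"
      unfolding contains_factor_def G_def by auto
    then obtain K where "tiling F X K" "H = Graph X (\<Union>C\<in>K. edges C)"
      unfolding is_factor_def tiling_def by blast
    then show ?thesis using H by (intro exI[of _ K]) auto
  qed
  then show ?thesis by blast
qed

text \<open>Induction on \<open>P\<close>, with \<open>r = card (verts F)\<close> and
  \<open>t = card (edges F)\<close>. A copy that places \<open>p\<close> removes \<open>r\<close>
  vertices, \<open>p\<close> and \<open>t - 1\<close> colours of \<open>D\<close>, and lowers each
  degree by at most \<open>r\<close>. Therefore \<open>d\<close> is an absolute bound: lowering it
  by \<open>r\<close> each time leaves \<open>d - r * card P\<close> unchanged while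
  \<open>card X\<close> only decreases. When \<open>P\<close> is exhausted, an ordinary factor in
  \<open>E\<close> takes the rest of \<open>D\<close>.\<close>

lemma rainbow_factor_with_special_colours:
  assumes F: "is_graph F" and r: "card (verts F) > 0" and t: "card (edges F) > 0"
    and b: "factor_threshold_bound F \<delta>" and s: "special_copy_bound F \<delta>"
    and e: "\<epsilon> > 0" and \<delta>: "\<delta> \<ge> 0"
  shows "\<exists>k\<^sub>0. \<forall>P (X::nat set) D (G::'c \<Rightarrow> nat set set) E d. finite P \<longrightarrow> finite X \<longrightarrow> finite D \<longrightarrow> D \<inter> P = {} \<longrightarrow>
      k\<^sub>0 + card (verts F) * card P \<le> card X \<longrightarrow> card (verts F) dvd card X \<longrightarrow>
      (card D + card P) * card (verts F) = card (edges F) * card X \<longrightarrow>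
      (\<forall>c. simple_edges (G c)) \<longrightarrow> simple_edges E \<longrightarrow>
      (\<forall>c\<in>D. \<forall>e\<in>E. e \<subseteq> X \<longrightarrow> e \<in> G c) \<longrightarrow>
      (\<forall>v\<in>X. real (degree_into E X v) \<ge> d) \<longrightarrow>
      (\<forall>p\<in>P. \<forall>v\<in>X. real (degree_into (G p) X v) \<ge> d) \<longrightarrow>
      d - real (card (verts F) * card P) \<ge> (\<delta> + \<epsilon>) * real (card X) \<longrightarrow>
      rainbow_factor F G X (D \<union> P)"
proof -
  obtain k1 where k1: "\<And>(X::nat set) E. finite X \<Longrightarrow> k1 \<le> card X \<Longrightarrow> card (verts F) dvd card X \<Longrightarrow>
      simple_edges E \<Longrightarrow>
      min_degree_ge E X (\<delta> + \<epsilon>) \<Longrightarrow>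
      (\<exists>K. tiling F X K \<and> (\<Union>C\<in>K. edges C) \<subseteq> E)"
    using tiling_of_threshold_bound[OF b e] by blast
  obtain k2 where k2: "\<And>(X::nat set) E E'. finite X \<Longrightarrow> k2 \<le> card X \<Longrightarrow>
        simple_edges E \<Longrightarrow> simple_edges E' \<Longrightarrow>
        min_degree_ge E X (\<delta> + \<epsilon>) \<Longrightarrow>
        min_degree_ge E' X (\<delta> + \<epsilon>) \<Longrightarrow>
        has_special_copy F X E E'"
    using s[unfolded special_copy_bound_def, rule_format, OF e] by blast
  define k0 where "k0 = max k1 k2"
  have "rainbow_factor F G X (D \<union> P)"
    if "finite P" "finite X" "finite D" "D \<inter> P = {}"
      "k0 + card (verts F) * card P \<le> card X" "card (verts F) dvd card X"
      "(card D + card P) * card (verts F) = card (edges F) * card X"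
      "\<forall>c. simple_edges (G c)" "simple_edges E"
      "\<forall>c\<in>D. \<forall>e\<in>E. e \<subseteq> X \<longrightarrow> e \<in> G c"
      "\<forall>v\<in>X. real (degree_into E X v) \<ge> d"
      "\<forall>p\<in>P. \<forall>v\<in>X. real (degree_into (G p) X v) \<ge> d"
      "d - real (card (verts F) * card P) \<ge> (\<delta> + \<epsilon>) * real (card X)"
    for P :: "'c set" and X :: "nat set" and D G E d
    using that
  proof (induction P arbitrary: X D d rule: finite_induct)
    case empty
    have "\<exists>K. tiling F X K \<and> (\<Union>C\<in>K. edges C) \<subseteq> E"
    proof (rule k1)
      show "\<forall>v\<in>X. (\<delta> + \<epsilon>) * real (card X) \<le> real (degree_into E X v)"
        using empty by fastforce
    qed (use empty k0_def in auto)
    then obtain K where "tiling F X K" "(\<Union>C\<in>K. edges C) \<subseteq> E" by blast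
    then show ?case
      using rainbow_factor_same_graph[OF F r empty(1), of K E D G] empty by auto
  next
    case (insert p P)
    note pr = insert.prems
    have cP: "card (insert p P) = Suc (card P)" using insert by simp
    have dX: "d \<ge> (\<delta> + \<epsilon>) * real (card X)" using pr(12) by (smt (verit) of_nat_0_le_iff)
    have "\<exists>C. is_graph C \<and> isomorphic F C \<and> verts C \<subseteq> X \<and>
             (\<exists>e\<in>edges C. e \<in> G p \<and> edges C - {e} \<subseteq> E)"
    proof (rule k2)
      show "\<forall>v\<in>X. (\<delta> + \<epsilon>) * real (card X) \<le> real (degree_into E X v)"
        using pr(10) dX by fastforce
      show "\<forall>v\<in>X. (\<delta> + \<epsilon>) * real (card X) \<le> real (degree_into (G p) X v)"
        using pr(11) dX by fastforce
    qed (use pr k0_def in auto)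
    then obtain C e where C: "is_graph C" "isomorphic F C" "verts C \<subseteq> X" "e \<in> edges C" "e \<in> G p"
      "edges C - {e} \<subseteq> E" by blast
    have vC: "card (verts C) = card (verts F)" using isomorphic_card_edges[OF F C(1,2)] by simp
    have finC: "finite (verts C)" using C by (simp add: is_graph_def)
    have cX: "card (X - verts C) = card X - card (verts F)"
      using card_Diff_subset[OF finC C(3)] vC by simp
    have rX: "card (verts F) \<le> card X" using vC C(3) pr(1) by (metis card_mono)
    obtain m where m: "card X = card (verts F) * m" using pr(5) by (auto elim: dvdE)
    have "(card D + Suc (card P)) * card (verts F) = (card (edges F) * m) * card (verts F)"
      using pr(6) cP m by (simp add: mult_ac)
    then have Dm: "card D + Suc (card P) = card (edges F) * m"
      using r mult_right_cancel by (metis less_irrefl)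
    have mP: "m \<ge> Suc (card P)"
    proof -
      have "card (verts F) * Suc (card P) \<le> card (verts F) * m" using pr(4) unfolding cP m by linarith
      then show ?thesis by (rule mult_left_le_imp_le) (rule r)
    qed
    \<comment> \<open>With \<open>t = card (edges F)\<close>:
      \<open>card D = t * m - Suc (card P)\<close> is at least
      \<open>(t - 1) * Suc (card P)\<close>, because \<open>m \<ge> Suc (card P)\<close>.\<close>
    have tD: "card (edges F) - 1 \<le> card D"
    proof (cases "card P = 0")
      case True
      have "card (edges F) * 1 \<le> card (edges F) * m" using mP by (intro mult_le_mono) auto
      then show ?thesis using Dm True by linarith
    next
      case False
      have "card (edges F) * Suc (card P) \<le> card (edges F) * m" using mP by (intro mult_le_mono) auto
      then have "card (edges F) * Suc (card P) \<le> card D + Suc (card P)" using Dm by simp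
      moreover have "card (edges F) * card P \<ge> card P" using t by simp
      ultimately show ?thesis unfolding mult_Suc_right by linarith
    qed
    then obtain D1 where D1: "D1 \<subseteq> D" "card D1 = card (edges F) - 1"
      using obtain_subset_with_card_n by metis
    have finD1: "finite D1" using D1 pr(2) finite_subset by blast
    have one: "rainbow_factor F G (verts C) (insert p D1)"
    proof (rule rainbow_factor_special_copy[where G = G and p = p and e = e and E = E, OF F C(1,2,4,5,6) finD1])
      show "p \<notin> D1" using D1 pr(3) by blast
      show "card D1 + 1 = card (edges F)" using D1 t by simp
      show "f \<in> G c" if "c \<in> D1" "f \<in> E" "f \<subseteq> verts C" for c f
        using pr(9) that D1 C(3) by blast
    qed
    have two: "rainbow_factor F G (X - verts C) ((D - D1) \<union> P)"
    proof (rule insert.IH[where d = "d - real (card (verts F))"])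
      show "finite (X - verts C)" "finite (D - D1)" using pr by auto
      show "(D - D1) \<inter> P = {}" using pr(3) by blast
      show "k0 + card (verts F) * card P \<le> card (X - verts C)" using pr(4) cP cX by simp
      show "card (verts F) dvd card (X - verts C)"
        using cX m by (metis dvd_triv_left dvd_diff_nat mult.right_neutral)
      have "card (D - D1) = card D - (card (edges F) - 1)" using card_Diff_subset[OF finD1 D1(1)] D1 by simp
      then have "card (D - D1) + card P = card (edges F) * m - card (edges F)" using Dm tD t by linarith
      then have "card (D - D1) + card P = card (edges F) * (m - 1)" by (simp add: diff_mult_distrib2)
      moreover have "card (X - verts C) = card (verts F) * (m - 1)"
        using cX m by (simp add: diff_mult_distrib2)
      ultimately show "(card (D - D1) + card P) * card (verts F) = card (edges F) * card (X - verts C)"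
        by (simp add: mult_ac)
      show "\<forall>c. simple_edges (G c)" "simple_edges E" using pr by auto
      show "\<forall>c\<in>D - D1. \<forall>e\<in>E. e \<subseteq> X - verts C \<longrightarrow> e \<in> G c" using pr(9) by blast
      show "\<forall>v\<in>X - verts C. d - real (card (verts F)) \<le> real (degree_into E (X - verts C) v)"
        using pr(10) degree_into_Diff[OF finC pr(1)] vC by (smt (verit) DiffD1)
      show "\<forall>q\<in>P. \<forall>v\<in>X - verts C. d - real (card (verts F)) \<le> real (degree_into (G q) (X - verts C) v)"
        using pr(11) degree_into_Diff[OF finC pr(1)] vC by (smt (verit) DiffD1 insertCI)
      have "d - real (card (verts F)) - real (card (verts F) * card P) \<ge> (\<delta> + \<epsilon>) * real (card X)"
        using pr(12) cP by simp
      moreover have "(\<delta> + \<epsilon>) * real (card X) \<ge> (\<delta> + \<epsilon>) * real (card (X - verts C))"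
        using \<delta> e cX by (intro mult_left_mono) auto
      ultimately show "(\<delta> + \<epsilon>) * real (card (X - verts C)) \<le> d - real (card (verts F)) - real (card (verts F) * card P)"
        by linarith
    qed
    have "rainbow_factor F G (verts C \<union> (X - verts C)) (insert p D1 \<union> ((D - D1) \<union> P))"
      by (rule rainbow_factor_Un[OF one two]) (use pr(3) insert.hyps D1 in auto)
    moreover have "verts C \<union> (X - verts C) = X" using C(3) by blast
    moreover have "insert p D1 \<union> ((D - D1) \<union> P) = D \<union> insert p P" using D1 by blast
    ultimately show ?case by simp
  qed
  then show ?thesis by blast
qed

section \<open>Copies with one edge in a second graph\<close>

lemma pigeonhole_fibre:
  assumes "finite S" "finite B" "B \<noteq> {}" "f \<in> S \<rightarrow> B" "card B * s \<le> card S"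
  obtains y where "y \<in> B" "s \<le> card {x \<in> S. f x = y}"
proof -
  obtain y where y: "y \<in> B" "card (f -` {y} \<inter> S) * card B \<ge> card S"
    using pigeonhole_card[OF assms(4,1,2,3)] by blast
  have "f -` {y} \<inter> S = {x \<in> S. f x = y}" by auto
  then have "s * card B \<le> card {x \<in> S. f x = y} * card B"
    using y(2) assms(5) by (metis mult.commute order_trans)
  moreover have "card B > 0" using assms by (simp add: card_gt_0_iff)
  ultimately have "s \<le> card {x \<in> S. f x = y}" by (rule mult_right_le_imp_le)
  then show thesis using that y(1) by blast
qed

lemma sum_card_swap:
  assumes "finite A" "finite B"
  shows "(\<Sum>a\<in>A. card {b \<in> B. R a b}) = (\<Sum>b\<in>B. card {a \<in> A. R a b})"
proof -
  have "(\<Sum>a\<in>A. card {b \<in> B. R a b}) = (\<Sum>a\<in>A. \<Sum>b\<in>B. if R a b then 1 else 0)"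
    using assms(2) by (simp only: card_eq_sum sum.inter_filter)
  also have "\<dots> = (\<Sum>b\<in>B. \<Sum>a\<in>A. if R a b then 1 else 0)" by (rule sum.swap)
  also have "\<dots> = (\<Sum>b\<in>B. card {a \<in> A. R a b})"
    using assms(1) by (simp only: card_eq_sum sum.inter_filter)
  finally show ?thesis .
qed

text \<open>The induction step of the Erdos--Stone theorem.\<close>

lemma extend_multipartite:
  fixes E :: "'b set set" and \<eta> :: real
  assumes X: "finite X" and j: "j \<ge> 1" and \<eta>: "\<eta> > 0"
    and A: "\<And>i. i < j \<Longrightarrow> A i \<subseteq> X \<and> card (A i) = S"
    and disj: "\<And>i i'. i < j \<Longrightarrow> i' < j \<Longrightarrow> i \<noteq> i' \<Longrightarrow> A i \<inter> A i' = {}"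
    and deg: "\<And>i v. i < j \<Longrightarrow> v \<in> A i \<Longrightarrow> real (degree_into E X v) \<ge> (1 - 1 / real j + \<eta>) * real (card X)"
    and S: "2 * real s \<le> real j * \<eta> * real S"
    and N: "\<eta> / 2 * real (card X) \<ge> real (j * S + 2 ^ (j * S) * s)"
  shows "\<exists>B Z. (\<forall>i<j. B i \<subseteq> A i \<and> card (B i) = s) \<and> Z \<subseteq> X \<and> card Z = s \<and>
    (\<forall>i<j. \<forall>x\<in>B i. \<forall>z\<in>Z. {x, z} \<in> E)"
proof (cases "s = 0")
  case True
  then show ?thesis by (intro exI[of _ "\<lambda>_. {}"] exI[of _ "{}"]) auto
next
  case False
  then have Spos: "S > 0" using S by (cases "S = 0") auto
  define W where "W = (\<Union>i<j. A i)"
  have WX: "W \<subseteq> X" using A by (auto simp: W_def)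
  then have finW: "finite W" using X finite_subset by blast
  have finA: "finite (A i)" if "i < j" for i using A[OF that] X finite_subset by blast
  have "card W = (\<Sum>i<j. card (A i))"
    unfolding W_def using finA disj by (intro card_UN_disjoint) auto
  then have cW: "card W = j * S" using A by simp
  define d where "d = (\<lambda>z. card {w \<in> W. {w, z} \<in> E})"
  have dle: "d z \<le> j * S" for z
    unfolding d_def cW[symmetric] by (rule card_mono) (use finW in auto)
  \<comment> \<open>The other \<open>j - 1\<close> parts hold only \<open>(j - 1) * S\<close>
    vertices, so \<open>\<theta>\<close> neighbours in \<open>W\<close> force
    \<open>j * \<eta> * S / 2 \<ge> s\<close> neighbours in every part.\<close>
  define \<theta> where "\<theta> = (real j - 1) * real S + real j * \<eta> * real S / 2"
  have \<theta>: "\<theta> \<ge> 0" using j \<eta> by (auto simp: \<theta>_def)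
  define Z' where "Z' = {z \<in> X. real (d z) \<ge> \<theta>}"
  have finZ': "finite Z'" using X by (simp add: Z'_def)
  \<comment> \<open>Double counting of edges between \<open>W\<close> and \<open>X\<close>: the
    average of \<open>d z\<close> is at least \<open>(j - 1) * S + j * \<eta> * S\<close>, which
    exceeds \<open>\<theta>\<close> by \<open>j * \<eta> * S / 2\<close>. Since
    \<open>d z \<le> j * S\<close>, at least \<open>\<eta> / 2 * card X\<close> vertices reach
    \<open>\<theta>\<close>.\<close>
  have "(real j * real S) * ((1 - 1 / real j + \<eta>) * real (card X))
      = (\<Sum>w\<in>W. (1 - 1 / real j + \<eta>) * real (card X))" using cW by simp
  also have "\<dots> \<le> (\<Sum>w\<in>W. real (degree_into E X w))"
    using deg by (intro sum_mono) (auto simp: W_def)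
  also have "\<dots> = real (\<Sum>z\<in>X. d z)"
    unfolding d_def degree_into_def
    using sum_card_swap[OF finW X, of "\<lambda>w z. {w, z} \<in> E"] by (simp flip: of_nat_sum)
  also have "\<dots> = (\<Sum>z\<in>X. real (d z))" by simp
  also have "\<dots> \<le> (\<Sum>z\<in>X. (if z \<in> Z' then real j * real S else 0) + \<theta>)"
  proof (rule sum_mono)
    fix z assume "z \<in> X"
    have "real (d z) \<le> real (j * S)" using dle by (simp only: of_nat_le_iff)
    then show "real (d z) \<le> (if z \<in> Z' then real j * real S else 0) + \<theta>"
      using \<theta> \<open>z \<in> X\<close> by (auto simp: Z'_def)
  qed
  also have "\<dots> = real (card Z') * (real j * real S) + real (card X) * \<theta>"
  proof -
    have "{x \<in> X. x \<in> Z'} = Z'" by (auto simp: Z'_def)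
    then show ?thesis using X by (simp add: sum.distrib flip: sum.inter_filter)
  qed
  finally have *: "(real j * real S) * ((1 - 1 / real j + \<eta>) * real (card X))
      \<le> real (card Z') * (real j * real S) + real (card X) * \<theta>" .
  have jS: "real j * real S > 0" using j Spos by simp
  have "(real j * real S) * ((1 - 1 / real j + \<eta>) * real (card X)) - real (card X) * \<theta>
     = (real j * real S) * (\<eta> / 2 * real (card X))"
    using j by (simp add: \<theta>_def field_simps)
  then have "(real j * real S) * (\<eta> / 2 * real (card X)) \<le> (real j * real S) * real (card Z')"
    using * by (simp add: mult.commute)
  then have "\<eta> / 2 * real (card X) \<le> real (card Z')"
    using mult_left_le_imp_le jS by blast
  then have "real (j * S + 2 ^ (j * S) * s) \<le> real (card Z')" using N by linarith
  then have cZ': "j * S + 2 ^ (j * S) * s \<le> card Z'" by (simp only: of_nat_le_iff)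
  define Z1 where "Z1 = Z' - W"
  have cZ1: "2 ^ (j * S) * s \<le> card Z1"
    using diff_card_le_card_Diff[OF finW, of Z'] cZ' cW by (simp add: Z1_def)
  \<comment> \<open>There are \<open>2 ^ (j * S)\<close> possible neighbourhoods in
    \<open>W\<close>. The new part consists of \<open>s\<close> vertices with the same neighbourhood
    \<open>y\<close>, and the old parts shrink into \<open>y\<close>.\<close>
  obtain y where y: "y \<in> Pow W" "s \<le> card {z \<in> Z1. {w \<in> W. {w, z} \<in> E} = y}"
  proof (rule pigeonhole_fibre[of Z1 "Pow W" "\<lambda>z. {w \<in> W. {w, z} \<in> E}" s])
    show "card (Pow W) * s \<le> card Z1" using cZ1 finW cW by (simp add: card_Pow)
  qed (use finZ' finW in \<open>auto simp: Z1_def\<close>)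
  obtain Z where Z: "Z \<subseteq> {z \<in> Z1. {w \<in> W. {w, z} \<in> E} = y}" "card Z = s"
    using obtain_subset_with_card_n[OF y(2)] by blast
  then obtain z where z: "z \<in> Z" using False by fastforce
  then have "real (card y) \<ge> \<theta>" using Z by (auto simp: Z1_def Z'_def d_def)
  have "s \<le> card (y \<inter> A i)" if i: "i < j" for i
  proof -
    have "card y \<le> card ((y \<inter> A i) \<union> (W - A i))"
      using y finW finA[OF i] by (intro card_mono) auto
    also have "\<dots> \<le> card (y \<inter> A i) + card (W - A i)" by (rule card_Un_le)
    also have "card (W - A i) = j * S - S"
      using card_Diff_subset[OF finA[OF i], of W] i A cW by (auto simp: W_def)
    finally have "real (card y) \<le> real (card (y \<inter> A i)) + (real j - 1) * real S"
    proof -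
      assume "card y \<le> card (y \<inter> A i) + (j * S - S)"
      moreover have "S \<le> j * S" using j by simp
      ultimately have "real (card y) \<le> real (card (y \<inter> A i)) + (real (j * S) - real S)"
        by linarith
      then show ?thesis by (simp add: algebra_simps)
    qed
    then have "real j * \<eta> * real S / 2 \<le> real (card (y \<inter> A i))"
      using \<open>real (card y) \<ge> \<theta>\<close> by (simp add: \<theta>_def)
    then have "real s \<le> real (card (y \<inter> A i))" using S by linarith
    then show ?thesis by simp
  qed
  then have "\<forall>i. \<exists>b. i < j \<longrightarrow> b \<subseteq> y \<inter> A i \<and> card b = s"
    using obtain_subset_with_card_n by metis
  then obtain B where B: "\<And>i. i < j \<Longrightarrow> B i \<subseteq> y \<inter> A i \<and> card (B i) = s" by metis
  show ?thesis
  proof (intro exI[of _ B] exI[of _ Z] conjI)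
    show "\<forall>i<j. B i \<subseteq> A i \<and> card (B i) = s" using B by blast
    show "Z \<subseteq> X" using Z(1) by (auto simp: Z1_def Z'_def)
    show "card Z = s" by (rule Z)
    show "\<forall>i<j. \<forall>x\<in>B i. \<forall>z\<in>Z. {x, z} \<in> E" using B Z(1) by blast
  qed
qed

lemma degree_into_Int:
  assumes "finite X"
  shows "degree_into E X v + degree_into E' X v \<le> degree_into (E \<inter> E') X v + card X"
proof -
  let ?A = "{w \<in> X. {v, w} \<in> E}" and ?B = "{w \<in> X. {v, w} \<in> E'}"
  have "card ?A + card ?B = card (?A \<union> ?B) + card (?A \<inter> ?B)"
    using assms by (intro card_Un_Int) auto
  moreover have "card (?A \<union> ?B) \<le> card X" using assms by (intro card_mono) auto
  moreover have "?A \<inter> ?B = {w \<in> X. {v, w} \<in> E \<inter> E'}" by auto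
  ultimately show ?thesis by (simp add: degree_into_def)
qed

text \<open>Edges inside a part are allowed. Disjointness of the parts follows from
  \<open>simple_edges E\<close>, as a common vertex \<open>x\<close> would give
  \<open>{x, x} \<in> E\<close>.\<close>

definition complete_multipartite :: "'b set set \<Rightarrow> 'b set \<Rightarrow> nat \<Rightarrow> nat \<Rightarrow> (nat \<Rightarrow> 'b set) \<Rightarrow> bool" where
  "complete_multipartite E X j s A \<longleftrightarrow> (\<forall>i<j. A i \<subseteq> X \<and> card (A i) = s) \<and>
     (\<forall>i<j. \<forall>i'<j. i \<noteq> i' \<longrightarrow> (\<forall>x\<in>A i. \<forall>y\<in>A i'. {x, y} \<in> E))"

lemma complete_multipartite_disjoint:
  assumes "complete_multipartite E X j s A" "simple_edges E" "i < j" "i' < j" "i \<noteq> i'"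
  shows "A i \<inter> A i' = {}"
proof (rule ccontr)
  assume "A i \<inter> A i' \<noteq> {}"
  then obtain x where "x \<in> A i" "x \<in> A i'" by blast
  then have "{x, x} \<in> E" using assms unfolding complete_multipartite_def by blast
  then show False using assms(2) by force
qed

text \<open>\<open>E'\<close> may be smaller than \<open>E\<close>: a single set is complete in the
  empty edge set, which starts the induction.\<close>

lemma complete_multipartite_Suc:
  fixes \<eta> :: real
  assumes X: "finite X" and j: "j \<ge> 1" and \<eta>: "\<eta> > 0"
    and A: "complete_multipartite E' X j S A" and E': "simple_edges E'" "E' \<subseteq> E"
    and deg: "\<And>v. v \<in> X \<Longrightarrow> real (degree_into E X v) \<ge> (1 - 1 / real j + \<eta>) * real (card X)"
    and S: "2 * real s \<le> real j * \<eta> * real S"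
    and N: "\<eta> / 2 * real (card X) \<ge> real (j * S + 2 ^ (j * S) * s)"
  obtains B where "complete_multipartite E X (Suc j) s B" "\<And>i. i < j \<Longrightarrow> B i \<subseteq> A i"
proof -
  have AX: "A i \<subseteq> X \<and> card (A i) = S" if "i < j" for i
    using A that unfolding complete_multipartite_def by blast
  have "\<exists>B Z. (\<forall>i<j. B i \<subseteq> A i \<and> card (B i) = s) \<and> Z \<subseteq> X \<and> card Z = s \<and>
      (\<forall>i<j. \<forall>x\<in>B i. \<forall>z\<in>Z. {x, z} \<in> E)"
  proof (rule extend_multipartite[OF X j \<eta> _ _ _ S N])
    show "A i \<inter> A i' = {}" if "i < j" "i' < j" "i \<noteq> i'" for i i'
      using complete_multipartite_disjoint[OF A E'(1) that] .
    show "(1 - 1 / real j + \<eta>) * real (card X) \<le> real (degree_into E X v)" if "i < j" "v \<in> A i" for i v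
      using deg AX that by blast
  qed (use AX in blast)
  then obtain B Z where BZ: "\<And>i. i < j \<Longrightarrow> B i \<subseteq> A i \<and> card (B i) = s" "Z \<subseteq> X" "card Z = s"
      "\<And>i x z. i < j \<Longrightarrow> x \<in> B i \<Longrightarrow> z \<in> Z \<Longrightarrow> {x, z} \<in> E" by blast
  define B' where "B' = (\<lambda>i. if i < j then B i else Z)"
  show thesis
  proof (rule that[of B'])
    show "B' i \<subseteq> A i" if "i < j" for i using BZ(1) that by (simp add: B'_def)
    have "{x, y} \<in> E" if "i < Suc j" "i' < Suc j" "i \<noteq> i'" "x \<in> B' i" "y \<in> B' i'" for i i' x y
    proof -
      consider "i < j" "i' < j" | "i < j" "i' = j" | "i = j" "i' < j" using \<open>i < Suc j\<close> \<open>i' < Suc j\<close> \<open>i \<noteq> i'\<close> by linarith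
      then show ?thesis
      proof cases
        case 1
        then have "x \<in> A i" "y \<in> A i'" using that BZ(1) by (auto simp: B'_def)
        then show ?thesis using A E'(2) 1 \<open>i \<noteq> i'\<close> unfolding complete_multipartite_def by blast
      next
        case 2 then show ?thesis using that BZ(4)[OF 2(1)] by (simp add: B'_def)
      next
        case 3 then show ?thesis using that BZ(4)[OF 3(2), of y x] by (simp add: B'_def insert_commute)
      qed
    qed
    moreover have "B' i \<subseteq> X \<and> card (B' i) = s" for i
      using BZ(1)[of i] BZ(2,3) AX[of i] by (auto simp: B'_def)
    ultimately show "complete_multipartite E X (Suc j) s B'"
      unfolding complete_multipartite_def by blast
  qed
qed

lemma ex_nat_mult_ge:
  fixes c :: real assumes "c > 0" shows "\<exists>n. \<forall>m\<ge>n. c * real m \<ge> x"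
proof -
  obtain n where "x / c < real n" using reals_Archimedean2 by blast
  then have "x \<le> c * real m" if "n \<le> m" for m
  proof -
    have "x / c \<le> real m" using \<open>x / c < real n\<close> that by linarith
    then show ?thesis using assms by (simp add: pos_divide_le_eq mult.commute)
  qed
  then show ?thesis by blast
qed

lemma ex_nat_mult_ge1:
  fixes c :: real assumes "c > 0" shows "\<exists>n. c * real n \<ge> x"
  using ex_nat_mult_ge[OF assms, of x] by blast

text \<open>For two parts the extension step runs in \<open>E \<inter> E'\<close>, where degrees are
  at least \<open>2 * \<eta> * card X\<close> because both graphs exceed one half by
  \<open>\<eta>\<close>. Further parts are added in \<open>E\<close> alone; the first two only
  shrink, so the edges between them stay in \<open>E'\<close>.\<close>

lemma complete_multipartite_special_edges:
  fixes \<eta> :: real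
  assumes \<eta>: "\<eta> > 0" and j: "j \<ge> 2"
  shows "\<exists>N0. \<forall>(X::'b set) E E'. finite X \<longrightarrow> N0 \<le> card X \<longrightarrow>
      simple_edges E \<longrightarrow> simple_edges E' \<longrightarrow>
      min_degree_ge E X (1 / 2 + \<eta>) \<longrightarrow>
      min_degree_ge E' X (1 / 2 + \<eta>) \<longrightarrow>
      min_degree_ge E X (1 - 1 / real (j - 1) + \<eta>) \<longrightarrow>
      (\<exists>A. complete_multipartite E X j s A \<and> (\<forall>x\<in>A 0. \<forall>y\<in>A 1. {x, y} \<in> E'))"
  using j
proof (induction j arbitrary: s rule: dec_induct)
  case base
  obtain S where S: "2 * \<eta> * real S \<ge> 2 * real s" using ex_nat_mult_ge1[of "2 * \<eta>" "2 * real s"] \<eta> by auto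
  obtain N1 where N1: "\<And>m. m \<ge> N1 \<Longrightarrow> \<eta> * real m \<ge> real (1 * S + 2 ^ (1 * S) * s)"
    using ex_nat_mult_ge[OF \<eta>] by blast
  have "\<exists>A. complete_multipartite E X 2 s A \<and> (\<forall>x\<in>A 0. \<forall>y\<in>A 1. {x, y} \<in> E')"
    if X: "finite X" "max N1 S \<le> card X" and E: "simple_edges E" "simple_edges E'"
      and d: "min_degree_ge E X (1 / 2 + \<eta>)"
       "min_degree_ge E' X (1 / 2 + \<eta>)" for X :: "'b set" and E E'
  proof -
    obtain A where A: "A \<subseteq> X" "card A = S" using obtain_subset_with_card_n[of S X] X by auto
    have A1: "complete_multipartite {} X 1 S (\<lambda>_. A)"
      using A by (auto simp: complete_multipartite_def)
    obtain B where B: "complete_multipartite (E \<inter> E') X (Suc 1) s B"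
    proof (rule complete_multipartite_Suc[OF X(1) _ _ A1, where \<eta> = "2 * \<eta>" and E = "E \<inter> E'" and s = s])
      fix v assume v: "v \<in> X"
      have "real (degree_into E X v) + real (degree_into E' X v) \<le> real (degree_into (E \<inter> E') X v) + real (card X)"
        using degree_into_Int[OF X(1), of E v E'] by linarith
      then show "(1 - 1 / real 1 + 2 * \<eta>) * real (card X) \<le> real (degree_into (E \<inter> E') X v)"
        using d v by (fastforce simp: algebra_simps)
    next
      show "real (1 * S + 2 ^ (1 * S) * s) \<le> 2 * \<eta> / 2 * real (card X)" using N1[of "card X"] X by simp
      show "2 * real s \<le> real 1 * (2 * \<eta>) * real S" using S by simp
    qed (use \<eta> in auto)
    have "complete_multipartite E X 2 s B"
      using B unfolding complete_multipartite_def by (simp add: numeral_2_eq_2)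
    moreover have "\<forall>x\<in>B 0. \<forall>y\<in>B 1. {x, y} \<in> E'"
    proof -
      have "{x, y} \<in> E \<inter> E'" if "x \<in> B 0" "y \<in> B 1" for x y
        using B that unfolding complete_multipartite_def
        by (metis One_nat_def lessI zero_less_Suc zero_neq_one)
      then show ?thesis by blast
    qed
    ultimately show ?thesis by blast
  qed
  then show ?case by (intro exI[of _ "max N1 S"]) blast
next
  case (step j)
  have jpos: "real j * \<eta> > 0" using step(1) \<eta> by simp
  obtain S where S: "(real j * \<eta>) * real S \<ge> 2 * real s" using ex_nat_mult_ge1[OF jpos] by blast
  obtain N1 where N1: "\<And>m. m \<ge> N1 \<Longrightarrow> \<eta> / 2 * real m \<ge> real (j * S + 2 ^ (j * S) * s)"
    using ex_nat_mult_ge[OF half_gt_zero[OF \<eta>]] by blast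
  obtain N2 where N2': "\<forall>(X::'b set) E E'. finite X \<longrightarrow> N2 \<le> card X \<longrightarrow>
      simple_edges E \<longrightarrow> simple_edges E' \<longrightarrow>
      min_degree_ge E X (1 / 2 + \<eta>) \<longrightarrow>
      min_degree_ge E' X (1 / 2 + \<eta>) \<longrightarrow>
      min_degree_ge E X (1 - 1 / real (j - 1) + \<eta>) \<longrightarrow>
      (\<exists>A. complete_multipartite E X j S A \<and> (\<forall>x\<in>A 0. \<forall>y\<in>A 1. {x, y} \<in> E'))"
    using step.IH[of S] by (elim exE)
  note N2 = N2'[rule_format (no_asm)]
  have "\<exists>A. complete_multipartite E X (Suc j) s A \<and> (\<forall>x\<in>A 0. \<forall>y\<in>A 1. {x, y} \<in> E')"
    if X: "finite X" "max N1 N2 \<le> card X" and E: "simple_edges E" "simple_edges E'"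
      and d: "min_degree_ge E X (1 / 2 + \<eta>)"
       "min_degree_ge E' X (1 / 2 + \<eta>)"
       "min_degree_ge E X (1 - 1 / real (Suc j - 1) + \<eta>)"
    for X :: "'b set" and E E'
  proof -
    have "1 / real j \<le> 1 / real (j - 1)" using step(1) by (intro divide_left_mono) auto
    then have le: "(1 - 1 / real (j - 1) + \<eta>) * real (card X) \<le> (1 - 1 / real j + \<eta>) * real (card X)"
      by (intro mult_right_mono) auto
    have "\<exists>A. complete_multipartite E X j S A \<and> (\<forall>x\<in>A 0. \<forall>y\<in>A 1. {x, y} \<in> E')"
    proof (rule N2[OF X(1) _ E d(1,2)])
      show "\<forall>v\<in>X. (1 - 1 / real (j - 1) + \<eta>) * real (card X) \<le> real (degree_into E X v)"
        using d(3) le by fastforce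
    qed (use X in auto)
    then obtain A where A: "complete_multipartite E X j S A" "\<forall>x\<in>A 0. \<forall>y\<in>A 1. {x, y} \<in> E'" by blast
    obtain B where B: "complete_multipartite E X (Suc j) s B" "\<And>i. i < j \<Longrightarrow> B i \<subseteq> A i"
    proof (rule complete_multipartite_Suc[OF X(1) _ \<eta> A(1) E(1), where E = E and s = s])
      show "real (j * S + 2 ^ (j * S) * s) \<le> \<eta> / 2 * real (card X)" using N1 X by simp
    qed (use S d(3) step(1) in auto)
    have "\<forall>x\<in>B 0. \<forall>y\<in>B 1. {x, y} \<in> E'" 
    proof -
      have "B 0 \<subseteq> A 0" "B 1 \<subseteq> A 1" using B(2) step(1) by auto
      then show ?thesis using A(2) by blast
    qed
    then show ?thesis using B(1) by blast
  qed
  then show ?case by (intro exI[of _ "max N1 N2"]) blast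
qed

section \<open>Embedding F along a proper colouring; the chromatic lower bound\<close>

lemma embedding_by_parts:
  fixes A :: "nat \<Rightarrow> 'b set"
  assumes V: "finite V" and fin: "\<And>w. w \<in> V \<Longrightarrow> finite (A (c w))"
    and card: "\<And>w. w \<in> V \<Longrightarrow> card {x \<in> V. c x = c w} \<le> card (A (c w))"
    and disj: "\<And>x y. x \<in> V \<Longrightarrow> y \<in> V \<Longrightarrow> c x \<noteq> c y \<Longrightarrow> A (c x) \<inter> A (c y) = {}"
  obtains h where "inj_on h V" "\<And>w. w \<in> V \<Longrightarrow> h w \<in> A (c w)"
proof -
  have "\<forall>w. \<exists>g. w \<in> V \<longrightarrow> g ` {x \<in> V. c x = c w} \<subseteq> A (c w) \<and> inj_on g {x \<in> V. c x = c w}"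
    using card_le_inj[OF _ fin card] V by auto
  then have "\<forall>i. \<exists>g. i \<in> c ` V \<longrightarrow> g ` {x \<in> V. c x = i} \<subseteq> A i \<and> inj_on g {x \<in> V. c x = i}"
    by auto
  then obtain g where g: "\<And>i. i \<in> c ` V \<Longrightarrow> g i ` {x \<in> V. c x = i} \<subseteq> A i \<and> inj_on (g i) {x \<in> V. c x = i}"
    by metis
  define h where "h = (\<lambda>w. g (c w) w)"
  have hA: "h w \<in> A (c w)" if "w \<in> V" for w using g[of "c w"] that by (auto simp: h_def)
  have "inj_on h V"
  proof (rule inj_onI)
    fix x y assume xy: "x \<in> V" "y \<in> V" "h x = h y"
    have "c x = c y" using hA[OF xy(1)] hA[OF xy(2)] disj[OF xy(1,2)] xy(3) by auto
    then show "x = y" using g[of "c x"] xy by (auto simp: h_def inj_on_def)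
  qed
  then show thesis using that hA by blast
qed

definition colourable :: "'a graph \<Rightarrow> nat \<Rightarrow> bool" where
  "colourable F q \<longleftrightarrow> (\<exists>\<chi>. (\<forall>v\<in>verts F. \<chi> v < q) \<and> (\<forall>u v. {u, v} \<in> edges F \<longrightarrow> \<chi> u \<noteq> \<chi> v))"

text \<open>The complete p-partite graph on the residue classes modulo \<open>p\<close> has minimum
  degree at least \<open>(1 - 1 / p) * n\<close>, but a copy of F in it would yield a colouring of F
  with \<open>p\<close> colours. So it has no factor, however large \<open>n\<close> is.\<close>

lemma factor_threshold_bound_ge_of_not_colourable:
  assumes F: "is_graph F" "edges F \<noteq> {}" and p: "p \<ge> 1" "\<not> colourable F p"
    and b: "factor_threshold_bound F \<delta>"
  shows "\<delta> \<ge> 1 - 1 / real p"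
proof (rule ccontr)
  assume "\<not> \<delta> \<ge> 1 - 1 / real p"
  then have "1 - 1 / real p - \<delta> > 0" by simp
  with b obtain n0 where n0: "\<And>n G. n \<ge> n0 \<Longrightarrow> card (verts F) dvd n \<Longrightarrow> is_graph (G::nat graph) \<Longrightarrow>
      card (verts G) = n \<Longrightarrow> real (min_degree G) \<ge> (\<delta> + (1 - 1 / real p - \<delta>)) * real n \<Longrightarrow> contains_factor F G"
    unfolding factor_threshold_bound_def by blast
  obtain e where e: "e \<in> edges F" using F by blast
  then obtain a b where "e = {a, b}" "a \<in> verts F" using is_graph_edgeE[OF F(1)] by metis
  then have r: "card (verts F) > 0" using F by (auto simp: is_graph_def card_gt_0_iff)
  define M where "M = card (verts F) * Suc n0"
  define n where "n = p * M"
  have M: "M > 0" "n0 \<le> M" using r by (auto simp: M_def trans_le_add2)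
  have n: "n > 0" "n0 \<le> n" using M p by (auto simp: n_def intro: order_trans[of _ M])
  define G where "G = Graph {..<n} {{x, y} |x y. x < n \<and> y < n \<and> x mod p \<noteq> y mod p}"
  have edge: "{x, y} \<in> edges G \<longleftrightarrow> x < n \<and> y < n \<and> x mod p \<noteq> y mod p" for x y
    by (auto simp: G_def doubleton_eq_iff)
  have G: "is_graph G" by (auto simp: is_graph_def G_def)
  have deg: "n - M \<le> degree G x" if "x < n" for x
  proof -
    have "{w. w < n \<and> w mod p = x mod p} \<subseteq> (\<lambda>k. p * k + x mod p) ` {..<M}"
    proof
      fix w assume w: "w \<in> {w. w < n \<and> w mod p = x mod p}"
      then have "w = p * (w div p) + x mod p" using mult_div_mod_eq[of p w] by simp
      moreover have "w div p < M" using w p by (simp add: n_def less_mult_imp_div_less mult.commute)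
      ultimately show "w \<in> (\<lambda>k. p * k + x mod p) ` {..<M}" by blast
    qed
    then have c: "card {w. w < n \<and> w mod p = x mod p} \<le> M"
      using surj_card_le[of "{..<M}" "{w. w < n \<and> w mod p = x mod p}" "\<lambda>k. p * k + x mod p"] by simp
    have "{w \<in> verts G. {x, w} \<in> edges G} = {..<n} - {w. w < n \<and> w mod p = x mod p}"
      using that by (auto simp: edge) (auto simp: G_def)
    then have "degree G x = card ({..<n} - {w. w < n \<and> w mod p = x mod p})" by (simp add: degree_def)
    also have "\<dots> = n - card {w. w < n \<and> w mod p = x mod p}" by (subst card_Diff_subset) auto
    finally show ?thesis using c by simp
  qed
  have "min_degree G \<in> degree G ` {..<n}"
    unfolding min_degree_def using n by (simp add: G_def del: Min_in) (rule Min_in, auto)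
  then have "n - M \<le> min_degree G" using deg by auto
  then have "real n - real M \<le> real (min_degree G)" by linarith
  moreover have "real n - real M = (\<delta> + (1 - 1 / real p - \<delta>)) * real n"
    using p by (simp add: n_def field_simps)
  ultimately have "contains_factor F G"
    by (intro n0[of n]) (use n G in \<open>auto simp: G_def n_def M_def\<close>)
  then obtain H where H: "is_factor F {..<n} H" "edges H \<subseteq> edges G"
    unfolding contains_factor_def by (auto simp: G_def)
  then obtain K where K: "\<forall>C\<in>K. is_graph C \<and> isomorphic F C" "(\<Union>C\<in>K. verts C) = {..<n}"
      "H = Graph {..<n} (\<Union>C\<in>K. edges C)" unfolding is_factor_def by blast
  then obtain C where C: "C \<in> K" using n by fastforce
  then obtain f where f: "\<forall>u\<in>verts F. \<forall>v\<in>verts F. {u, v} \<in> edges F \<longleftrightarrow> {f u, f v} \<in> edges C"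
    using K(1) unfolding isomorphic_def by blast
  have "colourable F p"
    unfolding colourable_def
  proof (intro exI[of _ "\<lambda>u. f u mod p"] conjI ballI allI impI)
    show "f v mod p < p" for v using p by simp
    fix u v assume uv: "{u, v} \<in> edges F"
    then have "u \<in> verts F" "v \<in> verts F" using is_graph_edge(1)[OF F(1) uv] by auto
    then have "{f u, f v} \<in> edges C" using f uv by blast
    then have "{f u, f v} \<in> edges G" using H(2) K(3) C by auto
    then show "f u mod p \<noteq> f v mod p" using edge by blast
  qed
  then show False using p by blast
qed

lemma special_copy_of_embedding:
  assumes F: "is_graph F" and h: "inj_on h (verts F)" "h ` verts F \<subseteq> X"
    and e: "e \<in> edges F" "h ` e \<in> E'"
    and E: "\<And>u v. {u, v} \<in> edges F \<Longrightarrow> {u, v} \<noteq> e \<Longrightarrow> {h u, h v} \<in> E"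
  shows "has_special_copy F X E E'"
proof (intro exI[of _ "Graph (h ` verts F) ((`) h ` edges F)"] conjI bexI[of _ "h ` e"])
  show "edges (Graph (h ` verts F) ((`) h ` edges F)) - {h ` e} \<subseteq> E"
  proof
    fix f assume "f \<in> edges (Graph (h ` verts F) ((`) h ` edges F)) - {h ` e}"
    then obtain d where d: "d \<in> edges F" "f = h ` d" "d \<noteq> e" by auto
    then obtain u v where "d = {u, v}" using is_graph_edgeE[OF F] by metis
    then show "f \<in> E" using E d by auto
  qed
qed (use copy_of_graph[OF F h(1)] h(2) e in auto)

text \<open>If \<open>q\<close> is the chromatic number of F, the threshold is at least
  \<open>1 - 1 / (q - 1)\<close>, just what a large complete q-partite subgraph requires. Some edge
  of F is sent between the first two parts, where all edges belong to \<open>E'\<close>.\<close>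

lemma special_copy_bound_of_chromatic:
  assumes F: "is_graph F" "edges F \<noteq> {}" and b: "factor_threshold_bound F \<delta>" and \<delta>: "\<delta> \<ge> 1 / 2"
  shows "special_copy_bound F \<delta>"
  unfolding special_copy_bound_def
proof (intro allI impI)
  fix \<epsilon> :: real assume \<epsilon>: "\<epsilon> > 0"
  obtain g :: "'a \<Rightarrow> nat" and m where g: "g ` verts F = {i. i < m}" "inj_on g (verts F)"
    using F finite_imp_inj_to_nat_seg[of "verts F"] unfolding is_graph_def by blast
  have "colourable F m"
    unfolding colourable_def
  proof (intro exI[of _ g] conjI ballI allI impI)
    show "g v < m" if "v \<in> verts F" for v using g(1) that by blast
    show "g u \<noteq> g v" if "{u, v} \<in> edges F" for u v
      using is_graph_edgeE[OF F(1) that] g(2) by (metis doubleton_eq_iff inj_onD)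
  qed
  define q where "q = (LEAST q. colourable F q)"
  have q: "colourable F q" unfolding q_def by (rule LeastI) fact
  then obtain \<chi> where \<chi>: "\<And>v. v \<in> verts F \<Longrightarrow> \<chi> v < q" "\<And>u v. {u, v} \<in> edges F \<Longrightarrow> \<chi> u \<noteq> \<chi> v"
    unfolding colourable_def by blast
  obtain e where e: "e \<in> edges F" using F by blast
  obtain a b' where ab: "e = {a, b'}" "a \<in> verts F" "b' \<in> verts F" "a \<noteq> b'"
    using is_graph_edgeE[OF F(1) e] by metis
  have "\<chi> a \<noteq> \<chi> b'" using \<chi>(2) e ab by blast
  then have q2: "q \<ge> 2" using \<chi>(1)[OF ab(2)] \<chi>(1)[OF ab(3)] by linarith
  have "\<not> colourable F (q - 1)" using not_less_Least[of "q - 1" "colourable F"] q2 by (simp add: q_def)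
  then have \<delta>q: "\<delta> \<ge> 1 - 1 / real (q - 1)"
    using factor_threshold_bound_ge_of_not_colourable[OF F _ _ b, of "q - 1"] q2 by linarith
  \<comment> \<open>A permutation of the colours taking \<open>\<chi> a\<close> to 0 and
    \<open>\<chi> b'\<close> to 1; the second transposition does not move 0.\<close>
  define \<pi> where "\<pi> = (\<lambda>i. transpose (transpose (\<chi> a) 0 (\<chi> b')) 1 (transpose (\<chi> a) 0 i))"
  have \<pi>_inj: "\<pi> i = \<pi> j \<longleftrightarrow> i = j" for i j
    unfolding \<pi>_def by (metis transpose_involutory)
  have b1: "transpose (\<chi> a) 0 (\<chi> b') \<noteq> 0" using \<open>\<chi> a \<noteq> \<chi> b'\<close> by (auto simp: transpose_def)
  have \<pi>a: "\<pi> (\<chi> a) = 0" using b1 by (simp add: \<pi>_def)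
  have \<pi>b: "\<pi> (\<chi> b') = 1" by (simp add: \<pi>_def)
  have \<pi>_less: "\<pi> i < q" if "i < q" for i
    using that q2 \<chi>(1)[OF ab(2)] \<chi>(1)[OF ab(3)] by (auto simp: \<pi>_def transpose_def)
  define c where "c = (\<lambda>v. \<pi> (\<chi> v))"
  define r where "r = card (verts F)"
  obtain N0 where N0': "\<forall>(X::nat set) E E'. finite X \<longrightarrow> N0 \<le> card X \<longrightarrow>
      simple_edges E \<longrightarrow> simple_edges E' \<longrightarrow>
      min_degree_ge E X (1 / 2 + \<epsilon>) \<longrightarrow>
      min_degree_ge E' X (1 / 2 + \<epsilon>) \<longrightarrow>
      min_degree_ge E X (1 - 1 / real (q - 1) + \<epsilon>) \<longrightarrow>
      (\<exists>A. complete_multipartite E X q r A \<and> (\<forall>x\<in>A 0. \<forall>y\<in>A 1. {x, y} \<in> E'))"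
    using complete_multipartite_special_edges[OF \<epsilon> q2, where s = r and 'b = nat] by (elim exE)
  note N0 = N0'[rule_format (no_asm)]
  have "has_special_copy F X E E'"
    if X: "finite X" "N0 \<le> card X" and E: "simple_edges E" "simple_edges E'"
      and d: "min_degree_ge E X (\<delta> + \<epsilon>)"
        "min_degree_ge E' X (\<delta> + \<epsilon>)" for X :: "nat set" and E E'
  proof -
    have le: "x \<le> \<delta> \<Longrightarrow> (x + \<epsilon>) * real (card X) \<le> (\<delta> + \<epsilon>) * real (card X)" for x
      by (intro mult_right_mono) auto
    have "\<exists>A. complete_multipartite E X q r A \<and> (\<forall>x\<in>A 0. \<forall>y\<in>A 1. {x, y} \<in> E')"
      by (rule N0[OF X E]) (use d le[OF \<delta>] le[OF \<delta>q] order_trans in blast)+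
    then obtain A where A: "complete_multipartite E X q r A" "\<forall>x\<in>A 0. \<forall>y\<in>A 1. {x, y} \<in> E'" by blast
    have Ai: "A i \<subseteq> X" "card (A i) = r" if "i < q" for i
      using A(1) that unfolding complete_multipartite_def by auto
    have cq: "c w < q" if "w \<in> verts F" for w using \<pi>_less \<chi>(1) that by (simp add: c_def)
    obtain h where h: "inj_on h (verts F)" "\<And>w. w \<in> verts F \<Longrightarrow> h w \<in> A (c w)"
    proof (rule embedding_by_parts[of "verts F" A c])
      show fv: "finite (verts F)" using F by (simp add: is_graph_def)
      show "finite (A (c w))" if "w \<in> verts F" for w
        using Ai(1)[OF cq[OF that]] X(1) finite_subset by blast
      show "card {x \<in> verts F. c x = c w} \<le> card (A (c w))" if "w \<in> verts F" for w
        unfolding Ai(2)[OF cq[OF that]] r_def using fv by (intro card_mono) auto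
      show "A (c x) \<inter> A (c y) = {}" if "x \<in> verts F" "y \<in> verts F" "c x \<noteq> c y" for x y
        using complete_multipartite_disjoint[OF A(1) E(1)] cq that by blast
    qed (rule that)
    show ?thesis
    proof (rule special_copy_of_embedding[OF F(1) h(1) _ e])
      show "h ` verts F \<subseteq> X" using h(2) Ai(1) cq by blast
      have "h a \<in> A 0" "h b' \<in> A 1" using h(2)[OF ab(2)] h(2)[OF ab(3)] \<pi>a \<pi>b by (simp_all add: c_def)
      then show "h ` e \<in> E'" using A(2) ab(1) by simp
      show "{h u, h v} \<in> E" if uv: "{u, v} \<in> edges F" "{u, v} \<noteq> e" for u v
      proof -
        have "u \<in> verts F" "v \<in> verts F" using is_graph_edge(1)[OF F(1) uv(1)] by auto
        moreover have "c u \<noteq> c v" using \<chi>(2)[OF uv(1)] \<pi>_inj by (simp add: c_def)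
        ultimately show ?thesis using A(1) h(2) cq unfolding complete_multipartite_def by blast
      qed
    qed
  qed
  then show "\<exists>k\<^sub>0. \<forall>(X::nat set) E E'. finite X \<longrightarrow> k\<^sub>0 \<le> card X \<longrightarrow>
        simple_edges E \<longrightarrow> simple_edges E' \<longrightarrow>
        min_degree_ge E X (\<delta> + \<epsilon>) \<longrightarrow>
        min_degree_ge E' X (\<delta> + \<epsilon>) \<longrightarrow>
        has_special_copy F X E E'"
    by (intro exI[of _ N0]) blast
qed

section \<open>Bipartite graphs with a bridge\<close>

text \<open>\<open>S\<close> is what can be reached from \<open>a\<close> without \<open>e\<close>.
  If it contained \<open>b\<close>, every use of \<open>e\<close> could be replaced by a path
  avoiding \<open>e\<close>, and deleting \<open>e\<close> would change neither reachability nor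
  components.\<close>

lemma bridge_split:
  assumes F: "is_graph F" and e: "is_bridge F e"
  obtains a b S where "e = {a, b}" "a \<in> S" "b \<notin> S" "a \<in> verts F" "b \<in> verts F"
    "\<And>u v. {u, v} \<in> edges F \<Longrightarrow> {u, v} \<noteq> e \<Longrightarrow> u \<in> S \<longleftrightarrow> v \<in> S"
proof -
  have eF: "e \<in> edges F" using e by (simp add: is_bridge_def)
  obtain a b where ab: "e = {a, b}" "a \<in> verts F" "b \<in> verts F" "a \<noteq> b"
    using is_graph_edgeE[OF F eF] by metis
  define R where "R = {(x, y). {x, y} \<in> edges F - {e}}"
  define Q where "Q = {(x, y). {x, y} \<in> edges F}"
  have symR: "sym R" by (auto simp: R_def sym_def insert_commute)
  define S where "S = {x. (a, x) \<in> R\<^sup>*}"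
  have "b \<notin> S"
  proof
    assume "b \<in> S"
    then have "(a, b) \<in> R\<^sup>*" by (simp add: S_def)
    moreover from this have "(b, a) \<in> R\<^sup>*" using sym_rtrancl[OF symR] by (auto dest: symD)
    ultimately have "(x, y) \<in> R\<^sup>*" if "{x, y} = e" for x y
      using that ab(1) by (auto simp: doubleton_eq_iff)
    moreover have "(x, y) \<in> R" if "(x, y) \<in> Q" "{x, y} \<noteq> e" for x y
      using that by (simp add: Q_def R_def)
    ultimately have "Q \<subseteq> R\<^sup>*" by (meson r_into_rtrancl subrelI)
    then have "Q\<^sup>* \<subseteq> R\<^sup>*" by (metis rtrancl_mono rtrancl_idemp)
    moreover have "R\<^sup>* \<subseteq> Q\<^sup>*" by (rule rtrancl_mono) (auto simp: R_def Q_def)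
    ultimately have "Q\<^sup>* = R\<^sup>*" by blast
    then have "connected_rel F = connected_rel (delete_edge F e)"
      by (simp add: connected_rel_def delete_edge_def Q_def R_def)
    then have "components F = components (delete_edge F e)"
      by (simp add: components_def delete_edge_def)
    then show False using e by (simp add: is_bridge_def)
  qed
  moreover have "u \<in> S \<longleftrightarrow> v \<in> S" if "{u, v} \<in> edges F" "{u, v} \<noteq> e" for u v
  proof -
    have "(u, v) \<in> R" "(v, u) \<in> R" using that by (auto simp: R_def insert_commute)
    then show ?thesis unfolding S_def by (auto intro: rtrancl_into_rtrancl)
  qed
  ultimately show thesis using that[of a b S] ab by (auto simp: S_def)
qed

text \<open>With \<open>u\<close>, a complete bipartite graph that has one side among the neighbours
  of \<open>u\<close> contains every small bipartite graph with a prescribed vertex at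
  \<open>u\<close>. Any positive density suffices. \<open>Y\<close> collects vertices that are
  already occupied.\<close>

lemma complete_bipartite_at_vertex:
  fixes \<eta> :: real
  assumes \<eta>: "\<eta> > 0"
  shows "\<exists>N0. \<forall>(X::'b set) E Y u. finite X \<longrightarrow> N0 \<le> card X \<longrightarrow>
      simple_edges E \<longrightarrow> min_degree_ge E X \<eta> \<longrightarrow>
      u \<in> X \<longrightarrow> Y \<subseteq> X \<longrightarrow> card Y \<le> b \<longrightarrow>
      (\<exists>A B. A \<subseteq> X - Y \<and> B \<subseteq> X - Y \<and> card A = s \<and> card B = s \<and> A \<inter> B = {} \<and>
         (\<forall>x\<in>A. {u, x} \<in> E) \<and> (\<forall>x\<in>A. \<forall>y\<in>B. {x, y} \<in> E))"
proof -
  obtain S where S: "(\<eta> / 2) * real S \<ge> 2 * real s" using ex_nat_mult_ge1[of "\<eta> / 2" "2 * real s"] \<eta> by auto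
  obtain N1 where N1: "\<And>m. m \<ge> N1 \<Longrightarrow> (\<eta> / 4) * real m \<ge> real (1 * S + 2 ^ (1 * S) * s)"
    using ex_nat_mult_ge[of "\<eta> / 4" "real (1 * S + 2 ^ (1 * S) * s)"] \<eta> by auto
  obtain N2 where N2: "\<And>m. m \<ge> N2 \<Longrightarrow> (\<eta> / 2) * real m \<ge> real (S + b)"
    using ex_nat_mult_ge[OF half_gt_zero[OF \<eta>]] by blast
  have main: "\<exists>A B. A \<subseteq> X - Y \<and> B \<subseteq> X - Y \<and> card A = s \<and> card B = s \<and> A \<inter> B = {} \<and>
         (\<forall>x\<in>A. {u, x} \<in> E) \<and> (\<forall>x\<in>A. \<forall>y\<in>B. {x, y} \<in> E)"
    if X: "finite X" "max (N1 + b) N2 \<le> card X" and E: "simple_edges E"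
      and d: "min_degree_ge E X \<eta>"
      and u: "u \<in> X" and Y: "Y \<subseteq> X" "card Y \<le> b" for X :: "'b set" and E Y u
  proof -
    have finY: "finite Y" using X Y finite_subset by blast
    have cX: "card (X - Y) = card X - card Y" using card_Diff_subset[OF finY Y(1)] .
    have n2: "(\<eta> / 2) * real (card X) \<ge> real S + real b" using N2[of "card X"] X by simp
    \<comment> \<open>The summand \<open>S\<close> supplies the neighbours of \<open>u\<close> from
      which the first side is taken; the other summand is the density for adding the second
      side.\<close>
    have deg: "real (degree_into E (X - Y) v) \<ge> \<eta> / 2 * real (card X) + real S" if "v \<in> X" for v
    proof -
      have "real (degree_into E (X - Y) v) \<ge> real (degree_into E X v) - real (card Y)"
        by (rule degree_into_Diff) fact+
      moreover have "real (degree_into E X v) \<ge> \<eta> * real (card X)" using d that by blast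
      ultimately show ?thesis using n2 Y(2) by (simp add: field_simps)
    qed
    have "real S \<le> real (degree_into E (X - Y) u)" using deg[OF u] \<eta>
      by (smt (verit) divide_pos_pos mult_nonneg_nonneg of_nat_0_le_iff)
    then obtain A0 where A0: "A0 \<subseteq> {w \<in> X - Y. {u, w} \<in> E}" "card A0 = S"
      using obtain_subset_with_card_n[of S "{w \<in> X - Y. {u, w} \<in> E}"] unfolding degree_into_def by auto
    have A1: "complete_multipartite {} (X - Y) 1 S (\<lambda>_. A0)"
      using A0 by (auto simp: complete_multipartite_def)
    obtain B where B: "complete_multipartite E (X - Y) (Suc 1) s B" "\<And>i. i < 1 \<Longrightarrow> B i \<subseteq> A0"
    proof (rule complete_multipartite_Suc[OF _ _ _ A1, where \<eta> = "\<eta> / 2" and E = E and s = s])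
      show "(1 - 1 / real 1 + \<eta> / 2) * real (card (X - Y)) \<le> real (degree_into E (X - Y) v)" if "v \<in> X - Y" for v
      proof -
        have "\<eta> / 2 * real (card (X - Y)) \<le> \<eta> / 2 * real (card X)"
          using \<eta> cX by (intro mult_left_mono) auto
        then show ?thesis using deg[of v] that by simp
      qed
      show "real (1 * S + 2 ^ (1 * S) * s) \<le> \<eta> / 2 / 2 * real (card (X - Y))"
      proof -
        have "N1 + b \<le> card X" using X(2) by simp
        then have "N1 \<le> card (X - Y)" using Y(2) unfolding cX by linarith
        from N1[OF this] show ?thesis by simp
      qed
      show "2 * real s \<le> real 1 * (\<eta> / 2) * real S" using S by simp
    qed (use \<eta> X in auto)
    have "B 0 \<inter> B 1 = {}" using complete_multipartite_disjoint[OF B(1) E, of 0 1] by simp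
    moreover have "B i \<subseteq> X - Y \<and> card (B i) = s" if "i < 2" for i
      using B(1) that unfolding complete_multipartite_def by simp
    moreover have "{x, y} \<in> E" if "x \<in> B 0" "y \<in> B 1" for x y
      using B(1) that unfolding complete_multipartite_def
      by (metis One_nat_def lessI zero_less_Suc zero_neq_one)
    moreover have "{u, x} \<in> E" if "x \<in> B 0" for x using B(2)[OF zero_less_one] A0(1) that by blast
    ultimately show ?thesis by (intro exI[of _ "B 0"] exI[of _ "B 1"]) auto
  qed
  show ?thesis by (intro exI[of _ "max (N1 + b) N2"] allI impI) (rule main; assumption)
qed

text \<open>Any edge \<open>{u, v}\<close> of \<open>E'\<close> can carry the bridge. The side of
  \<open>a\<close> is embedded with \<open>a\<close> at \<open>u\<close>, the rest with
  \<open>b\<close> at \<open>v\<close>. No other edge of F joins the two sides, so they are placed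
  independently.\<close>

lemma special_copy_bound_of_bridge:
  assumes F: "is_graph F" and c2: "colourable F 2" and e: "is_bridge F e" and \<delta>: "\<delta> \<ge> 0"
  shows "special_copy_bound F \<delta>"
  unfolding special_copy_bound_def
proof (intro allI impI)
  fix \<epsilon> :: real assume \<epsilon>: "\<epsilon> > 0"
  obtain a b S where abS: "e = {a, b}" "a \<in> S" "b \<notin> S" "a \<in> verts F" "b \<in> verts F"
    "\<And>u v. {u, v} \<in> edges F \<Longrightarrow> {u, v} \<noteq> e \<Longrightarrow> u \<in> S \<longleftrightarrow> v \<in> S"
    using bridge_split[OF F e] by metis
  have eF: "e \<in> edges F" using e by (simp add: is_bridge_def)
  obtain \<chi> where \<chi>: "\<And>v. v \<in> verts F \<Longrightarrow> \<chi> v < (2::nat)" "\<And>u v. {u, v} \<in> edges F \<Longrightarrow> \<chi> u \<noteq> \<chi> v"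
    using c2 unfolding colourable_def by blast
  define r where "r = card (verts F)"
  \<comment> \<open>The second application has to avoid \<open>u\<close>, \<open>v\<close> and both
    sides of the first bipartite graph, hence \<open>2 + r + r\<close>.\<close>
  obtain N0 where N0': "\<forall>(X::nat set) E Y u. finite X \<longrightarrow> N0 \<le> card X \<longrightarrow>
      simple_edges E \<longrightarrow> min_degree_ge E X \<epsilon> \<longrightarrow>
      u \<in> X \<longrightarrow> Y \<subseteq> X \<longrightarrow> card Y \<le> 2 + r + r \<longrightarrow>
      (\<exists>A B. A \<subseteq> X - Y \<and> B \<subseteq> X - Y \<and> card A = r \<and> card B = r \<and> A \<inter> B = {} \<and>
         (\<forall>x\<in>A. {u, x} \<in> E) \<and> (\<forall>x\<in>A. \<forall>y\<in>B. {x, y} \<in> E))"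
    using complete_bipartite_at_vertex[OF \<epsilon>, where b = "2 + r + r" and s = r and 'b = nat] by (elim exE)
  note N0 = N0'[rule_format (no_asm)]
  have "has_special_copy F X E E'"
    if X: "finite X" "max 1 N0 \<le> card X" and E: "simple_edges E" "simple_edges E'"
      and d: "min_degree_ge E X (\<delta> + \<epsilon>)"
        "min_degree_ge E' X (\<delta> + \<epsilon>)" for X :: "nat set" and E E'
  proof -
    have le: "\<epsilon> * real (card X) \<le> (\<delta> + \<epsilon>) * real (card X)" using \<delta> by (intro mult_right_mono) auto
    have dE: "min_degree_ge E X \<epsilon>" using d(1) le by fastforce
    obtain u where u: "u \<in> X" using X by (metis card.empty ex_in_conv max.bounded_iff not_one_le_zero)
    have "real (degree_into E' X u) > 0" using d(2) u le \<epsilon> X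
      by (smt (verit) One_nat_def Suc_le_lessD max.bounded_iff mult_pos_pos of_nat_0_less_iff)
    then have "{w \<in> X. {u, w} \<in> E'} \<noteq> {}" unfolding degree_into_def by (metis card.empty of_nat_0 less_irrefl)
    then obtain v where v: "v \<in> X" "{u, v} \<in> E'" by blast
    then have uv: "u \<noteq> v" using E(2) by force
    obtain P0 P1 where P: "P0 \<subseteq> X - {u, v}" "P1 \<subseteq> X - {u, v}" "card P0 = r" "card P1 = r" "P0 \<inter> P1 = {}"
         "\<forall>x\<in>P0. {u, x} \<in> E" "\<forall>x\<in>P0. \<forall>y\<in>P1. {x, y} \<in> E"
      using N0[OF X(1) _ E(1) dE u, of "{u, v}"] X u v uv by (auto simp: card_insert_if)
    have fin: "finite P0" "finite P1" using P X(1) finite_subset by blast+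
    have "card ({u, v} \<union> P0 \<union> P1) \<le> card {u, v} + card P0 + card P1"
      by (meson card_Un_le order_trans add_le_mono1)
    then have cY: "card ({u, v} \<union> P0 \<union> P1) \<le> 2 + r + r" using P uv by simp
    have sub: "{u, v} \<union> P0 \<union> P1 \<subseteq> X" using P u v by blast
    obtain Q0 Q1 where Q: "Q0 \<subseteq> X - ({u, v} \<union> P0 \<union> P1)" "Q1 \<subseteq> X - ({u, v} \<union> P0 \<union> P1)"
         "card Q0 = r" "card Q1 = r" "Q0 \<inter> Q1 = {}"
         "\<forall>x\<in>Q0. {v, x} \<in> E" "\<forall>x\<in>Q0. \<forall>y\<in>Q1. {x, y} \<in> E"
      using N0[OF X(1) _ E(1) dE v(1) sub cY] X by auto
    have finQ: "finite Q0" "finite Q1" using Q X(1) finite_subset by blast+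
    define A where "A = (\<lambda>i::nat. if i = 0 then {u} else if i = 1 then {v} else if i = 2 then P0
       else if i = 3 then P1 else if i = 4 then Q0 else Q1)"
    \<comment> \<open>The numbers follow \<open>A\<close>: the two roots, then on the side
      \<open>S\<close> the vertices coloured unlike and like \<open>a\<close>, then elsewhere those
      unlike and like \<open>b\<close>. Edges other than \<open>e\<close> stay on one side and so
      join only 0-2, 2-3, 1-4 or 4-5.\<close>
    define c where "c = (\<lambda>w. if w = a then 0 else if w = b then 1
       else if w \<in> S then (if \<chi> w \<noteq> \<chi> a then 2 else 3)
       else (if \<chi> w \<noteq> \<chi> b then 4 else (5::nat)))"
    have ab: "a \<noteq> b" using abS by blast
    have finF: "finite (verts F)" using F by (simp add: is_graph_def)
    obtain h where h: "inj_on h (verts F)" "\<And>w. w \<in> verts F \<Longrightarrow> h w \<in> A (c w)"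
    proof (rule embedding_by_parts[OF finF, of A c])
      show "finite (A (c w))" for w using fin finQ by (simp add: A_def)
      show "card {x \<in> verts F. c x = c w} \<le> card (A (c w))" if "w \<in> verts F" for w
      proof -
        consider "w = a" | "w = b" | "w \<noteq> a" "w \<noteq> b" by blast
        then show ?thesis
        proof cases
          case 1
          have "{x \<in> verts F. c x = c w} \<subseteq> {a}" using 1 ab by (auto simp: c_def split: if_splits)
          then have "card {x \<in> verts F. c x = c w} \<le> card {a}" by (intro card_mono) auto
          then show ?thesis using 1 by (simp add: c_def A_def)
        next
          case 2
          have "{x \<in> verts F. c x = c w} \<subseteq> {b}" using 2 ab by (auto simp: c_def split: if_splits)
          then have "card {x \<in> verts F. c x = c w} \<le> card {b}" by (intro card_mono) auto
          then show ?thesis using 2 ab by (simp add: c_def A_def)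
        next
          case 3
          then have "card (A (c w)) = r" using P Q by (simp add: c_def A_def)
          moreover have "card {x \<in> verts F. c x = c w} \<le> r"
            unfolding r_def using finF by (intro card_mono) auto
          ultimately show ?thesis by simp
        qed
      qed
      have "A i \<inter> A j = {}" if "i < j" "j < 6" for i j
      proof -
        have "i \<in> {0,1,2,3,4}" "j \<in> {1,2,3,4,5}" using that by auto
        moreover have "{u} \<inter> {v} = {}" "{u} \<inter> P0 = {}" "{u} \<inter> P1 = {}" "{u} \<inter> Q0 = {}" "{u} \<inter> Q1 = {}"
          "{v} \<inter> P0 = {}" "{v} \<inter> P1 = {}" "{v} \<inter> Q0 = {}" "{v} \<inter> Q1 = {}"
          "P0 \<inter> P1 = {}" "P0 \<inter> Q0 = {}" "P0 \<inter> Q1 = {}" "P1 \<inter> Q0 = {}" "P1 \<inter> Q1 = {}" "Q0 \<inter> Q1 = {}"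
          using P(1,2,5) Q(1,2,5) uv by blast+
        ultimately show ?thesis using that(1) by (elim insertE emptyE) (simp_all add: A_def)
      qed
      moreover have "c w < 6" for w by (simp add: c_def)
      ultimately show "A (c x) \<inter> A (c y) = {}" if "c x \<noteq> c y" for x y
        using that by (metis inf_commute linorder_neqE_nat)
    qed (rule that)
    show ?thesis
    proof (rule special_copy_of_embedding[OF F h(1) _ eF])
      have "A i \<subseteq> X" for i using P Q u v by (auto simp: A_def)
      then show "h ` verts F \<subseteq> X" using h(2) by blast
      have "h a = u" "h b = v" using h(2)[OF abS(4)] h(2)[OF abS(5)] ab by (simp_all add: c_def A_def)
      then show "h ` e \<in> E'" using v abS(1) by simp
      show "{h x, h y} \<in> E" if xy: "{x, y} \<in> edges F" "{x, y} \<noteq> e" for x y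
      proof -
        have V: "x \<in> verts F" "y \<in> verts F" using is_graph_edge(1)[OF F xy(1)] by auto
        have S: "x \<in> S \<longleftrightarrow> y \<in> S" using abS(6)[OF xy] .
        have ne: "\<chi> x \<noteq> \<chi> y" using \<chi>(2)[OF xy(1)] .
        have two: "\<chi> w = 0 \<or> \<chi> w = 1" if "w \<in> verts F" for w using \<chi>(1)[OF that] by linarith
        have col: "\<chi> x = \<chi> z \<longleftrightarrow> \<chi> y \<noteq> \<chi> z" if "z \<in> verts F" for z
          using two[OF V(1)] two[OF V(2)] two[OF that] ne by auto
        have EA: "{p, q} \<in> E" if "p \<in> A i" "q \<in> A j" "(i, j) \<in> {(0,2),(2,3),(1,4),(4,5)}" for p q i j
          using that P Q by (auto simp: A_def)
        have EA': "{p, q} \<in> E" if "p \<in> A i" "q \<in> A j" "(j, i) \<in> {(0,2),(2,3),(1,4),(4,5)}" for p q i j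
          using EA[OF that(2,1,3)] by (simp add: insert_commute)
        have "(c x, c y) \<in> {(0,2),(2,3),(1,4),(4,5)} \<or> (c y, c x) \<in> {(0,2),(2,3),(1,4),(4,5)}"
          using S ne col[OF abS(4)] col[OF abS(5)] abS(2,3) ab
          unfolding c_def by (auto split: if_splits)
        then show ?thesis using EA EA' h(2)[OF V(1)] h(2)[OF V(2)] by blast
      qed
    qed
  qed
  then show "\<exists>k\<^sub>0. \<forall>(X::nat set) E E'. finite X \<longrightarrow> k\<^sub>0 \<le> card X \<longrightarrow>
        simple_edges E \<longrightarrow> simple_edges E' \<longrightarrow>
        min_degree_ge E X (\<delta> + \<epsilon>) \<longrightarrow>
        min_degree_ge E' X (\<delta> + \<epsilon>) \<longrightarrow>
        has_special_copy F X E E'"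
    by (intro exI[of _ "max 1 N0"]) blast
qed

lemma factor_threshold_bound_mono:
  assumes "factor_threshold_bound F \<delta>" "\<delta> \<le> \<delta>'"
  shows "factor_threshold_bound F \<delta>'"
  unfolding factor_threshold_bound_def
proof (intro allI impI)
  fix \<epsilon> :: real assume "\<epsilon> > 0"
  then have "\<delta>' + \<epsilon> - \<delta> > 0" using assms(2) by simp
  with assms(1) have "\<exists>n\<^sub>0::nat. \<forall>n\<ge>n\<^sub>0. card (verts F) dvd n \<longrightarrow>
        (\<forall>G::nat graph. is_graph G \<longrightarrow> card (verts G) = n \<longrightarrow>
           real (min_degree G) \<ge> (\<delta> + (\<delta>' + \<epsilon> - \<delta>)) * real n \<longrightarrow> contains_factor F G)"
    unfolding factor_threshold_bound_def by blast
  then show "\<exists>n\<^sub>0::nat. \<forall>n\<ge>n\<^sub>0. card (verts F) dvd n \<longrightarrow>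
        (\<forall>G::nat graph. is_graph G \<longrightarrow> card (verts G) = n \<longrightarrow>
           real (min_degree G) \<ge> (\<delta>' + \<epsilon>) * real n \<longrightarrow> contains_factor F G)"
    by simp
qed

text \<open>The case distinction of the threshold enters only here. A value below
  \<open>1 / 2\<close> can only come from a graph with a bridge, and the chromatic lower bound for
  \<open>p = 2\<close> then shows that the graph is bipartite.\<close>

lemma transversal_factor_threshold_bounds:
  assumes F: "is_graph F" "edges F \<noteq> {}"
  shows "factor_threshold_bound F (transversal_factor_threshold F)"
    "special_copy_bound F (transversal_factor_threshold F)"
    "transversal_factor_threshold F \<ge> 0"
proof -
  have b: "factor_threshold_bound F (factor_threshold F)" by (rule factor_threshold_least(1)[OF F])
  have "factor_threshold F \<le> transversal_factor_threshold F"
    by (auto simp: transversal_factor_threshold_def)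
  then show bT: "factor_threshold_bound F (transversal_factor_threshold F)"
    using factor_threshold_bound_mono[OF b] by blast
  then show nn: "transversal_factor_threshold F \<ge> 0" using factor_threshold_bound_nonneg[OF F] by blast
  show "special_copy_bound F (transversal_factor_threshold F)"
  proof (cases "transversal_factor_threshold F \<ge> 1 / 2")
    case True
    then show ?thesis by (rule special_copy_bound_of_chromatic[OF F bT])
  next
    case False
    then have "has_bridge F" by (auto simp: transversal_factor_threshold_def split: if_splits)
    then obtain e where e: "is_bridge F e" by (auto simp: has_bridge_def)
    have "colourable F 2"
      using factor_threshold_bound_ge_of_not_colourable[OF F _ _ bT, of 2] False by auto
    then show ?thesis using special_copy_bound_of_bridge[OF F(1) _ e nn] by blast
  qed
qed

section \<open>Random subsets\<close>

lemma exp_uminus_le_quadratic: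
  fixes h :: real assumes "h \<ge> 0" shows "exp (- h) \<le> 1 - h + h\<^sup>2"
proof -
  have "exp (- h) = 1 / exp h" by (simp add: exp_minus field_simps)
  also have "\<dots> \<le> 1 / (1 + h)" using assms exp_ge_add_one_self[of h] by (intro divide_left_mono) auto
  also have "\<dots> \<le> 1 - h + h\<^sup>2"
  proof -
    have "(1 - h + h\<^sup>2) * (1 + h) = 1 + h ^ 3" by (simp add: algebra_simps power2_eq_square power3_eq_cube)
    moreover have "h ^ 3 \<ge> 0" using assms by simp
    ultimately show ?thesis using assms by (simp add: divide_le_eq)
  qed
  finally show ?thesis .
qed

text \<open>The Chernoff bound, by counting in a finite product space.\<close>

lemma card_PiE_few_hits:
  fixes \<beta> \<tau> :: real
  assumes I: "finite I" and \<Omega>: "\<And>i. i \<in> I \<Longrightarrow> finite (\<Omega> i)" and A: "\<And>i. i \<in> I \<Longrightarrow> A i \<subseteq> \<Omega> i"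
    and dens: "\<And>i. i \<in> I \<Longrightarrow> real (card (A i)) \<ge> \<beta> * real (card (\<Omega> i))"
    and \<beta>: "0 \<le> \<beta>" "\<beta> \<le> 1" and \<tau>: "\<tau> > 0"
  shows "real (card {f \<in> PiE I \<Omega>. real (card {i \<in> I. f i \<in> A i}) \<le> (\<beta> - \<tau>) * real (card I)})
    \<le> exp (- (\<tau>\<^sup>2 / 4) * real (card I)) * real (\<Prod>i\<in>I. card (\<Omega> i))"
proof -
  \<comment> \<open>This \<open>h\<close> minimises the exponent
    \<open>h\<^sup>2 - h * \<tau>\<close>, with value \<open>- (\<tau>\<^sup>2 / 4)\<close>.\<close>
  define h where "h = \<tau> / 2"
  have h: "h > 0" using \<tau> by (simp add: h_def)
  define M where "M = real (card I)"
  define bad where "bad = {f \<in> PiE I \<Omega>. real (card {i \<in> I. f i \<in> A i}) \<le> (\<beta> - \<tau>) * M}"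
  \<comment> \<open>A factor \<open>exp (- h)\<close> for every hit: the product is at least
    \<open>exp (- h * ((\<beta> - \<tau>) * M))\<close> on bad maps, while its sum over all maps
    factorises over the coordinates.\<close>
  define w where "w = (\<lambda>i x. if x \<in> A i then exp (- h) else 1)"
  have fin: "finite (PiE I \<Omega>)" using I \<Omega> by (intro finite_PiE) auto
  have prodw: "(\<Prod>i\<in>I. w i (f i)) = exp (- h * real (card {i \<in> I. f i \<in> A i}))" for f
  proof -
    have "(\<Prod>i\<in>I. w i (f i)) = (\<Prod>i\<in>{i \<in> I. f i \<in> A i}. exp (- h))"
      unfolding w_def by (rule prod.inter_filter[OF I, symmetric])
    also have "\<dots> = exp (- h) ^ card {i \<in> I. f i \<in> A i}" by simp
    also have "\<dots> = exp (- h * real (card {i \<in> I. f i \<in> A i}))"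
      by (metis exp_of_nat_mult mult.commute)
    finally show ?thesis .
  qed
  have "real (card bad) * exp (- h * ((\<beta> - \<tau>) * M)) = (\<Sum>f\<in>bad. exp (- h * ((\<beta> - \<tau>) * M)))" by simp
  also have "\<dots> \<le> (\<Sum>f\<in>bad. \<Prod>i\<in>I. w i (f i))"
    unfolding prodw using h by (intro sum_mono) (auto simp: bad_def)
  also have "\<dots> \<le> (\<Sum>f\<in>PiE I \<Omega>. \<Prod>i\<in>I. w i (f i))"
    using fin by (intro sum_mono2) (auto simp: bad_def w_def intro!: prod_nonneg)
  also have "\<dots> = (\<Prod>i\<in>I. \<Sum>x\<in>\<Omega> i. w i x)" using I \<Omega> by (simp add: prod_sum_PiE)
  also have "\<dots> \<le> (\<Prod>i\<in>I. real (card (\<Omega> i)) * exp (- ((1 - exp (- h)) * \<beta>)))"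
  proof (rule prod_mono)
    fix i assume i: "i \<in> I"
    have "(\<Sum>x\<in>\<Omega> i. w i x) = (\<Sum>x\<in>\<Omega> i. 1 - (if x \<in> A i then 1 - exp (- h) else 0))"
      by (rule sum.cong) (auto simp: w_def)
    also have "\<dots> = real (card (\<Omega> i)) - (\<Sum>x\<in>{x \<in> \<Omega> i. x \<in> A i}. 1 - exp (- h))"
      using \<Omega>[OF i] by (simp add: sum_subtractf flip: sum.inter_filter)
    also have "{x \<in> \<Omega> i. x \<in> A i} = A i" using A[OF i] by auto
    finally have eq: "(\<Sum>x\<in>\<Omega> i. w i x) = real (card (\<Omega> i)) - real (card (A i)) * (1 - exp (- h))" by simp
    have "(1 - exp (- h)) * (\<beta> * real (card (\<Omega> i))) \<le> (1 - exp (- h)) * real (card (A i))"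
      using h dens[OF i] by (intro mult_left_mono) auto
    then have "(\<Sum>x\<in>\<Omega> i. w i x) \<le> real (card (\<Omega> i)) * (1 - (1 - exp (- h)) * \<beta>)"
      unfolding eq by (simp add: algebra_simps)
    also have "\<dots> \<le> real (card (\<Omega> i)) * exp (- ((1 - exp (- h)) * \<beta>))"
      using exp_ge_add_one_self[of "- ((1 - exp (- h)) * \<beta>)"] by (intro mult_left_mono) auto
    finally have le: "(\<Sum>x\<in>\<Omega> i. w i x) \<le> real (card (\<Omega> i)) * exp (- ((1 - exp (- h)) * \<beta>))" .
    have "0 \<le> (\<Sum>x\<in>\<Omega> i. w i x)" by (rule sum_nonneg) (simp add: w_def)
    with le show "0 \<le> (\<Sum>x\<in>\<Omega> i. w i x) \<and> (\<Sum>x\<in>\<Omega> i. w i x) \<le> real (card (\<Omega> i)) * exp (- ((1 - exp (- h)) * \<beta>))" by blast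
  qed
  also have "\<dots> = real (\<Prod>i\<in>I. card (\<Omega> i)) * exp (- ((1 - exp (- h)) * \<beta>)) ^ card I"
    by (simp add: prod.distrib)
  also have "exp (- ((1 - exp (- h)) * \<beta>)) ^ card I = exp (- ((1 - exp (- h)) * \<beta>) * M)"
    unfolding M_def by (metis exp_of_nat_mult mult.commute)
  finally have *: "real (card bad) * exp (- h * ((\<beta> - \<tau>) * M))
      \<le> real (\<Prod>i\<in>I. card (\<Omega> i)) * exp (- ((1 - exp (- h)) * \<beta>) * M)" .
  have expo: "h * (\<beta> - \<tau>) - (1 - exp (- h)) * \<beta> \<le> - (\<tau>\<^sup>2 / 4)"
  proof -
    have "(exp (- h) - (1 - h)) * \<beta> \<le> h\<^sup>2 * 1"
      using exp_uminus_le_quadratic[of h] h \<beta> by (intro mult_mono) (auto simp: exp_ge_add_one_self[of "-h", simplified])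
    then have "h * \<beta> - (1 - exp (- h)) * \<beta> \<le> h\<^sup>2" by (simp add: algebra_simps)
    moreover have "h\<^sup>2 - h * \<tau> = - (\<tau>\<^sup>2 / 4)" by (simp add: h_def power2_eq_square)
    moreover have "h * (\<beta> - \<tau>) = h * \<beta> - h * \<tau>" by (simp add: algebra_simps)
    ultimately show ?thesis by linarith
  qed
  have "real (card bad) = (real (card bad) * exp (- h * ((\<beta> - \<tau>) * M))) * exp (h * ((\<beta> - \<tau>) * M))"
    by (simp add: mult.assoc flip: exp_add)
  also have "\<dots> \<le> (real (\<Prod>i\<in>I. card (\<Omega> i)) * exp (- ((1 - exp (- h)) * \<beta>) * M)) * exp (h * ((\<beta> - \<tau>) * M))"
    using * by (rule mult_right_mono) simp
  also have "\<dots> = real (\<Prod>i\<in>I. card (\<Omega> i)) * exp ((h * (\<beta> - \<tau>) - (1 - exp (- h)) * \<beta>) * M)"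
    by (simp add: algebra_simps flip: exp_add)
  also have "\<dots> \<le> real (\<Prod>i\<in>I. card (\<Omega> i)) * exp (- (\<tau>\<^sup>2 / 4) * M)"
  proof -
    have "(h * (\<beta> - \<tau>) - (1 - exp (- h)) * \<beta>) * M \<le> - (\<tau>\<^sup>2 / 4) * M"
      using expo by (intro mult_right_mono) (auto simp: M_def)
    then show ?thesis by (intro mult_left_mono) (auto intro: prod_nonneg)
  qed
  finally show ?thesis by (simp add: bad_def M_def mult.commute)
qed

section \<open>Random maps: injectivity and inherited degrees\<close>

lemma card_inj_PiE_ge:
  assumes "finite S"
  shows "(card S - k) ^ k \<le> card {f \<in> {..<k} \<rightarrow>\<^sub>E S. inj_on f {..<k}}"
proof (cases "k \<le> card S")
  case False
  then show ?thesis by (cases k) auto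
next
  case True
  let ?L = "{xs. length xs = k \<and> distinct xs \<and> set xs \<subseteq> S}"
  let ?h = "\<lambda>xs. \<lambda>i\<in>{..<k}. xs ! i"
  have "card ?L = \<Prod>{card S - k + 1..card S}" by (rule card_lists_distinct_length_eq[OF assms True])
  moreover have "(card S - k) ^ card {card S - k + 1..card S} \<le> \<Prod>{card S - k + 1..card S}"
    unfolding prod_constant[symmetric] by (rule prod_mono) auto
  ultimately have "(card S - k) ^ k \<le> card ?L" using True by simp
  also have "\<dots> \<le> card {f \<in> {..<k} \<rightarrow>\<^sub>E S. inj_on f {..<k}}"
  proof (rule card_inj_on_le[of ?h])
    show "inj_on ?h ?L"
    proof (rule inj_onI)
      fix xs ys assume a: "xs \<in> ?L" "ys \<in> ?L" "?h xs = ?h ys"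
      have "xs ! i = ys ! i" if "i < k" for i using fun_cong[OF a(3), of i] that by simp
      then show "xs = ys" using a by (intro nth_equalityI) auto
    qed
    show "?h ` ?L \<subseteq> {f \<in> {..<k} \<rightarrow>\<^sub>E S. inj_on f {..<k}}"
      by (auto simp: inj_on_def nth_eq_iff_index_eq subset_iff split: if_splits)
    show "finite {f \<in> {..<k} \<rightarrow>\<^sub>E S. inj_on f {..<k}}"
      using assms by (intro finite_subset[OF _ finite_PiE[of "{..<k}" "\<lambda>_. S"]]) auto
  qed
  finally show ?thesis .
qed

text \<open>The good maps are the injections into \<open>V - Q\<close>, counted from below by
  Bernoulli's inequality. If \<open>card Q + k > card V\<close> and \<open>k > 0\<close>, the
  right-hand side is at least the number of all maps.\<close>

lemma card_not_inj_PiE_le: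
  assumes V: "finite V" "V \<noteq> {}" and Q: "Q \<subseteq> V"
  shows "real (card {f \<in> {..<k} \<rightarrow>\<^sub>E V. \<not> (inj_on f {..<k} \<and> f ` {..<k} \<inter> Q = {})})
    \<le> real (k * (card Q + k)) / real (card V) * real (card V) ^ k"
proof -
  define N where "N = real (card V)"
  have N: "N > 0" using V by (simp add: N_def card_gt_0_iff)
  let ?U = "{..<k} \<rightarrow>\<^sub>E V"
  let ?B = "{f \<in> ?U. \<not> (inj_on f {..<k} \<and> f ` {..<k} \<inter> Q = {})}"
  let ?G = "{f \<in> {..<k} \<rightarrow>\<^sub>E (V - Q). inj_on f {..<k}}"
  have finU: "finite ?U" using V by (intro finite_PiE) auto
  have cU: "real (card ?U) = N ^ k" by (simp add: card_funcsetE N_def)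
  have Gsub: "?G \<subseteq> ?U" by (auto simp: PiE_def Pi_def)
  have "?B \<subseteq> ?U - ?G" by fastforce
  then have "card ?B \<le> card (?U - ?G)" using finU by (intro card_mono) auto
  also have "\<dots> = card ?U - card ?G" using finite_subset[OF Gsub finU] Gsub by (rule card_Diff_subset)
  finally have B: "real (card ?B) \<le> N ^ k - real (card ?G)"
    using cU card_mono[OF finU Gsub] by (simp add: of_nat_diff)
  have "card (V - Q) = card V - card Q" using card_Diff_subset[OF finite_subset[OF Q V(1)] Q] .
  then have g: "(card V - card Q - k) ^ k \<le> card ?G" using card_inj_PiE_ge[of "V - Q" k] V by simp
  define x where "x = (real (card Q) + real k) / N"
  show ?thesis
  proof (cases "card Q + k \<le> card V")
    case True
    then have le1: "x \<le> 1" using N by (simp add: x_def N_def divide_le_eq)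
    have "real (card V - card Q - k) = N * (1 - x)"
      using True N by (simp add: x_def N_def of_nat_diff field_simps)
    then have "(N * (1 - x)) ^ k \<le> real (card ?G)" using g by (metis of_nat_le_iff of_nat_power)
    moreover have "N ^ k * (1 - real k * x) \<le> N ^ k * (1 - x) ^ k"
      using Bernoulli_inequality[of "- x" k] le1 N by (intro mult_left_mono) auto
    ultimately have "N ^ k * (1 - real k * x) \<le> real (card ?G)" by (simp add: power_mult_distrib)
    then have "real (card ?B) \<le> (real k * x) * N ^ k" using B by (simp add: algebra_simps)
    then show ?thesis by (simp add: x_def N_def)
  next
    case False
    then have x1: "x \<ge> 1" using N by (simp add: x_def N_def le_divide_eq)
    show ?thesis
    proof (cases "k = 0")
      case True
      have "?B = {}" using True by auto
      then show ?thesis unfolding \<open>?B = {}\<close> by simp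
    next
      case kF: False
      have "1 * 1 \<le> real k * x" using x1 kF by (intro mult_mono) auto
      then have "1 * N ^ k \<le> (real k * x) * N ^ k" using N by (intro mult_right_mono) auto
      then have "real (card ?B) \<le> (real k * x) * N ^ k" using B by linarith
      then show ?thesis by (simp add: x_def N_def)
    qed
  qed
qed

lemma degree_into_image:
  assumes "inj_on f {..<k}"
  shows "degree_into E (f ` {..<k}) q = card {j \<in> {..<k}. {q, f j} \<in> E}"
proof -
  have "{w \<in> f ` {..<k}. {q, w} \<in> E} = f ` {j \<in> {..<k}. {q, f j} \<in> E}" by auto
  moreover have "card (f ` {j \<in> {..<k}. {q, f j} \<in> E}) = card {j \<in> {..<k}. {q, f j} \<in> E}"
    by (rule card_image, rule inj_on_subset[OF assms]) auto
  ultimately show ?thesis by (simp add: degree_into_def)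
qed

definition low_degree :: "'b set set \<Rightarrow> 'b set \<Rightarrow> real \<Rightarrow> nat \<Rightarrow> (nat \<Rightarrow> 'b) \<Rightarrow> bool" where
  "low_degree E Q d k f \<longleftrightarrow> (\<exists>v\<in>f ` {..<k} \<union> Q. real (degree_into E (f ` {..<k}) v) < d)"

text \<open>A union bound over the vertices of \<open>Q\<close> and the positions
  \<open>i < k\<close>. For a vertex \<open>f i\<close> the neighbourhood depends on the map, so its
  value is fixed first: there are \<open>card V\<close> values, each leaving fewer maps by the same
  factor, and only a factor \<open>k\<close> is lost.\<close>

lemma card_low_degree_le:
  fixes \<beta> \<tau> :: real and V :: "'b set"
  assumes V: "finite V" and Q: "Q \<subseteq> V"
    and deg: "\<And>v. v \<in> V \<Longrightarrow> real (degree_into E V v) \<ge> \<beta> * real (card V)"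
    and \<beta>: "0 \<le> \<beta>" "\<beta> \<le> 1" and \<tau>: "\<tau> > 0" and k: "\<tau> * real k \<ge> 1"
  shows "real (card {f \<in> {..<k} \<rightarrow>\<^sub>E V. inj_on f {..<k} \<and> low_degree E Q ((\<beta> - 2 * \<tau>) * real k) k f})
    \<le> (real k + real (card Q)) * exp (- (\<tau>\<^sup>2 / 4) * real k) * real (card V) ^ k"
proof -
  define N where "N = card V"
  define b where "b = exp (- (\<tau>\<^sup>2 / 4) * real k) * real N ^ k"
  define nb where "nb = (\<lambda>x. {w \<in> V. {x, w} \<in> E})"
  have kpos: "k > 0" using k \<tau> by (cases "k = 0") auto
  have nb: "nb x \<subseteq> V" "real (card (nb x)) \<ge> \<beta> * real N" if "x \<in> V" for x
    using deg[OF that] by (auto simp: nb_def degree_into_def N_def)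
  define B2 where "B2 = (\<lambda>q. {f \<in> {..<k} \<rightarrow>\<^sub>E V. real (card {j \<in> {..<k}. f j \<in> nb q}) \<le> (\<beta> - \<tau>) * real (card {..<k})})"
  define \<Omega> where "\<Omega> = (\<lambda>(i::nat) (x::'b) j. if j = i then {x} else V)"
  \<comment> \<open>Coordinate \<open>i\<close> always counts as a hit, so that the density
    condition holds there as well, by \<open>\<beta> \<le> 1\<close>. The false hit costs 1, at most
    \<open>\<tau> * k\<close>; this accounts for the second \<tau> in the statement.\<close>
  define A where "A = (\<lambda>(i::nat) (x::'b) j. if j = i then {x} else nb x)"
  define C where "C = (\<lambda>i x. {f \<in> PiE {..<k} (\<Omega> i x). real (card {j \<in> {..<k}. f j \<in> A i x j}) \<le> (\<beta> - \<tau>) * real (card {..<k})})"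
  have B2: "real (card (B2 q)) \<le> b" if "q \<in> Q" for q
    using card_PiE_few_hits[of "{..<k}" "\<lambda>_. V" "\<lambda>_. nb q" \<beta> \<tau>] V nb[of q] that Q \<beta> \<tau>
    by (auto simp: B2_def b_def N_def)
  \<comment> \<open>Fixing \<open>f i = x\<close> makes the neighbourhood of \<open>f i\<close> independent of the other coordinates.\<close>
  have C: "real (card (C i x)) * real N \<le> b" if "i < k" "x \<in> V" for i x
  proof -
    have "real (card (C i x)) \<le> exp (- (\<tau>\<^sup>2 / 4) * real (card {..<k})) * real (\<Prod>j\<in>{..<k}. card (\<Omega> i x j))"
      unfolding C_def
      by (rule card_PiE_few_hits) (use V nb[OF that(2)] \<beta> \<tau> in \<open>auto simp: \<Omega>_def A_def N_def\<close>)
    moreover have "(\<Prod>j\<in>{..<k}. card (\<Omega> i x j)) = N ^ (k - 1)"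
    proof -
      have "(\<Prod>j\<in>{..<k}. card (\<Omega> i x j)) = card (\<Omega> i x i) * (\<Prod>j\<in>{..<k} - {i}. card (\<Omega> i x j))"
        using that by (intro prod.remove) auto
      also have "(\<Prod>j\<in>{..<k} - {i}. card (\<Omega> i x j)) = (\<Prod>j\<in>{..<k} - {i}. N)"
        by (rule prod.cong) (auto simp: \<Omega>_def N_def)
      finally show ?thesis using that by (simp add: \<Omega>_def)
    qed
    ultimately have "real (card (C i x)) * real N \<le> exp (- (\<tau>\<^sup>2 / 4) * real k) * real (N ^ (k - 1)) * real N"
      by (intro mult_right_mono) auto
    also have "\<dots> = b" using kpos by (simp add: b_def power_eq_if[of _ k])
    finally show ?thesis .
  qed
  have sub: "{f \<in> {..<k} \<rightarrow>\<^sub>E V. inj_on f {..<k} \<and> low_degree E Q ((\<beta> - 2 * \<tau>) * real k) k f}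
     \<subseteq> (\<Union>q\<in>Q. B2 q) \<union> (\<Union>i\<in>{..<k}. \<Union>x\<in>V. C i x)" (is "?L \<subseteq> ?R")
  proof
    fix f assume f: "f \<in> ?L"
    then have fV: "f \<in> {..<k} \<rightarrow>\<^sub>E V" and inj: "inj_on f {..<k}" by auto
    obtain v where v: "v \<in> f ` {..<k} \<union> Q" "real (degree_into E (f ` {..<k}) v) < (\<beta> - 2 * \<tau>) * real k"
      using f unfolding low_degree_def by blast
    have "{j \<in> {..<k}. {v, f j} \<in> E} = {j \<in> {..<k}. f j \<in> nb v}" using fV by (auto simp: nb_def)
    then have d: "real (card {j \<in> {..<k}. f j \<in> nb v}) < (\<beta> - 2 * \<tau>) * real k"
      using v(2) degree_into_image[OF inj, of E v] by simp
    show "f \<in> ?R"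
    proof (cases "v \<in> Q")
      case True
      have "(\<beta> - 2 * \<tau>) * real k \<le> (\<beta> - \<tau>) * real k" using \<tau> by (intro mult_right_mono) auto
      then have "f \<in> B2 v" using fV d by (simp add: B2_def)
      then show ?thesis using True by blast
    next
      case False
      then obtain i where i: "i < k" "v = f i" using v(1) by blast
      have vV: "v \<in> V" using fV i by auto
      have "f \<in> PiE {..<k} (\<Omega> i v)" using fV i by (auto simp: PiE_def Pi_def \<Omega>_def)
      moreover have "real (card {j \<in> {..<k}. f j \<in> A i v j}) \<le> (\<beta> - \<tau>) * real (card {..<k})"
      proof -
        have "card {j \<in> {..<k}. f j \<in> A i v j} \<le> card (insert i {j \<in> {..<k}. f j \<in> nb v})"
          by (rule card_mono) (auto simp: A_def split: if_splits)
        also have "\<dots> \<le> Suc (card {j \<in> {..<k}. f j \<in> nb v})" by (simp add: card_insert_if)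
        finally have "real (card {j \<in> {..<k}. f j \<in> A i v j}) \<le> 1 + (\<beta> - 2 * \<tau>) * real k"
          using d by linarith
        also have "\<dots> \<le> (\<beta> - \<tau>) * real k" using k by (simp add: algebra_simps)
        finally show ?thesis by simp
      qed
      ultimately have "f \<in> C i v" by (simp add: C_def)
      then show ?thesis using i vV by blast
    qed
  qed
  have finQ: "finite Q" using Q V finite_subset by blast
  have finU: "finite ({..<k} \<rightarrow>\<^sub>E V)" using V by (intro finite_PiE) auto
  have "C i x \<subseteq> {..<k} \<rightarrow>\<^sub>E V" if "x \<in> V" for i x
    using that by (auto simp: C_def \<Omega>_def PiE_def Pi_def split: if_splits)
  then have finR: "finite ?R" using finU by (intro finite_subset[OF _ finU]) (auto simp: B2_def)
  have "real (card ?L) \<le> real (card ?R)" using card_mono[OF finR sub] by simp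
  also have "\<dots> \<le> real (card (\<Union>q\<in>Q. B2 q)) + real (card (\<Union>i\<in>{..<k}. \<Union>x\<in>V. C i x))"
    using card_Un_le[of "\<Union>q\<in>Q. B2 q" "\<Union>i\<in>{..<k}. \<Union>x\<in>V. C i x"] by linarith
  also have "real (card (\<Union>q\<in>Q. B2 q)) \<le> real (card Q) * b"
  proof -
    have "real (card (\<Union>q\<in>Q. B2 q)) \<le> (\<Sum>q\<in>Q. real (card (B2 q)))"
      using card_UN_le[OF finQ, of B2] by (metis of_nat_le_iff of_nat_sum)
    also have "\<dots> \<le> (\<Sum>q\<in>Q. b)" by (rule sum_mono) (rule B2)
    finally show ?thesis by simp
  qed
  also have "real (card (\<Union>i\<in>{..<k}. \<Union>x\<in>V. C i x)) \<le> real k * b"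
  proof -
    have "real (card (\<Union>x\<in>V. C i x)) \<le> b" if "i < k" for i
    proof -
      have "real (card (\<Union>x\<in>V. C i x)) \<le> (\<Sum>x\<in>V. real (card (C i x)))"
        using card_UN_le[OF V, of "C i"] by (metis of_nat_le_iff of_nat_sum)
      also have "\<dots> \<le> (\<Sum>x\<in>V. b / real N)"
      proof (rule sum_mono)
        fix x assume x: "x \<in> V"
        then have "N > 0" using V by (auto simp: N_def card_gt_0_iff)
        then show "real (card (C i x)) \<le> b / real N" using C[OF that x] by (simp add: le_divide_eq)
      qed
      also have "\<dots> \<le> b" by (simp add: N_def b_def)
      finally show ?thesis .
    qed
    then have "(\<Sum>i<k. real (card (\<Union>x\<in>V. C i x))) \<le> (\<Sum>i<k. b)" by (intro sum_mono) auto
    moreover have "real (card (\<Union>i\<in>{..<k}. \<Union>x\<in>V. C i x)) \<le> (\<Sum>i<k. real (card (\<Union>x\<in>V. C i x)))"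
      using card_UN_le[of "{..<k}" "\<lambda>i. \<Union>x\<in>V. C i x"] by (metis finite_lessThan of_nat_le_iff of_nat_sum)
    ultimately show ?thesis by simp
  qed
  finally show ?thesis by (simp add: b_def N_def algebra_simps)
qed

lemma ex_exp_decay:
  fixes c \<eta> a :: real assumes "c > 0" "\<eta> > 0" "a \<ge> 0"
  shows "\<exists>k0. \<forall>k\<ge>k0. (real k + a) * exp (- c * real k) \<le> \<eta>"
proof -
  obtain k1 where k1: "\<And>k. k \<ge> k1 \<Longrightarrow> (\<eta> * c\<^sup>2 / 4) * real k \<ge> 1"
    using ex_nat_mult_ge[of "\<eta> * c\<^sup>2 / 4" 1] assms by auto
  obtain k2 where k2: "real k2 \<ge> a" using real_arch_simple by blast
  have "(real k + a) * exp (- c * real k) \<le> \<eta>" if k: "k \<ge> max (max k1 k2) 1" for k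
  proof -
    have kp: "real k > 0" "a \<le> real k" using k k2 by auto
    have ck: "c * real k \<ge> 0" using assms by simp
    have "(c * real k)\<^sup>2 / 2 \<le> exp (c * real k)"
      using exp_lower_Taylor_quadratic[OF ck] ck by linarith
    then have "exp (- c * real k) \<le> 2 / (c * real k)\<^sup>2"
      using assms kp by (simp add: exp_minus field_simps)
    then have "(real k + a) * exp (- c * real k) \<le> (2 * real k) * (2 / (c * real k)\<^sup>2)"
      using kp by (intro mult_mono) auto
    also have "\<dots> = 4 / (c\<^sup>2 * real k)" using kp assms by (simp add: power2_eq_square field_simps)
    also have "\<dots> \<le> \<eta>" using k1[of k] k kp assms by (simp add: field_simps)
    finally show ?thesis .
  qed
  then show ?thesis by blast
qed

section \<open>Colour classes and random permutations\<close>

text \<open>From here on the threshold is known only through its two bounds. Graphs without edges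
  are left to the end, since \<open>factor_threshold\<close> says nothing about them.\<close>

locale factor_thresholds =
  fixes F :: "'a graph" and \<delta> :: real and r t :: nat
  assumes is_graph_F: "is_graph F" and card_verts_F: "card (verts F) = r" and card_edges_F: "card (edges F) = t"
    and r_pos: "r > 0" and t_pos: "t > 0"
    and factor_bound: "factor_threshold_bound F \<delta>" and special_bound: "special_copy_bound F \<delta>"
    and \<delta>_nonneg: "\<delta> \<ge> 0"
begin

text \<open>When \<open>D\<close> is a single class on \<open>X\<close>, the graph of any one of its
  colours serves as the common graph; \<open>D \<noteq> {}\<close> provides such a colour.\<close>

lemma rainbow_factor_class:
  assumes \<epsilon>: "\<epsilon> > 0"
  shows "\<exists>k\<^sub>0. \<forall>P (X::nat set) D (G::'c \<Rightarrow> nat set set) d. finite P \<longrightarrow> finite X \<longrightarrow> finite D \<longrightarrow> D \<noteq> {} \<longrightarrow>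
      D \<inter> P = {} \<longrightarrow> k\<^sub>0 + r * card P \<le> card X \<longrightarrow> r dvd card X \<longrightarrow>
      (card D + card P) * r = t * card X \<longrightarrow>
      (\<forall>c. simple_edges (G c)) \<longrightarrow>
      (\<forall>c\<in>D. \<forall>c'\<in>D. \<forall>e. e \<subseteq> X \<longrightarrow> e \<in> G c \<longrightarrow> e \<in> G c') \<longrightarrow>
      (\<forall>c\<in>D \<union> P. \<forall>v\<in>X. real (degree_into (G c) X v) \<ge> d) \<longrightarrow>
      d - real (r * card P) \<ge> (\<delta> + \<epsilon>) * real (card X) \<longrightarrow>
      rainbow_factor F G X (D \<union> P)"
proof -
  obtain k0 where k0: "\<forall>P (X::nat set) D (G::'c \<Rightarrow> nat set set) E d. finite P \<longrightarrow> finite X \<longrightarrow> finite D \<longrightarrow> D \<inter> P = {} \<longrightarrow>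
      k0 + r * card P \<le> card X \<longrightarrow> r dvd card X \<longrightarrow>
      (card D + card P) * r = t * card X \<longrightarrow>
      (\<forall>c. simple_edges (G c)) \<longrightarrow> simple_edges E \<longrightarrow>
      (\<forall>c\<in>D. \<forall>e\<in>E. e \<subseteq> X \<longrightarrow> e \<in> G c) \<longrightarrow>
      (\<forall>v\<in>X. real (degree_into E X v) \<ge> d) \<longrightarrow>
      (\<forall>p\<in>P. \<forall>v\<in>X. real (degree_into (G p) X v) \<ge> d) \<longrightarrow>
      d - real (r * card P) \<ge> (\<delta> + \<epsilon>) * real (card X) \<longrightarrow>
      rainbow_factor F G X (D \<union> P)"
    using rainbow_factor_with_special_colours[OF is_graph_F _ _ factor_bound special_bound \<epsilon> \<delta>_nonneg,
        where 'c = 'c, unfolded card_verts_F card_edges_F, OF r_pos t_pos] by (elim exE)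
  note k0' = k0[rule_format (no_asm)]
  show ?thesis
  proof (intro exI[of _ k0] allI impI)
    fix P X D and G :: "'c \<Rightarrow> nat set set" and d
    assume a: "finite P" "finite X" "finite D" "D \<noteq> {}" "D \<inter> P = {}" "k0 + r * card P \<le> card X" "r dvd card X"
      "(card D + card P) * r = t * card X" "\<forall>c. simple_edges (G c)"
      "\<forall>c\<in>D. \<forall>c'\<in>D. \<forall>e. e \<subseteq> X \<longrightarrow> e \<in> G c \<longrightarrow> e \<in> G c'"
      "\<forall>c\<in>D \<union> P. \<forall>v\<in>X. real (degree_into (G c) X v) \<ge> d"
      "d - real (r * card P) \<ge> (\<delta> + \<epsilon>) * real (card X)"
    obtain c0 where c0: "c0 \<in> D" using a(4) by blast
    show "rainbow_factor F G X (D \<union> P)"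
    proof (rule k0'[OF a(1,2,3,5,6,7,8,9), where E = "G c0" and d = d])
      show "simple_edges (G c0)" using a(9) by blast
      show "\<forall>c\<in>D. \<forall>e\<in>G c0. e \<subseteq> X \<longrightarrow> e \<in> G c" using a(10) c0 by blast
      show "\<forall>v\<in>X. d \<le> real (degree_into (G c0) X v)" using a(11) c0 by blast
      show "\<forall>p\<in>P. \<forall>v\<in>X. d \<le> real (degree_into (G p) X v)" using a(11) by blast
    qed (rule a(12))
  qed
qed

end

section \<open>Colour classes and averaging\<close>

text \<open>Pigeonhole on the traces \<open>G c \<inter> Pow X\<close>; as subsets of
  \<open>Pow X\<close> they number at most \<open>2 ^ (2 ^ card X)\<close>.\<close>

lemma large_colour_class:
  assumes "finite X" "finite S" "2 ^ (2 ^ card X) * s \<le> card S"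
  obtains S' where "S' \<subseteq> S" "s \<le> card S'"
    "\<And>c c' e. c \<in> S' \<Longrightarrow> c' \<in> S' \<Longrightarrow> e \<subseteq> X \<Longrightarrow> e \<in> G c \<Longrightarrow> e \<in> G c'"
proof -
  obtain y where y: "s \<le> card {c \<in> S. G c \<inter> Pow X = y}"
  proof (rule pigeonhole_fibre[of S "Pow (Pow X)" "\<lambda>c. G c \<inter> Pow X" s])
    show "card (Pow (Pow X)) * s \<le> card S" using assms by (simp add: card_Pow)
  qed (use assms in auto)
  show thesis
    by (rule that[of "{c \<in> S. G c \<inter> Pow X = y}"]) (use y in blast)+
qed

lemma ex_le_average:
  fixes g :: "'b \<Rightarrow> real"
  assumes "finite A" "A \<noteq> {}" "sum g A \<le> real (card A) * M"
  shows "\<exists>x\<in>A. g x \<le> M"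
proof (rule ccontr)
  assume "\<not> ?thesis"
  then have "(\<Sum>x\<in>A. M) < sum g A" using assms by (intro sum_strict_mono) auto
  then show False using assms(3) by simp
qed

lemma card_markov:
  fixes g :: "'b \<Rightarrow> real"
  assumes "finite A" "\<And>x. x \<in> A \<Longrightarrow> g x \<ge> 0"
  shows "real (card {x \<in> A. g x \<ge> M}) * M \<le> sum g A"
proof -
  have "real (card {x \<in> A. g x \<ge> M}) * M = (\<Sum>x\<in>{x \<in> A. g x \<ge> M}. M)" by simp
  also have "\<dots> \<le> (\<Sum>x\<in>{x \<in> A. g x \<ge> M}. g x)" by (rule sum_mono) auto
  also have "\<dots> \<le> sum g A" using assms by (intro sum_mono2) auto
  finally show ?thesis .
qed

section \<open>Blocks of a random permutation\<close>

text \<open>An extensional function, so that a block of a random permutation can be compared with a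
  uniformly random element of \<open>{..<k} \<rightarrow>\<^sub>E V\<close>.\<close>

definition block :: "nat \<Rightarrow> nat \<Rightarrow> 'b list \<Rightarrow> nat \<Rightarrow> 'b" where
  "block k i xs = (\<lambda>j\<in>{..<k}. xs ! (i * k + j))"

lemma block_index_less:
  assumes "i < m" "m * k \<le> N" "j < k" shows "i * k + j < (N::nat)"
proof -
  have "i * k + j < Suc i * k" using assms(3) by simp
  also have "\<dots> \<le> m * k" using assms(1) by (intro mult_le_mono1) simp
  finally show ?thesis using assms(2) by simp
qed

lemma block_in_PiE:
  assumes "xs \<in> permutations_of_set V" "i < m" "m * k \<le> card V"
  shows "block k i xs \<in> {..<k} \<rightarrow>\<^sub>E V" "inj_on (block k i xs) {..<k}"
proof -
  have xs: "set xs = V" "distinct xs" "length xs = card V"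
    using assms(1) by (auto simp: permutations_of_set_def distinct_card)
  have less: "i * k + j < length xs" if "j < k" for j
    using block_index_less[OF assms(2,3) that] xs by simp
  show "block k i xs \<in> {..<k} \<rightarrow>\<^sub>E V" using less xs by (auto simp: block_def)
  show "inj_on (block k i xs) {..<k}"
    using less xs by (auto simp: block_def inj_on_def nth_eq_iff_index_eq)
qed

lemma block_disjoint:
  assumes "xs \<in> permutations_of_set V" "i < m" "i' < m" "i \<noteq> i'" "m * k \<le> card V"
  shows "block k i xs ` {..<k} \<inter> block k i' xs ` {..<k} = {}"
proof (rule ccontr)
  assume "\<not> ?thesis"
  then obtain j j' where j: "j < k" "j' < k" "xs ! (i * k + j) = xs ! (i' * k + j')"
    by (auto simp: block_def)
  have xs: "distinct xs" "length xs = card V"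
    using assms(1) by (auto simp: permutations_of_set_def distinct_card)
  have eq: "i * k + j = i' * k + j'"
    using j xs block_index_less[OF assms(2,5) j(1)] block_index_less[OF assms(3,5) j(2)]
    by (simp add: nth_eq_iff_index_eq)
  have "(i * k + j) div k = i" "(i' * k + j') div k = i'" using j by auto
  then show False using eq assms(4) by simp
qed

text \<open>Cutting out a known block loses no information and leaves a permutation of the remaining
  vertices.\<close>

lemma card_permutations_block_le:
  assumes V: "finite V" and i: "i < m" "m * k \<le> card V"
    and f: "f \<in> {..<k} \<rightarrow>\<^sub>E V" "inj_on f {..<k}"
  shows "card {xs \<in> permutations_of_set V. block k i xs = f} \<le> fact (card V - k)"
proof -
  let ?A = "{xs \<in> permutations_of_set V. block k i xs = f}"
  let ?h = "\<lambda>xs. take (i * k) xs @ drop (i * k + k) xs"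
  have split: "xs = take (i * k) xs @ map f [0..<k] @ drop (i * k + k) xs
      \<and> length (take (i * k) xs) = i * k" if "xs \<in> ?A" for xs
  proof -
    have len: "length xs = card V" using that by (auto simp: permutations_of_set_def distinct_card)
    have ik: "i * k + k \<le> length xs"
    proof -
      have "Suc i * k \<le> m * k" using i(1) by (intro mult_le_mono1) simp
      then show ?thesis using i(2) len by simp
    qed
    have "take k (drop (i * k) xs) = map f [0..<k]"
    proof (rule nth_equalityI)
      show "length (take k (drop (i * k) xs)) = length (map f [0..<k])" using ik by simp
      fix j assume "j < length (take k (drop (i * k) xs))"
      then have j: "j < k" by simp
      have "f j = xs ! (i * k + j)" using that j by (auto simp: block_def)
      then show "take k (drop (i * k) xs) ! j = map f [0..<k] ! j" using j ik by simp
    qed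
    moreover have "xs = take (i * k) xs @ take k (drop (i * k) xs) @ drop k (drop (i * k) xs)"
      by (simp only: append_take_drop_id)
    ultimately show ?thesis using ik by (simp add: add.commute)
  qed
  have "card ?A \<le> card (permutations_of_set (V - f ` {..<k}))"
  proof (rule card_inj_on_le[of ?h])
    show "inj_on ?h ?A"
    proof (rule inj_onI)
      fix xs ys assume a: "xs \<in> ?A" "ys \<in> ?A" "?h xs = ?h ys"
      have "take (i * k) xs = take (i * k) ys \<and> drop (i * k + k) xs = drop (i * k + k) ys"
        using a(3) split[OF a(1)] split[OF a(2)] by (metis append_eq_append_conv)
      then show "xs = ys" using split[OF a(1)] split[OF a(2)] by metis
    qed
    show "?h ` ?A \<subseteq> permutations_of_set (V - f ` {..<k})"
    proof
      fix ys assume "ys \<in> ?h ` ?A"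
      then obtain xs where xs: "xs \<in> ?A" "ys = ?h xs" by blast
      have d: "distinct xs" "set xs = V" using xs(1) by (auto simp: permutations_of_set_def)
      define a b where "a = take (i * k) xs" and "b = drop (i * k + k) xs"
      have e: "xs = a @ map f [0..<k] @ b" using split[OF xs(1)] by (simp add: a_def b_def)
      have img: "set (map f [0..<k]) = f ` {..<k}" by auto
      have "distinct (a @ b)" using d(1) unfolding e by auto
      moreover have "set (a @ b) = V - f ` {..<k}"
        using d unfolding e img[symmetric] by auto
      ultimately show "ys \<in> permutations_of_set (V - f ` {..<k})"
        using xs(2) by (simp add: a_def b_def permutations_of_set_def)
    qed
  qed simp
  also have "\<dots> = fact (card V - k)"
  proof -
    have "f ` {..<k} \<subseteq> V" using f(1) by auto
    then have "card (V - f ` {..<k}) = card V - k"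
      using card_image[OF f(2)] V by (simp add: card_Diff_subset finite_subset)
    then show ?thesis using V by (simp add: card_permutations_of_set)
  qed
  finally show ?thesis .
qed

text \<open>A block equals a given injective map with probability at most
  \<open>fact (N - k) / fact N\<close>. For \<open>N \<ge> 2 * k * k\<close> this is at most twice
  the probability under uniformly random maps, so estimates for those carry over to blocks.\<close>

lemma power_mult_fact_le:
  assumes "2 * k * k \<le> N"
  shows "real N ^ k * fact (N - k) \<le> 2 * fact N"
proof (cases "k = 0")
  case True then show ?thesis by simp
next
  case False
  have "k \<le> 2 * k * k" using False by (cases k) auto
  then have kN: "k \<le> N" using assms by linarith
  then have N: "N > 0" using False by simp
  define x where "x = real k / real N"
  have "real k * x \<le> 1 / 2"
  proof -
    have "real (2 * k * k) \<le> real N" using assms by (simp only: of_nat_le_iff)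
    then show ?thesis using N by (simp add: x_def field_simps)
  qed
  moreover have "x \<le> 1" using kN N by (simp add: x_def)
  then have "1 - real k * x \<le> (1 - x) ^ k" using Bernoulli_inequality[of "- x" k] by simp
  ultimately have "1 / 2 \<le> (1 - x) ^ k" by linarith
  then have "real N ^ k * (1 / 2) \<le> real N ^ k * (1 - x) ^ k" by (intro mult_left_mono) auto
  also have "\<dots> = (real N - real k) ^ k"
    using N by (simp add: x_def field_simps flip: power_mult_distrib)
  finally have "real N ^ k \<le> 2 * (real N - real k) ^ k" by simp
  moreover have "(real N - real k) ^ k * fact (N - k) \<le> fact N"
  proof -
    have "(N - k) ^ k * fact (N - k) \<le> fact N"
    proof -
      have "fact N = fact (N - k) * \<Prod>{N - k + 1..N}"
        using fact_eq_fact_times[of "N - k" N] by simp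
      moreover have "(N - k) ^ card {N - k + 1..N} \<le> \<Prod>{N - k + 1..N}"
        unfolding prod_constant[symmetric] by (rule prod_mono) auto
      ultimately show ?thesis using kN by simp
    qed
    then have "real ((N - k) ^ k * fact (N - k)) \<le> real (fact N)" by (simp only: of_nat_le_iff)
    then show ?thesis using kN by (simp add: of_nat_diff)
  qed
  then have "2 * ((real N - real k) ^ k * fact (N - k)) \<le> 2 * fact N" by simp
  moreover have "real N ^ k * fact (N - k) \<le> 2 * (real N - real k) ^ k * fact (N - k)"
    using \<open>real N ^ k \<le> 2 * (real N - real k) ^ k\<close> by (intro mult_right_mono) auto
  ultimately show ?thesis unfolding mult.assoc by linarith
qed

text \<open>The expected number of bad pairs of a block and a colour, estimated through uniformly
  random maps at the price of a factor 2.\<close>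

lemma ex_permutation_few_bad_blocks:
  assumes V: "finite V" and m: "m * k \<le> card V" and k: "2 * k * k \<le> card V" and C: "finite C"
    and bad: "\<And>c. c \<in> C \<Longrightarrow> real (card {f \<in> {..<k} \<rightarrow>\<^sub>E V. inj_on f {..<k} \<and> bad c f}) \<le> \<eta> * real (card V) ^ k"
    and \<eta>: "\<eta> \<ge> 0"
  shows "\<exists>xs\<in>permutations_of_set V. (\<Sum>i<m. real (card {c \<in> C. bad c (block k i xs)})) \<le> 2 * \<eta> * real m * real (card C)"
proof (rule ex_le_average)
  define N where "N = card V"
  define PS where "PS = permutations_of_set V"
  have finPS: "finite PS" by (simp add: PS_def)
  have one: "real (card {xs \<in> PS. bad c (block k i xs)}) \<le> 2 * \<eta> * fact N" if c: "c \<in> C" and i: "i < m" for c i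
  proof -
    let ?B = "{f \<in> {..<k} \<rightarrow>\<^sub>E V. inj_on f {..<k} \<and> bad c f}"
    have finB: "finite ?B"
      using V by (intro finite_subset[OF _ finite_PiE[of "{..<k}" "\<lambda>_. V"]]) auto
    have "{xs \<in> PS. bad c (block k i xs)} \<subseteq> (\<Union>f\<in>?B. {xs \<in> PS. block k i xs = f})"
      using block_in_PiE[OF _ i m] by (auto simp: PS_def)
    then have "card {xs \<in> PS. bad c (block k i xs)} \<le> card (\<Union>f\<in>?B. {xs \<in> PS. block k i xs = f})"
      using finPS finB by (intro card_mono) auto
    also have "\<dots> \<le> (\<Sum>f\<in>?B. card {xs \<in> PS. block k i xs = f})" using finB by (rule card_UN_le)
    also have "\<dots> \<le> (\<Sum>f\<in>?B. fact (N - k))"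
      unfolding PS_def N_def by (rule sum_mono) (rule card_permutations_block_le[OF V i m], auto)
    also have "\<dots> = card ?B * fact (N - k)" by simp
    finally have "real (card {xs \<in> PS. bad c (block k i xs)}) \<le> real (card ?B * fact (N - k))"
      by (simp only: of_nat_le_iff)
    also have "\<dots> \<le> (\<eta> * real N ^ k) * fact (N - k)"
      using bad[OF c] by (simp add: N_def mult_right_mono)
    also have "\<dots> \<le> \<eta> * (2 * fact N)"
      using power_mult_fact_le[of k N] k \<eta> unfolding mult.assoc N_def by (intro mult_left_mono) auto
    finally show ?thesis by simp
  qed
  have "(\<Sum>xs\<in>PS. \<Sum>i<m. real (card {c \<in> C. bad c (block k i xs)}))
      = (\<Sum>i<m. \<Sum>xs\<in>PS. real (card {c \<in> C. bad c (block k i xs)}))" by (rule sum.swap)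
  also have "\<dots> = (\<Sum>i<m. \<Sum>c\<in>C. real (card {xs \<in> PS. bad c (block k i xs)}))"
    using sum_card_swap[OF finPS C] by (intro sum.cong) (auto simp flip: of_nat_sum)
  also have "\<dots> \<le> (\<Sum>i<m. \<Sum>c\<in>C. 2 * \<eta> * fact N)" by (intro sum_mono one) auto
  also have "\<dots> = real (card PS) * (2 * \<eta> * real m * real (card C))"
    using V by (simp add: PS_def N_def card_permutations_of_set)
  finally show "(\<Sum>xs\<in>permutations_of_set V. \<Sum>i<m. real (card {c \<in> C. bad c (block k i xs)}))
      \<le> real (card (permutations_of_set V)) * (2 * \<eta> * real m * real (card C))"
    by (simp add: PS_def)
qed (use V in auto)

section \<open>Absorbers\<close>

definition absorber :: "'a graph \<Rightarrow> ('c \<Rightarrow> 'b set set) \<Rightarrow> 'b set \<Rightarrow> 'c set \<Rightarrow> 'b set \<Rightarrow> 'c set \<Rightarrow> bool" where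
  "absorber F G Q P T D \<longleftrightarrow> T \<inter> Q = {} \<and> D \<inter> P = {} \<and>
     rainbow_factor F G T D \<and> rainbow_factor F G (T \<union> Q) (D \<union> P)"

context factor_thresholds
begin

text \<open>At least half of the maps \<open>f\<close> are good: injective, avoiding
  \<open>Q\<close>, and with large degrees into \<open>T\<close> for all colours of \<open>P\<close>
  and more than half of \<open>C\<close>. Of the latter colours outside \<open>P\<close>, a constant
  proportion forms one class on \<open>T \<union> Q\<close>. Every injection \<open>g\<close> into
  this class gives an absorber, by \<open>rainbow_factor_class\<close> with no special colours on
  \<open>T\<close> and with \<open>P\<close> on \<open>T \<union> Q\<close>. Counting maps instead
  of sets makes the later random choice a product space.\<close>

lemma absorber_density:
  fixes \<epsilon> :: real
  assumes \<epsilon>: "\<epsilon> > 0"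
  shows "\<exists>k' \<beta> n\<^sub>0. k' > 0 \<and> \<beta> > 0 \<and> (\<forall>n (V::nat set) (C::'c set) G Q P. n\<^sub>0 \<le> n \<longrightarrow> finite V \<longrightarrow> card V = r * n \<longrightarrow>
      finite C \<longrightarrow> card C = t * n \<longrightarrow> (\<forall>c. simple_edges (G c)) \<longrightarrow>
      (\<forall>c\<in>C. min_degree_ge (G c) V (\<delta> + \<epsilon>)) \<longrightarrow>
      Q \<subseteq> V \<longrightarrow> card Q = r \<longrightarrow> P \<subseteq> C \<longrightarrow> card P = t \<longrightarrow>
      real (card {(f, g) \<in> ({..<r * k'} \<rightarrow>\<^sub>E V) \<times> ({..<t * k'} \<rightarrow>\<^sub>E C). inj_on f {..<r * k'} \<and> inj_on g {..<t * k'} \<and>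
          absorber F G Q P (f ` {..<r * k'}) (g ` {..<t * k'})})
        \<ge> \<beta> * real (card (({..<r * k'} \<rightarrow>\<^sub>E V) \<times> ({..<t * k'} \<rightarrow>\<^sub>E C))))"
proof -
  have \<epsilon>2: "\<epsilon> / 2 > 0" using \<epsilon> by simp
  obtain k0 where k0: "\<forall>P (X::nat set) D (G::'c \<Rightarrow> nat set set) d. finite P \<longrightarrow> finite X \<longrightarrow> finite D \<longrightarrow> D \<noteq> {} \<longrightarrow>
      D \<inter> P = {} \<longrightarrow> k0 + r * card P \<le> card X \<longrightarrow> r dvd card X \<longrightarrow>
      (card D + card P) * r = t * card X \<longrightarrow>
      (\<forall>c. simple_edges (G c)) \<longrightarrow>
      (\<forall>c\<in>D. \<forall>c'\<in>D. \<forall>e. e \<subseteq> X \<longrightarrow> e \<in> G c \<longrightarrow> e \<in> G c') \<longrightarrow>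
      (\<forall>c\<in>D \<union> P. \<forall>v\<in>X. real (degree_into (G c) X v) \<ge> d) \<longrightarrow>
      d - real (r * card P) \<ge> (\<delta> + \<epsilon> / 2) * real (card X) \<longrightarrow>
      rainbow_factor F G X (D \<union> P)"
    using rainbow_factor_class[OF \<epsilon>2, where 'c = 'c] by (elim exE)
  \<comment> \<open>Then \<open>d\<close> exceeds \<open>(\<delta> + \<epsilon> / 2) * k\<close> by
    \<open>\<epsilon> / 4 * k\<close>, which pays for the \<open>r * t\<close> vertices of the
    copies placing \<open>P\<close> and for enlarging \<open>T\<close> by \<open>r\<close>
    vertices.\<close>
  define \<tau> where "\<tau> = \<epsilon> / 8"
  have \<tau>: "\<tau> > 0" using \<epsilon> by (simp add: \<tau>_def)
  \<comment> \<open>The \<open>t\<close> colours of \<open>P\<close> cost \<open>t * \<eta>\<close>,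
    and the maps bad for half of all colours cost \<open>2 * \<eta>\<close> by Markov's inequality,
    together \<open>1 / 8\<close>.\<close>
  define \<eta> where "\<eta> = 1 / (8 * (real t + 2))"
  have \<eta>: "\<eta> > 0" "(real t + 2) * \<eta> = 1 / 8" by (auto simp: \<eta>_def)
  obtain k1 where k1: "\<And>k. k \<ge> k1 \<Longrightarrow> (real k + real r) * exp (- (\<tau>\<^sup>2 / 4) * real k) \<le> \<eta>"
    using ex_exp_decay[of "\<tau>\<^sup>2 / 4" \<eta> "real r"] \<tau> \<eta> by auto
  obtain k2 where k2: "\<And>k. k \<ge> k2 \<Longrightarrow> \<tau> * real k \<ge> 1" using ex_nat_mult_ge[OF \<tau>] by blast
  obtain k3 where k3: "\<And>k. k \<ge> k3 \<Longrightarrow> (\<epsilon> / 4) * real k \<ge> real (r * t) + (\<delta> + \<epsilon> / 2) * real r"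
    using ex_nat_mult_ge[of "\<epsilon> / 4" "real (r * t) + (\<delta> + \<epsilon> / 2) * real r"] \<epsilon> by auto
  define k' where "k' = Suc (k0 + r * t + k1 + k2 + k3)"
  define k where "k = r * k'"
  define l where "l = t * k'"
  have k'pos: "k' > 0" by (simp add: k'_def)
  have "1 * k' \<le> k" unfolding k_def using r_pos by (intro mult_le_mono1) simp
  then have k: "k0 + r * t \<le> k" "k1 \<le> k" "k2 \<le> k" "k3 \<le> k" "k > 0" by (auto simp: k'_def)
  have l: "l > 0" using t_pos k'pos by (simp add: l_def)
  define B where "B = (2::nat) ^ (2 ^ (k + r))"
  have B: "B > 0" by (simp add: B_def)
  define d where "d = (\<delta> + \<epsilon> - 2 * \<tau>) * real k"
  have d1: "(\<delta> + \<epsilon> / 2) * real k \<le> d" unfolding d_def using \<epsilon> by (intro mult_right_mono) (auto simp: \<tau>_def)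
  have d2: "(\<delta> + \<epsilon> / 2) * real (k + r) \<le> d - real (r * t)"
  proof -
    have e1: "d = (\<delta> + \<epsilon> / 2) * real k + \<epsilon> / 4 * real k" by (simp add: d_def \<tau>_def field_simps)
    have e2: "(\<delta> + \<epsilon> / 2) * real (k + r) = (\<delta> + \<epsilon> / 2) * real k + (\<delta> + \<epsilon> / 2) * real r"
      by (simp add: distrib_left)
    show ?thesis unfolding e1 e2 using k3[OF k(4)] by linarith
  qed
  have B4: "1 / (4 * real B) > 0" using B by simp
  obtain n1 where n1: "\<And>n. n \<ge> n1 \<Longrightarrow> (1 / (4 * real B)) * real n \<ge> real (t + 1 + l)"
    using ex_nat_mult_ge[OF B4] by blast
  define n0 where "n0 = Suc (n1 + 8 * (k * (r + k)))"
  define \<gamma> where "\<gamma> = (1 / (4 * real B)) ^ l"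
  have \<gamma>: "\<gamma> > 0" using B by (simp add: \<gamma>_def)
  have main: "real (card {(f, g) \<in> ({..<k} \<rightarrow>\<^sub>E V) \<times> ({..<l} \<rightarrow>\<^sub>E C). inj_on f {..<k} \<and> inj_on g {..<l} \<and>
          absorber F G Q P (f ` {..<k}) (g ` {..<l})})
        \<ge> (\<gamma> / 2) * real (card (({..<k} \<rightarrow>\<^sub>E V) \<times> ({..<l} \<rightarrow>\<^sub>E C)))"
    if n: "n0 \<le> n" and V: "finite V" "card V = r * n" and C: "finite C" "card C = t * n"
      and G: "\<forall>c. simple_edges (G c)"
      and deg: "\<forall>c\<in>C. min_degree_ge (G c) V (\<delta> + \<epsilon>)"
      and Q: "Q \<subseteq> V" "card Q = r" and P: "P \<subseteq> C" "card P = t"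
    for n and V :: "nat set" and C :: "'c set" and G Q P
  proof -
    have n': "n > 0" "n1 \<le> n" "8 * (k * (r + k)) \<le> n" using n by (auto simp: n0_def)
    define N where "N = real (card V)"
    have Vne: "V \<noteq> {}" using V n'(1) r_pos by auto
    have Cne: "C \<noteq> {}" using C n'(1) t_pos by auto
    have Npos: "N > 0" using V(1) Vne by (simp add: N_def card_gt_0_iff)
    have cC: "real (card C) > 0" using C(1) Cne by (simp add: card_gt_0_iff)
    have finP: "finite P" and finQ: "finite Q" using P Q V C finite_subset by blast+
    \<comment> \<open>The estimate for random maps takes a density at most 1; any vertex and any
      colour show that this holds.\<close>
    have \<beta>1: "\<delta> + \<epsilon> \<le> 1"
    proof -
      obtain v c where vc: "v \<in> V" "c \<in> C" using Vne Cne by blast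
      have "(\<delta> + \<epsilon>) * N \<le> 1 * N"
        using deg vc degree_into_le[OF V(1), of "G c" v] unfolding N_def by fastforce
      then show ?thesis using Npos by (metis mult_le_cancel_right_pos)
    qed
    define U where "U = {..<k} \<rightarrow>\<^sub>E V"
    define U' where "U' = {..<l} \<rightarrow>\<^sub>E C"
    have finU: "finite U" "finite U'" using V C by (auto simp: U_def U'_def intro: finite_PiE)
    have cU: "real (card U) = N ^ k" by (simp add: U_def N_def card_funcsetE)
    have cU': "real (card U') = real (card C) ^ l" by (simp add: U'_def card_funcsetE)
    define badc where "badc = (\<lambda>c. {f \<in> U. inj_on f {..<k} \<and> low_degree (G c) Q d k f})"
    have badc: "real (card (badc c)) \<le> \<eta> * N ^ k" if "c \<in> C" for c
    proof -
      have "real (card (badc c)) \<le> (real k + real (card Q)) * exp (- (\<tau>\<^sup>2 / 4) * real k) * real (card V) ^ k"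
        unfolding badc_def U_def d_def
        by (rule card_low_degree_le[OF V(1) Q(1)]) (use deg that \<delta>_nonneg \<epsilon> \<beta>1 \<tau> k2[OF k(3)] in auto)
      also have "\<dots> \<le> \<eta> * N ^ k"
        unfolding N_def using k1[OF k(2)] Q(2) by (intro mult_right_mono) auto
      finally show ?thesis .
    qed
    define bad1 where "bad1 = {f \<in> U. \<not> (inj_on f {..<k} \<and> f ` {..<k} \<inter> Q = {})}"
    define bad2 where "bad2 = (\<Union>p\<in>P. badc p)"
    define bad3 where "bad3 = {f \<in> U. real (card {c \<in> C. f \<in> badc c}) \<ge> real (card C) / 2}"
    have b1: "real (card bad1) \<le> 1 / 8 * N ^ k"
    proof -
      have "real (card bad1) \<le> real (k * (card Q + k)) / real (card V) * real (card V) ^ k"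
        unfolding bad1_def U_def by (rule card_not_inj_PiE_le[OF V(1) Vne Q(1)])
      also have "\<dots> \<le> 1 / 8 * real (card V) ^ k"
      proof (rule mult_right_mono)
        have "n \<le> r * n" using r_pos by simp
        then have "8 * (k * (card Q + k)) \<le> card V" using n'(3) unfolding V(2) Q(2) by linarith
        then have "8 * real (k * (card Q + k)) \<le> real (card V)" by linarith
        then show "real (k * (card Q + k)) / real (card V) \<le> 1 / 8"
          using Npos unfolding N_def by (simp add: pos_divide_le_eq)
      qed simp
      finally show ?thesis by (simp add: N_def)
    qed
    have b2: "real (card bad2) \<le> real t * (\<eta> * N ^ k)"
    proof -
      have "real (card bad2) \<le> (\<Sum>p\<in>P. real (card (badc p)))"
        unfolding bad2_def using card_UN_le[OF finP, of badc] by (metis of_nat_le_iff of_nat_sum)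
      also have "\<dots> \<le> (\<Sum>p\<in>P. \<eta> * N ^ k)" using badc P(1) by (intro sum_mono) auto
      finally show ?thesis using P(2) by simp
    qed
    have b3: "real (card bad3) \<le> 2 * (\<eta> * N ^ k)"
    proof -
      have "real (card bad3) * (real (card C) / 2) \<le> (\<Sum>f\<in>U. real (card {c \<in> C. f \<in> badc c}))"
        unfolding bad3_def by (rule card_markov[OF finU(1)]) simp
      also have "\<dots> = real (\<Sum>f\<in>U. card {c \<in> C. f \<in> badc c})" by simp
      also have "(\<Sum>f\<in>U. card {c \<in> C. f \<in> badc c}) = (\<Sum>c\<in>C. card {f \<in> U. f \<in> badc c})"
        by (rule sum_card_swap[OF finU(1) C(1)])
      also have "\<dots> = (\<Sum>c\<in>C. card (badc c))"
        by (intro sum.cong arg_cong[of _ _ card]) (auto simp: badc_def)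
      also have "real \<dots> \<le> (\<Sum>c\<in>C. \<eta> * N ^ k)" unfolding of_nat_sum by (rule sum_mono) (rule badc)
      also have "\<dots> = (2 * (\<eta> * N ^ k)) * (real (card C) / 2)" by simp
      finally show ?thesis using cC by (metis half_gt_zero mult_le_cancel_right_pos)
    qed
    define good where "good = U - (bad1 \<union> bad2 \<union> bad3)"
    have cgood: "real (card good) \<ge> N ^ k / 2"
    proof -
      have sub: "bad1 \<union> bad2 \<union> bad3 \<subseteq> U" by (auto simp: bad1_def bad2_def bad3_def badc_def)
      have "card (bad1 \<union> bad2 \<union> bad3) \<le> card bad1 + card bad2 + card bad3"
        by (meson card_Un_le order_trans add_le_mono1)
      then have "real (card (bad1 \<union> bad2 \<union> bad3)) \<le> 1 / 8 * N ^ k + real t * (\<eta> * N ^ k) + 2 * (\<eta> * N ^ k)"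
        using b1 b2 b3 by linarith
      also have "\<dots> = (1 / 8 + (real t + 2) * \<eta>) * N ^ k" by (simp add: algebra_simps)
      also have "\<dots> = N ^ k / 4" unfolding \<eta>(2) by simp
      finally have "real (card (bad1 \<union> bad2 \<union> bad3)) \<le> N ^ k / 4" .
      moreover have "card good = card U - card (bad1 \<union> bad2 \<union> bad3)"
        unfolding good_def using card_Diff_subset[OF finite_subset[OF sub finU(1)] sub] .
      moreover have "card (bad1 \<union> bad2 \<union> bad3) \<le> card U" using card_mono[OF finU(1) sub] .
      ultimately have "real (card good) \<ge> N ^ k - N ^ k / 4" using cU by (simp add: of_nat_diff)
      moreover have "N ^ k > 0" using Npos by simp
      ultimately show ?thesis by linarith
    qed
    define R where "R = (\<lambda>f g. inj_on f {..<k} \<and> inj_on g {..<l} \<and> absorber F G Q P (f ` {..<k}) (g ` {..<l}))"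
    have ext: "real (card {g \<in> U'. R f g}) \<ge> \<gamma> * real (card C) ^ l" if f: "f \<in> good" for f
    proof -
      define T where "T = f ` {..<k}"
      have fU: "f \<in> U" "inj_on f {..<k}" "T \<inter> Q = {}" using f by (auto simp: good_def bad1_def T_def)
      have T: "finite T" "card T = k" using fU by (auto simp: T_def card_image)
      have TQ: "finite (T \<union> Q)" "card (T \<union> Q) = k + r"
        using T finQ fU(3) Q(2) by (auto simp: card_Un_disjoint)
      have degf: "real (degree_into (G c) T v) \<ge> d" if "c \<in> C" "f \<notin> badc c" "v \<in> T \<union> Q" for c v
        using that fU by (auto simp: badc_def low_degree_def T_def not_less)
      have degP: "f \<notin> badc p" if "p \<in> P" for p using f that by (auto simp: good_def bad2_def)
      define S where "S = {c \<in> C - P. f \<notin> badc c}"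
      have finS: "finite S" using C by (simp add: S_def)
      have "card C \<le> card (S \<union> P \<union> {c \<in> C. f \<in> badc c})" using C finP by (intro card_mono) (auto simp: S_def)
      also have "\<dots> \<le> card S + card P + card {c \<in> C. f \<in> badc c}"
        by (meson card_Un_le order_trans add_le_mono1)
      finally have "card C \<le> card S + t + card {c \<in> C. f \<in> badc c}" using P(2) by simp
      moreover have "real (card {c \<in> C. f \<in> badc c}) < real (card C) / 2"
        using f fU by (auto simp: good_def bad3_def)
      ultimately have cS: "real (card S) \<ge> real (card C) / 2 - real t" by linarith
      define s where "s = card S div B"
      have "B * s \<le> card S" by (simp add: s_def)
      then obtain S' where S': "S' \<subseteq> S" "s \<le> card S'"
        "\<And>c c' e. c \<in> S' \<Longrightarrow> c' \<in> S' \<Longrightarrow> e \<subseteq> T \<union> Q \<Longrightarrow> e \<in> G c \<Longrightarrow> e \<in> G c'"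
        using large_colour_class[OF TQ(1) finS, of s G] TQ(2) B_def by metis
      have finS': "finite S'" using S' finS finite_subset by blast
      \<comment> \<open>Of the guaranteed half of \<open>card C\<close>, one quarter pays for
        \<open>P\<close>, for the rounding in \<open>s\<close> and for the \<open>l\<close> values
        lost to injectivity.\<close>
      have sl: "real (s - l) \<ge> 1 / (4 * real B) * real (card C)"
      proof -
        have "card S < s * B + B" using dividend_less_div_times[OF B, of "card S"] by (simp add: s_def add.commute)
        then have "real (card S) < real (s * B + B)" by (simp only: of_nat_less_iff)
        then have s1: "real (card C) / 2 - real t < (real s + 1) * real B" using cS by (simp add: algebra_simps)
        have "n \<le> t * n" using t_pos by simp
        then have "real n \<le> real (card C)" using C(2) by (simp only: of_nat_le_iff)
        then have "(1 / (4 * real B)) * real n \<le> (1 / (4 * real B)) * real (card C)"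
          using B by (intro mult_left_mono) auto
        then have "real (t + 1 + l) \<le> (1 / (4 * real B)) * real (card C)" using n1[OF n'(2)] by linarith
        then have "real (t + 1 + l) * real B \<le> real (card C) / 4" using B by (simp add: field_simps)
        moreover have "real t \<le> real t * real B" using B by (simp add: mult_le_cancel_left1)
        ultimately have "real (card C) / 4 < (real s - real l) * real B" using s1 by (simp add: algebra_simps)
        then have "1 / (4 * real B) * real (card C) < real s - real l" using B by (simp add: field_simps)
        also have "\<dots> \<le> real (s - l)" by linarith
        finally show ?thesis by simp
      qed
      have "\<gamma> * real (card C) ^ l = (1 / (4 * real B) * real (card C)) ^ l"
        unfolding \<gamma>_def by (rule power_mult_distrib[symmetric])
      also have "\<dots> \<le> real (s - l) ^ l" using sl B by (intro power_mono) auto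
      also have "\<dots> \<le> real (card S' - l) ^ l" using S'(2) by (intro power_mono) auto
      also have "\<dots> \<le> real (card {g \<in> {..<l} \<rightarrow>\<^sub>E S'. inj_on g {..<l}})"
        using card_inj_PiE_ge[OF finS', of l] by (metis of_nat_le_iff of_nat_power)
      also have "\<dots> \<le> real (card {g \<in> U'. R f g})"
      proof -
        have "{g \<in> {..<l} \<rightarrow>\<^sub>E S'. inj_on g {..<l}} \<subseteq> {g \<in> U'. R f g}"
        proof
          fix g assume "g \<in> {g \<in> {..<l} \<rightarrow>\<^sub>E S'. inj_on g {..<l}}"
          then have g: "g \<in> {..<l} \<rightarrow>\<^sub>E S'" "inj_on g {..<l}" by auto
          define D where "D = g ` {..<l}"
          have D: "finite D" "card D = l" "D \<subseteq> S'" using g by (auto simp: D_def card_image)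
          have Dne: "D \<noteq> {}" using D(2) l by auto
          have DC: "D \<subseteq> C" "D \<inter> P = {}" "\<And>c. c \<in> D \<Longrightarrow> f \<notin> badc c" using D(3) S'(1) by (auto simp: S_def)
          have same: "\<forall>c\<in>D. \<forall>c'\<in>D. \<forall>e. e \<subseteq> T \<union> Q \<longrightarrow> e \<in> G c \<longrightarrow> e \<in> G c'" using S'(3) D(3) by blast
          have "rainbow_factor F G T (D \<union> {})"
          proof (rule k0[rule_format (no_asm), where P = "{}" and d = d])
            show "k0 + r * card ({}::'c set) \<le> card T" using k T by simp
            show "r dvd card T" using T by (simp add: k_def)
            show "(card D + card ({}::'c set)) * r = t * card T" using T D(2) by (simp add: k_def l_def)
            show "\<forall>c\<in>D. \<forall>c'\<in>D. \<forall>e. e \<subseteq> T \<longrightarrow> e \<in> G c \<longrightarrow> e \<in> G c'" using same by blast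
            show "\<forall>c\<in>D \<union> {}. \<forall>v\<in>T. d \<le> real (degree_into (G c) T v)" using degf DC by blast
            show "(\<delta> + \<epsilon> / 2) * real (card T) \<le> d - real (r * card ({}::'c set))" using d1 T by simp
          qed (use T D Dne G in auto)
          then have one: "rainbow_factor F G T D" by simp
          have two: "rainbow_factor F G (T \<union> Q) (D \<union> P)"
          proof (rule k0[rule_format (no_asm), where d = d])
            show "k0 + r * card P \<le> card (T \<union> Q)" using k TQ(2) P(2) by simp
            show "r dvd card (T \<union> Q)" using TQ(2) by (simp add: k_def)
            show "(card D + card P) * r = t * card (T \<union> Q)"
              using TQ(2) D(2) P(2) by (simp add: k_def l_def algebra_simps)
            show "\<forall>c\<in>D. \<forall>c'\<in>D. \<forall>e. e \<subseteq> T \<union> Q \<longrightarrow> e \<in> G c \<longrightarrow> e \<in> G c'" by (rule same)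
            show "\<forall>c\<in>D \<union> P. \<forall>v\<in>T \<union> Q. d \<le> real (degree_into (G c) (T \<union> Q) v)"
            proof (intro ballI)
              fix c v assume cv: "c \<in> D \<union> P" "v \<in> T \<union> Q"
              \<comment> \<open>\<open>low_degree\<close> also controls the vertices of
                \<open>Q\<close>, and extending the target from \<open>T\<close> to
                \<open>T \<union> Q\<close> can only add neighbours.\<close>
              have "d \<le> real (degree_into (G c) T v)" using cv degf DC degP P(1) by blast
              moreover have "degree_into (G c) T v \<le> degree_into (G c) (T \<union> Q) v"
                by (rule degree_into_mono[OF TQ(1)]) auto
              ultimately show "d \<le> real (degree_into (G c) (T \<union> Q) v)" by linarith
            qed
            show "(\<delta> + \<epsilon> / 2) * real (card (T \<union> Q)) \<le> d - real (r * card P)" using d2 TQ(2) P(2) by simp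
          qed (use TQ D Dne DC G finP in auto)
          have "R f g" unfolding R_def absorber_def T_def[symmetric] D_def[symmetric]
            using fU(2,3) g(2) DC(2) one two by blast
          moreover have "g \<in> U'" using g(1) S'(1) by (auto simp: U'_def S_def PiE_def Pi_def)
          ultimately show "g \<in> {g \<in> U'. R f g}" by simp
        qed
        then show ?thesis using finU(2) by (simp add: card_mono)
      qed
      finally show ?thesis .
    qed
    have eq: "{(f, g) \<in> U \<times> U'. R f g} = (SIGMA f:U. {g \<in> U'. R f g})" by auto
    have "(\<gamma> / 2) * real (card (U \<times> U')) = (N ^ k / 2) * (\<gamma> * real (card C) ^ l)"
      by (simp add: card_cartesian_product cU cU')
    also have "\<dots> \<le> real (card good) * (\<gamma> * real (card C) ^ l)"
      using cgood \<gamma> by (intro mult_right_mono) auto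
    also have "\<dots> = (\<Sum>f\<in>good. \<gamma> * real (card C) ^ l)" by simp
    also have "\<dots> \<le> (\<Sum>f\<in>good. real (card {g \<in> U'. R f g}))"
      by (rule sum_mono) (rule ext)
    also have "\<dots> \<le> (\<Sum>f\<in>U. real (card {g \<in> U'. R f g}))"
      using finU by (intro sum_mono2) (auto simp: good_def)
    also have "\<dots> = real (card {(f, g) \<in> U \<times> U'. R f g})"
      unfolding eq using finU by (subst card_SigmaI) auto
    finally show ?thesis by (simp add: U_def U'_def R_def)
  qed
  show ?thesis
    by (intro exI[of _ k'] exI[of _ "\<gamma> / 2"] exI[of _ n0] conjI allI impI k'pos)
      (use \<gamma> main[unfolded k_def l_def] in auto)
qed

end

section \<open>Conflict-free families by random choice and deletion\<close>

lemma card_PiE_conflict_le: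
  assumes \<Omega>: "finite \<Omega>" and I: "finite I" and ij: "i \<in> I" "j \<in> I" "i \<noteq> j"
    and conf: "\<And>x. x \<in> \<Omega> \<Longrightarrow> real (card {y \<in> \<Omega>. conf x y}) \<le> \<kappa> * real (card \<Omega>)"
  shows "real (card {f \<in> I \<rightarrow>\<^sub>E \<Omega>. conf (f i) (f j)}) \<le> \<kappa> * real (card (I \<rightarrow>\<^sub>E \<Omega>))"
proof -
  define B where "B = (\<lambda>x a. if a = i then {x} else if a = j then {y \<in> \<Omega>. conf x y} else \<Omega>)"
  have cB: "real (card (PiE I (B x))) * real (card \<Omega>) \<le> \<kappa> * real (card \<Omega>) ^ card I" if x: "x \<in> \<Omega>" for x
  proof -
    have "card (PiE I (B x)) = (\<Prod>a\<in>I. card (B x a))" using I by (rule card_PiE)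
    also have "\<dots> = card (B x i) * (card (B x j) * (\<Prod>a\<in>I - {i} - {j}. card (B x a)))"
      using I ij by (subst prod.remove[of I i]; simp; subst prod.remove[of "I - {i}" j]; simp)
    also have "(\<Prod>a\<in>I - {i} - {j}. card (B x a)) = (\<Prod>a\<in>I - {i} - {j}. card \<Omega>)"
      by (rule prod.cong) (auto simp: B_def)
    also have "\<dots> = card \<Omega> ^ (card I - 2)" using I ij by (simp add: numeral_2_eq_2)
    finally have "card (PiE I (B x)) = card {y \<in> \<Omega>. conf x y} * card \<Omega> ^ (card I - 2)"
      using ij by (simp add: B_def)
    then have "real (card (PiE I (B x))) \<le> (\<kappa> * real (card \<Omega>)) * real (card \<Omega>) ^ (card I - 2)"
      using conf[OF x] by (simp add: mult_right_mono)
    then have "real (card (PiE I (B x))) * real (card \<Omega>)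
        \<le> (\<kappa> * real (card \<Omega>)) * real (card \<Omega>) ^ (card I - 2) * real (card \<Omega>)"
      by (intro mult_right_mono) auto
    also have "\<dots> = \<kappa> * real (card \<Omega>) ^ (card I - 2 + 2)"
      by (simp add: power_add power2_eq_square)
    also have "card I - 2 + 2 = card I"
    proof -
      have "card {i, j} \<le> card I" using I ij by (intro card_mono) auto
      then show ?thesis using ij by simp
    qed
    finally show ?thesis .
  qed
  have "{f \<in> I \<rightarrow>\<^sub>E \<Omega>. conf (f i) (f j)} \<subseteq> (\<Union>x\<in>\<Omega>. PiE I (B x))"
  proof
    fix f assume f: "f \<in> {f \<in> I \<rightarrow>\<^sub>E \<Omega>. conf (f i) (f j)}"
    then have "f \<in> PiE I (B (f i))" using ij by (auto simp: PiE_def Pi_def B_def)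
    then show "f \<in> (\<Union>x\<in>\<Omega>. PiE I (B x))" using f ij by auto
  qed
  moreover have "finite (\<Union>x\<in>\<Omega>. PiE I (B x))"
    using \<Omega> I by (intro finite_UN_I finite_PiE) (auto simp: B_def)
  ultimately have "card {f \<in> I \<rightarrow>\<^sub>E \<Omega>. conf (f i) (f j)} \<le> card (\<Union>x\<in>\<Omega>. PiE I (B x))" by (intro card_mono)
  also have "\<dots> \<le> (\<Sum>x\<in>\<Omega>. card (PiE I (B x)))" by (rule card_UN_le[OF \<Omega>])
  finally have "real (card {f \<in> I \<rightarrow>\<^sub>E \<Omega>. conf (f i) (f j)}) \<le> (\<Sum>x\<in>\<Omega>. real (card (PiE I (B x))))"
    by (simp only: of_nat_le_iff flip: of_nat_sum)
  also have "\<dots> \<le> (\<Sum>x\<in>\<Omega>. \<kappa> * real (card \<Omega>) ^ card I / real (card \<Omega>))"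
  proof (rule sum_mono)
    fix x assume x: "x \<in> \<Omega>"
    then have "card \<Omega> > 0" using \<Omega> by (auto simp: card_gt_0_iff)
    then show "real (card (PiE I (B x))) \<le> \<kappa> * real (card \<Omega>) ^ card I / real (card \<Omega>)"
      using cB[OF x] by (simp add: le_divide_eq)
  qed
  also have "\<dots> = \<kappa> * real (card \<Omega>) ^ card I"
  proof (cases "card \<Omega> = 0")
    case True
    have "card I \<noteq> 0" using I ij by auto
    then show ?thesis using True by simp
  qed simp
  finally show ?thesis using I by (simp add: card_funcsetE)
qed

text \<open>Choose \<open>M\<close> points independently. By the Chernoff bound each
  \<open>A z\<close> is hit more than \<open>\<beta> / 2 * M\<close> times, and the third condition
  on \<open>M\<close> allows a union bound over \<open>Z\<close>. The expected number of conflicts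
  is at most \<open>M * M * \<kappa>\<close>; by Markov's inequality some such choice has fewer than
  twice as many. Deleting all indices in conflicts costs at most \<open>\<beta> / 4 * M\<close>
  hits, by the second condition.\<close>

lemma ex_conflict_free_family:
  fixes \<beta> \<kappa> :: real and A :: "'z \<Rightarrow> 'w set"
  assumes \<Omega>: "finite \<Omega>" "\<Omega> \<noteq> {}" and Z: "finite Z" and A: "\<And>z. z \<in> Z \<Longrightarrow> A z \<subseteq> \<Omega>"
    and dens: "\<And>z. z \<in> Z \<Longrightarrow> real (card (A z)) \<ge> \<beta> * real (card \<Omega>)" and \<beta>: "0 < \<beta>" "\<beta> \<le> 1"
    and conf: "\<And>x. x \<in> \<Omega> \<Longrightarrow> real (card {y \<in> \<Omega>. conf x y}) \<le> \<kappa> * real (card \<Omega>)" and \<kappa>: "\<kappa> > 0"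
    and M: "M > 0" "8 * real M * \<kappa> \<le> \<beta>" "real (card Z) * exp (- (\<beta>\<^sup>2 / 16) * real M) < 1 / 2"
  shows "\<exists>J f. J \<subseteq> {..<M} \<and> (\<forall>i\<in>J. f i \<in> \<Omega>) \<and> (\<forall>i\<in>J. \<forall>j\<in>J. i \<noteq> j \<longrightarrow> \<not> conf (f i) (f j)) \<and>
     (\<forall>z\<in>Z. real (card {i \<in> J. f i \<in> A z}) \<ge> \<beta> / 4 * real M)"
proof -
  define U where "U = {..<M} \<rightarrow>\<^sub>E \<Omega>"
  have finU: "finite U" using \<Omega> by (auto simp: U_def intro: finite_PiE)
  have cUpos: "real (card U) > 0" using \<Omega> by (simp add: U_def card_funcsetE card_gt_0_iff)
  define few where "few = (\<lambda>z. {f \<in> U. real (card {i \<in> {..<M}. f i \<in> A z}) \<le> (\<beta> - \<beta> / 2) * real (card {..<M})})"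
  have few: "real (card (few z)) \<le> exp (- (\<beta>\<^sup>2 / 16) * real M) * real (card U)" if z: "z \<in> Z" for z
  proof -
    have "real (card (few z)) \<le> exp (- ((\<beta> / 2)\<^sup>2 / 4) * real (card {..<M})) * real (\<Prod>i\<in>{..<M}. card \<Omega>)"
      unfolding few_def U_def
      by (rule card_PiE_few_hits) (use \<Omega> A[OF z] dens[OF z] \<beta> in auto)
    moreover have "(\<beta> / 2)\<^sup>2 / 4 = \<beta>\<^sup>2 / 16" by (simp add: power2_eq_square)
    ultimately show ?thesis by (simp add: U_def card_funcsetE)
  qed
  define pairs where "pairs = {(i, j). i < M \<and> j < M \<and> i \<noteq> j}"
  have pairs: "pairs \<subseteq> {..<M} \<times> {..<M}" by (auto simp: pairs_def)
  have finp: "finite pairs" using pairs by (rule finite_subset) auto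
  have cp: "card pairs \<le> M * M" using card_mono[OF _ pairs] by simp
  define X where "X = (\<lambda>f. card {p \<in> pairs. conf (f (fst p)) (f (snd p))})"
  define many where "many = {f \<in> U. real (X f) \<ge> 2 * (real M * real M * \<kappa>)}"
  have many: "real (card many) \<le> real (card U) / 2"
  proof -
    have "real (card many) * (2 * (real M * real M * \<kappa>)) \<le> (\<Sum>f\<in>U. real (X f))"
      unfolding many_def by (rule card_markov[OF finU]) simp
    also have "\<dots> = real (\<Sum>f\<in>U. X f)" by simp
    also have "(\<Sum>f\<in>U. X f) = (\<Sum>p\<in>pairs. card {f \<in> U. conf (f (fst p)) (f (snd p))})"
      unfolding X_def by (rule sum_card_swap[OF finU finp])
    also have "real \<dots> \<le> (\<Sum>p\<in>pairs. \<kappa> * real (card U))"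
      unfolding of_nat_sum U_def
      by (rule sum_mono, rule card_PiE_conflict_le[OF \<Omega>(1)]) (use conf in \<open>auto simp: pairs_def\<close>)
    also have "\<dots> = real (card pairs) * (\<kappa> * real (card U))" by simp
    also have "\<dots> \<le> real (M * M) * (\<kappa> * real (card U))"
      using cp \<kappa> by (intro mult_right_mono) (auto simp del: of_nat_mult)
    also have "\<dots> = (real (card U) / 2) * (2 * (real M * real M * \<kappa>))" by simp
    finally have "real (card many) * (2 * (real M * real M * \<kappa>)) \<le> (real (card U) / 2) * (2 * (real M * real M * \<kappa>))" .
    moreover have "2 * (real M * real M * \<kappa>) > 0" using M \<kappa> by simp
    ultimately show ?thesis by (metis mult_le_cancel_right_pos)
  qed
  have "real (card ((\<Union>z\<in>Z. few z) \<union> many)) < real (card U)"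
  proof -
    have "real (card (\<Union>z\<in>Z. few z)) \<le> (\<Sum>z\<in>Z. real (card (few z)))"
      using card_UN_le[OF Z, of few] by (metis of_nat_le_iff of_nat_sum)
    also have "\<dots> \<le> (\<Sum>z\<in>Z. exp (- (\<beta>\<^sup>2 / 16) * real M) * real (card U))" by (intro sum_mono few)
    also have "\<dots> = (real (card Z) * exp (- (\<beta>\<^sup>2 / 16) * real M)) * real (card U)" by simp
    also have "\<dots> < 1 / 2 * real (card U)" using M(3) cUpos by (rule mult_strict_right_mono)
    finally have "real (card (\<Union>z\<in>Z. few z)) < 1 / 2 * real (card U)" .
    moreover have "card ((\<Union>z\<in>Z. few z) \<union> many) \<le> card (\<Union>z\<in>Z. few z) + card many" by (rule card_Un_le)
    ultimately show ?thesis using many by linarith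
  qed
  then have "\<not> U \<subseteq> (\<Union>z\<in>Z. few z) \<union> many"
    using card_mono[of "(\<Union>z\<in>Z. few z) \<union> many" U] finU Z
    by (auto simp: few_def many_def)
  then obtain f where f: "f \<in> U" "\<And>z. z \<in> Z \<Longrightarrow> f \<notin> few z" "f \<notin> many" by blast
  \<comment> \<open>\<open>pairs\<close> is ordered, so each deleted index is the first component of
    a conflicting pair, and \<open>X f\<close> bounds the number of deletions.\<close>
  define J where "J = {i \<in> {..<M}. \<forall>j<M. j \<noteq> i \<longrightarrow> \<not> conf (f i) (f j)}"
  have "{..<M} - J \<subseteq> fst ` {p \<in> pairs. conf (f (fst p)) (f (snd p))}"
  proof
    fix i assume "i \<in> {..<M} - J"
    then obtain j where "i < M" "j < M" "j \<noteq> i" "conf (f i) (f j)" by (auto simp: J_def)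
    then show "i \<in> fst ` {p \<in> pairs. conf (f (fst p)) (f (snd p))}"
      by (intro image_eqI[of _ _ "(i, j)"]) (auto simp: pairs_def)
  qed
  then have "card ({..<M} - J) \<le> X f" unfolding X_def using finp by (intro surj_card_le) auto
  moreover have "real (X f) < 2 * (real M * real M * \<kappa>)" using f(1,3) by (simp add: many_def)
  moreover have "2 * (real M * real M * \<kappa>) \<le> \<beta> / 4 * real M"
  proof -
    have "(8 * real M * \<kappa>) * (real M / 4) \<le> \<beta> * (real M / 4)" using M(2) by (intro mult_right_mono) auto
    then show ?thesis by (simp add: mult_ac)
  qed
  ultimately have cJ: "real (card ({..<M} - J)) \<le> \<beta> / 4 * real M" by linarith
  have "real (card {i \<in> J. f i \<in> A z}) \<ge> \<beta> / 4 * real M" if z: "z \<in> Z" for z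
  proof -
    have "card {i \<in> {..<M}. f i \<in> A z} \<le> card ({i \<in> J. f i \<in> A z} \<union> ({..<M} - J))"
      by (rule card_mono) (auto simp: J_def)
    also have "\<dots> \<le> card {i \<in> J. f i \<in> A z} + card ({..<M} - J)" by (rule card_Un_le)
    finally have "real (card {i \<in> {..<M}. f i \<in> A z}) \<le> real (card {i \<in> J. f i \<in> A z}) + \<beta> / 4 * real M"
      using cJ by linarith
    moreover have "real (card {i \<in> {..<M}. f i \<in> A z}) > \<beta> / 2 * real M"
      using f(1) f(2)[OF z] by (simp add: few_def)
    ultimately show ?thesis by simp
  qed
  moreover have "\<forall>i\<in>J. f i \<in> \<Omega>" using f(1) by (auto simp: J_def U_def)
  moreover have "\<forall>i\<in>J. \<forall>j\<in>J. i \<noteq> j \<longrightarrow> \<not> conf (f i) (f j)" by (auto simp: J_def)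
  moreover have "J \<subseteq> {..<M}" by (auto simp: J_def)
  ultimately show ?thesis by blast
qed

section \<open>Almost covering\<close>

context factor_thresholds
begin

text \<open>A block is bad if a share \<open>\<eta> / 4\<close> of the colours has low degree on it;
  averaging and Markov's inequality make bad blocks rare. Good blocks are coloured greedily. While a
  share \<open>\<eta> / 2\<close> of the colours is still available, at least half of that is
  suitable for the next block, and a class of \<open>l\<close> colours among them finishes it.
  Leaving out some good blocks keeps this supply up to the end.\<close>

lemma almost_cover:
  fixes \<epsilon> \<eta> :: real
  assumes \<epsilon>: "\<epsilon> > 0" and \<eta>: "\<eta> > 0" "\<eta> \<le> 1"
  shows "\<exists>n\<^sub>0. \<forall>n (V::nat set) (C::'c set) G. n\<^sub>0 \<le> n \<longrightarrow> finite V \<longrightarrow> card V = r * n \<longrightarrow> finite C \<longrightarrow> card C = t * n \<longrightarrow>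
      (\<forall>c. simple_edges (G c)) \<longrightarrow>
      (\<forall>c\<in>C. min_degree_ge (G c) V (\<delta> + \<epsilon>)) \<longrightarrow>
      (\<exists>W D m. W \<subseteq> V \<and> D \<subseteq> C \<and> card W = r * m \<and> card D = t * m \<and> real m \<le> \<eta> * real n \<and>
         rainbow_factor F G (V - W) (C - D))"
proof -
  have \<epsilon>2: "\<epsilon> / 2 > 0" using \<epsilon> by simp
  obtain k0 where k0: "\<forall>P (X::nat set) D (G::'c \<Rightarrow> nat set set) d. finite P \<longrightarrow> finite X \<longrightarrow> finite D \<longrightarrow> D \<noteq> {} \<longrightarrow>
      D \<inter> P = {} \<longrightarrow> k0 + r * card P \<le> card X \<longrightarrow> r dvd card X \<longrightarrow>
      (card D + card P) * r = t * card X \<longrightarrow>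
      (\<forall>c. simple_edges (G c)) \<longrightarrow>
      (\<forall>c\<in>D. \<forall>c'\<in>D. \<forall>e. e \<subseteq> X \<longrightarrow> e \<in> G c \<longrightarrow> e \<in> G c') \<longrightarrow>
      (\<forall>c\<in>D \<union> P. \<forall>v\<in>X. real (degree_into (G c) X v) \<ge> d) \<longrightarrow>
      d - real (r * card P) \<ge> (\<delta> + \<epsilon> / 2) * real (card X) \<longrightarrow>
      rainbow_factor F G X (D \<union> P)"
    using rainbow_factor_class[OF \<epsilon>2, where 'c = 'c] by (elim exE)
  define \<tau> where "\<tau> = \<epsilon> / 4"
  have \<tau>: "\<tau> > 0" using \<epsilon> by (simp add: \<tau>_def)
  \<comment> \<open>\<open>2 * \<eta>1\<close> is \<open>(\<eta> / 4)\<^sup>2\<close>: one factor is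
    the share of colours that makes a block bad, the other the resulting share of bad
    blocks.\<close>
  define \<eta>1 where "\<eta>1 = \<eta>\<^sup>2 / 32"
  have \<eta>1: "\<eta>1 > 0" using \<eta> by (simp add: \<eta>1_def)
  obtain k1 where k1: "\<And>k. k \<ge> k1 \<Longrightarrow> (real k + 0) * exp (- (\<tau>\<^sup>2 / 4) * real k) \<le> \<eta>1"
    using ex_exp_decay[of "\<tau>\<^sup>2 / 4" \<eta>1 0] \<tau> \<eta>1 by auto
  obtain k2 where k2: "\<And>k. k \<ge> k2 \<Longrightarrow> \<tau> * real k \<ge> 1" using ex_nat_mult_ge[OF \<tau>] by blast
  define k' where "k' = Suc (k0 + k1 + k2)"
  define k where "k = r * k'"
  define l where "l = t * k'"
  have k'pos: "k' > 0" by (simp add: k'_def)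
  have "1 * k' \<le> k" unfolding k_def using r_pos by (intro mult_le_mono1) simp
  then have k: "k0 \<le> k" "k1 \<le> k" "k2 \<le> k" "k > 0" by (auto simp: k'_def)
  have l: "l > 0" using t_pos k'pos by (simp add: l_def)
  define B where "B = (2::nat) ^ (2 ^ k)"
  obtain n1 where n1: "\<And>n. n \<ge> n1 \<Longrightarrow> (\<eta> / 4) * real n \<ge> real k'"
    using ex_nat_mult_ge[of "\<eta> / 4" "real k'"] \<eta> by auto
  have "real t * \<eta> / 4 > 0" using t_pos \<eta> by simp
  then obtain n2 where n2: "\<And>n. n \<ge> n2 \<Longrightarrow> (real t * \<eta> / 4) * real n \<ge> real (B * l)"
    using ex_nat_mult_ge by blast
  define n0 where "n0 = Suc (n1 + n2 + 2 * k * k)"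
  have main: "\<exists>W D m. W \<subseteq> V \<and> D \<subseteq> C \<and> card W = r * m \<and> card D = t * m \<and> real m \<le> \<eta> * real n \<and>
         rainbow_factor F G (V - W) (C - D)"
    if n: "n0 \<le> n" and V: "finite V" "card V = r * n" and C: "finite C" "card C = t * n"
      and G: "\<forall>c. simple_edges (G c)"
      and deg: "\<forall>c\<in>C. min_degree_ge (G c) V (\<delta> + \<epsilon>)"
    for n and V :: "nat set" and C :: "'c set" and G
  proof -
    have n': "n > 0" "n1 \<le> n" "n2 \<le> n" "2 * k * k \<le> n" using n by (auto simp: n0_def)
    have Vne: "V \<noteq> {}" using V n'(1) r_pos by auto
    have Cne: "C \<noteq> {}" using C n'(1) t_pos by auto
    have \<beta>1: "\<delta> + \<epsilon> \<le> 1"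
    proof -
      obtain v c where vc: "v \<in> V" "c \<in> C" using Vne Cne by blast
      have "(\<delta> + \<epsilon>) * real (card V) \<le> 1 * real (card V)"
        using deg vc degree_into_le[OF V(1), of "G c" v] by fastforce
      moreover have "real (card V) > 0" using V(1) Vne by (simp add: card_gt_0_iff)
      ultimately show ?thesis by (metis mult_le_cancel_right_pos)
    qed
    define bad where "bad = (\<lambda>c. low_degree (G c) {} ((\<delta> + \<epsilon> - 2 * \<tau>) * real k) k)"
    define m where "m = n div k'"
    have mk: "m * k \<le> card V"
    proof -
      have "r * (m * k') \<le> r * n" unfolding m_def by (intro mult_le_mono2) (rule div_times_less_eq_dividend)
      then show ?thesis by (simp add: k_def V mult_ac)
    qed
    have "real (card {f \<in> {..<k} \<rightarrow>\<^sub>E V. inj_on f {..<k} \<and> bad c f}) \<le> \<eta>1 * real (card V) ^ k" if "c \<in> C" for c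
    proof -
      have "real (card {f \<in> {..<k} \<rightarrow>\<^sub>E V. inj_on f {..<k} \<and> bad c f})
         \<le> (real k + real (card ({}::nat set))) * exp (- (\<tau>\<^sup>2 / 4) * real k) * real (card V) ^ k"
        unfolding bad_def
        by (rule card_low_degree_le[OF V(1)]) (use deg that \<delta>_nonneg \<epsilon> \<beta>1 \<tau> k2[OF k(3)] in auto)
      also have "\<dots> \<le> \<eta>1 * real (card V) ^ k"
        using k1[OF k(2)] by (intro mult_right_mono) auto
      finally show ?thesis .
    qed
    moreover have "2 * k * k \<le> card V"
    proof -
      have "n \<le> r * n" using r_pos by simp
      then show ?thesis using n'(4) V(2) by linarith
    qed
    ultimately obtain xs where xs: "xs \<in> permutations_of_set V"
        "(\<Sum>i<m. real (card {c \<in> C. bad c (block k i xs)})) \<le> 2 * \<eta>1 * real m * real (card C)"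
      using ex_permutation_few_bad_blocks[OF V(1) mk _ C(1), of bad \<eta>1] \<eta>1 by auto
    define T where "T = (\<lambda>i. block k i xs ` {..<k})"
    have T: "finite (T i)" "card (T i) = k" "T i \<subseteq> V" if "i < m" for i
      using block_in_PiE[OF xs(1) that mk] by (auto simp: T_def card_image)
    have Tdisj: "T i \<inter> T i' = {}" if "i < m" "i' < m" "i \<noteq> i'" for i i'
      unfolding T_def by (rule block_disjoint[OF xs(1) that mk])
    define nbad where "nbad = (\<lambda>i. real (card {c \<in> C. bad c (block k i xs)}))"
    define badblocks where "badblocks = {i \<in> {..<m}. nbad i \<ge> \<eta> / 4 * real (card C)}"
    have cC: "real (card C) > 0" using C(1) Cne by (simp add: card_gt_0_iff)
    have "real (card badblocks) * (\<eta> / 4 * real (card C)) \<le> sum nbad {..<m}"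
      unfolding badblocks_def by (rule card_markov) (auto simp: nbad_def)
    also have "\<dots> \<le> 2 * \<eta>1 * real m * real (card C)" using xs(2) by (simp add: nbad_def)
    also have "\<dots> = (\<eta> / 4 * real m) * (\<eta> / 4 * real (card C))"
      by (simp add: \<eta>1_def power2_eq_square)
    finally have "real (card badblocks) * (\<eta> / 4 * real (card C)) \<le> (\<eta> / 4 * real m) * (\<eta> / 4 * real (card C))" .
    moreover have "\<eta> / 4 * real (card C) > 0" using \<eta> cC by simp
    ultimately have cbad: "real (card badblocks) \<le> \<eta> / 4 * real m" by (metis mult_le_cancel_right_pos)
    define good where "good = {..<m} - badblocks"
    have cgood: "real (card good) \<ge> (1 - \<eta> / 4) * real m"
    proof -
      have sub: "badblocks \<subseteq> {..<m}" by (auto simp: badblocks_def)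
      then have "finite badblocks" by (rule finite_subset) simp
      then have "card good = m - card badblocks" "card badblocks \<le> m"
        using card_Diff_subset[OF _ sub] card_mono[OF _ sub] by (simp_all add: good_def)
      then show ?thesis using cbad by (simp add: of_nat_diff algebra_simps)
    qed
    \<comment> \<open>These blocks use at most a share \<open>1 - \<eta> / 2\<close> of the colours.
      There are enough good blocks, since \<open>(1 - \<eta> / 4) * (n - k')\<close> is at least
      \<open>(1 - \<eta> / 2) * n\<close> for large \<open>n\<close>.\<close>
    define b where "b = nat \<lfloor>(1 - \<eta> / 2) * real n / real k'\<rfloor>"
    have bnn: "(1 - \<eta> / 2) * real n / real k' \<ge> 0" using \<eta> by simp
    have b: "real b \<le> (1 - \<eta> / 2) * real n / real k'" "(1 - \<eta> / 2) * real n / real k' < real b + 1"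
      using bnn unfolding b_def by linarith+
    have bk: "real b * real k' \<le> (1 - \<eta> / 2) * real n" using b(1) k'pos by (simp add: le_divide_eq)
    have bk2: "(1 - \<eta> / 2) * real n \<le> real b * real k' + real k'"
      using b(2) k'pos by (simp add: divide_less_eq algebra_simps)
    have "real b \<le> real (card good)"
    proof -
      have mm: "real n - real k' \<le> real m * real k'"
      proof -
        have "n < m * k' + k'" using dividend_less_div_times[OF k'pos, of n] by (simp add: m_def add.commute)
        then have "real n < real (m * k' + k')" by (simp only: of_nat_less_iff)
        then show ?thesis by simp
      qed
      have "real b * real k' \<le> (1 - \<eta> / 2) * real n" by (rule bk)
      also have "\<dots> \<le> (1 - \<eta> / 4) * (real n - real k')"
      proof -
        have e1: "(1 - \<eta> / 4) * (real n - real k') = real n - real k' - \<eta> / 4 * real n + \<eta> * real k' / 4"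
          by (simp add: field_simps)
        have e2: "(1 - \<eta> / 2) * real n = real n - 2 * (\<eta> / 4 * real n)" by (simp add: field_simps)
        have "\<eta> * real k' \<ge> 0" using \<eta> by simp
        then show ?thesis unfolding e1 e2 using n1[OF n'(2)] by linarith
      qed
      also have "\<dots> \<le> (1 - \<eta> / 4) * (real m * real k')" using mm \<eta> by (intro mult_left_mono) auto
      also have "\<dots> \<le> real (card good) * real k'" using cgood by (simp add: mult_right_mono flip: mult.assoc)
      finally show ?thesis using k'pos by simp
    qed
    then obtain Bs where Bs: "Bs \<subseteq> good" "card Bs = b" "finite Bs"
      using obtain_subset_with_card_n[of b good] by auto
    have Bsm: "i < m" if "i \<in> Bs" for i using that Bs(1) by (auto simp: good_def)
    have greedy: "\<exists>D\<subseteq>C. card D = l * card B' \<and> rainbow_factor F G (\<Union>i\<in>B'. T i) D"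
      if "finite B'" "B' \<subseteq> Bs" for B'
      using that
    proof (induction B' rule: finite_induct)
      case empty
      show ?case by (intro exI[of _ "{}"]) (auto simp: rainbow_factor_empty)
    next
      case (insert i B')
      then obtain D where D: "D \<subseteq> C" "card D = l * card B'" "rainbow_factor F G (\<Union>i\<in>B'. T i) D" by blast
      have finD: "finite D" using D C finite_subset by blast
      have im: "i < m" using insert.prems Bsm by blast
      define S where "S = {c \<in> C - D. \<not> bad c (block k i xs)}"
      have finS: "finite S" using C by (simp add: S_def)
      have "nbad i < \<eta> / 4 * real (card C)"
        using insert.prems Bs(1) im by (auto simp: good_def badblocks_def)
      moreover have "card (C - D) \<le> card S + card {c \<in> C. bad c (block k i xs)}"
        by (rule order_trans[OF card_mono card_Un_le]) (use C in \<open>auto simp: S_def\<close>)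
      moreover have "card (C - D) = card C - l * card B'" using D(2) card_Diff_subset[OF finD D(1)] by simp
      moreover have "real (l * card B') \<le> (1 - \<eta> / 2) * real (card C)"
      proof -
        have "card B' \<le> b" using insert.prems Bs card_mono by (metis insert_subset)
        then have "real (card B') * real k' \<le> real b * real k'" by (intro mult_right_mono) auto
        then have "real t * (real (card B') * real k') \<le> real t * ((1 - \<eta> / 2) * real n)"
          using bk by (intro mult_left_mono) auto
        then show ?thesis by (simp add: l_def C(2) algebra_simps)
      qed
      moreover have "(1 - \<eta> / 2) * real (card C) = real (card C) - 2 * (\<eta> / 4 * real (card C))"
        by (simp add: field_simps)
      ultimately have "real (card S) \<ge> \<eta> / 4 * real (card C)"
        unfolding nbad_def by linarith
      also have "\<eta> / 4 * real (card C) = (real t * \<eta> / 4) * real n" by (simp add: C(2))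
      finally have "real (B * l) \<le> real (card S)" using n2[OF n'(3)] by linarith
      then have "2 ^ (2 ^ card (T i)) * l \<le> card S" using T(2)[OF im] by (simp only: B_def of_nat_le_iff)
      then obtain S' where S': "S' \<subseteq> S" "l \<le> card S'"
        "\<And>c c' e. c \<in> S' \<Longrightarrow> c' \<in> S' \<Longrightarrow> e \<subseteq> T i \<Longrightarrow> e \<in> G c \<Longrightarrow> e \<in> G c'"
        using large_colour_class[OF T(1)[OF im] finS, of l G] by metis
      obtain D' where D': "D' \<subseteq> S'" "card D' = l" "finite D'"
        using obtain_subset_with_card_n[OF S'(2)] by blast
      have "rainbow_factor F G (T i) (D' \<union> {})"
      proof (rule k0[rule_format (no_asm), where P = "{}" and d = "(\<delta> + \<epsilon> / 2) * real k"])
        show "D' \<noteq> {}" using D' l by auto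
        show "k0 + r * card ({}::'c set) \<le> card (T i)" using k T(2)[OF im] by simp
        show "r dvd card (T i)" using T(2)[OF im] by (simp add: k_def)
        show "(card D' + card ({}::'c set)) * r = t * card (T i)" using T(2)[OF im] D'(2) by (simp add: k_def l_def)
        show "\<forall>c\<in>D'. \<forall>c'\<in>D'. \<forall>e. e \<subseteq> T i \<longrightarrow> e \<in> G c \<longrightarrow> e \<in> G c'" using S'(3) D'(1) by blast
        show "\<forall>c\<in>D' \<union> {}. \<forall>v\<in>T i. (\<delta> + \<epsilon> / 2) * real k \<le> real (degree_into (G c) (T i) v)"
        proof (intro ballI)
          fix c v assume "c \<in> D' \<union> {}" "v \<in> T i"
          then have "\<not> bad c (block k i xs)" using D'(1) S'(1) by (auto simp: S_def)
          then have "\<not> real (degree_into (G c) (T i) v) < (\<delta> + \<epsilon> - 2 * \<tau>) * real k"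
            using \<open>v \<in> T i\<close> unfolding bad_def low_degree_def T_def by blast
          then show "(\<delta> + \<epsilon> / 2) * real k \<le> real (degree_into (G c) (T i) v)"
            unfolding \<tau>_def by (simp add: not_less algebra_simps)
        qed
      qed (use T(1,2)[OF im] D' G in auto)
      then have "rainbow_factor F G (T i) D'" by simp
      moreover have "T i \<inter> T i' = {}" if "i' \<in> B'" for i'
        using Tdisj[OF im] Bsm insert.prems insert.hyps(2) that by blast
      then have "T i \<inter> (\<Union>i\<in>B'. T i) = {}" by blast
      moreover have "D' \<inter> D = {}" using D'(1) S'(1) by (auto simp: S_def)
      ultimately have "rainbow_factor F G (T i \<union> (\<Union>i\<in>B'. T i)) (D' \<union> D)"
        using D(3) by (intro rainbow_factor_Un)
      moreover have "card (D' \<union> D) = l * card (insert i B')"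
        using \<open>D' \<inter> D = {}\<close> D' D(2) finD insert.hyps by (simp add: card_Un_disjoint)
      moreover have "D' \<union> D \<subseteq> C" using D'(1) S'(1) D(1) by (auto simp: S_def)
      ultimately show ?case by (intro exI[of _ "D' \<union> D"]) simp
    qed
    obtain D where D: "D \<subseteq> C" "card D = l * b" "rainbow_factor F G (\<Union>i\<in>Bs. T i) D"
      using greedy[OF Bs(3) subset_refl] Bs(2) by blast
    define Y where "Y = (\<Union>i\<in>Bs. T i)"
    have YV: "Y \<subseteq> V" using T(3) Bsm by (auto simp: Y_def)
    have "card Y = (\<Sum>i\<in>Bs. card (T i))"
      unfolding Y_def using Bs(3) T(1) Bsm Tdisj by (intro card_UN_disjoint) auto
    then have cY: "card Y = k * b" using T(2) Bsm Bs(2) by simp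
    have finY: "finite Y" using YV V finite_subset by blast
    have finD: "finite D" using D C finite_subset by blast
    define p where "p = n - k' * b"
    have kbn: "real (k' * b) \<le> real n"
    proof -
      have "(1 - \<eta> / 2) * real n \<le> 1 * real n" using \<eta> by (intro mult_right_mono) auto
      then show ?thesis using bk by (simp add: mult.commute)
    qed
    then have kbn': "k' * b \<le> n" by (simp only: of_nat_le_iff)
    show ?thesis
    proof (intro exI[of _ "V - Y"] exI[of _ "C - D"] exI[of _ p] conjI)
      show "card (V - Y) = r * p"
        using card_Diff_subset[OF finY YV] cY V(2) by (simp add: p_def k_def diff_mult_distrib2 mult.assoc)
      show "card (C - D) = t * p"
        using card_Diff_subset[OF finD D(1)] D(2) C(2) by (simp add: p_def l_def diff_mult_distrib2 mult.assoc)
      have "real p = real n - real k' * real b" using kbn' by (simp add: p_def of_nat_diff)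
      then have "real p \<le> \<eta> / 2 * real n + real k'" using bk2 by (simp add: algebra_simps)
      also have "\<dots> \<le> \<eta> * real n" using n1[OF n'(2)] \<eta> by (simp add: algebra_simps)
      finally show "real p \<le> \<eta> * real n" .
      have "V - (V - Y) = Y" "C - (C - D) = D" using YV D(1) by auto
      then show "rainbow_factor F G (V - (V - Y)) (C - (C - D))" using D(3) by (simp add: Y_def)
    qed auto
  qed
  show ?thesis by (intro exI[of _ n0] allI impI) (rule main; assumption)
qed

end

section \<open>The main argument\<close>

lemma rainbow_factor_UN:
  assumes "finite J" "\<And>i. i \<in> J \<Longrightarrow> rainbow_factor F G (T i) (D i)"
    and "\<And>i j. i \<in> J \<Longrightarrow> j \<in> J \<Longrightarrow> i \<noteq> j \<Longrightarrow> T i \<inter> T j = {} \<and> D i \<inter> D j = {}"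
  shows "rainbow_factor F G (\<Union>i\<in>J. T i) (\<Union>i\<in>J. D i)"
  using assms
proof (induction J rule: finite_induct)
  case empty
  then show ?case by (simp add: rainbow_factor_empty)
next
  case (insert i J)
  have "rainbow_factor F G (T i \<union> (\<Union>i\<in>J. T i)) (D i \<union> (\<Union>i\<in>J. D i))"
  proof (rule rainbow_factor_Un)
    show "rainbow_factor F G (T i) (D i)" using insert.prems by simp
    show "rainbow_factor F G (\<Union>i\<in>J. T i) (\<Union>i\<in>J. D i)" using insert by simp
    have "T i \<inter> T j = {} \<and> D i \<inter> D j = {}" if "j \<in> J" for j
      using insert.prems(2)[of i j] insert.hyps that by auto
    then show "T i \<inter> (\<Union>i\<in>J. T i) = {}" "D i \<inter> (\<Union>i\<in>J. D i) = {}" by blast+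
  qed
  then show ?case by simp
qed

text \<open>Cut any \<open>Q\<close> and \<open>P\<close> off the leftover and give them to a
  suitable absorber. Every other pair loses at most this one absorber, so the hypothesis survives
  with \<open>m - 1\<close>. Absorbers that are never called on keep their own factor.\<close>

lemma rainbow_factor_absorb:
  assumes "finite J" "\<And>i. i \<in> J \<Longrightarrow> rainbow_factor F G (T i) (D i)"
    and "\<And>i j. i \<in> J \<Longrightarrow> j \<in> J \<Longrightarrow> i \<noteq> j \<Longrightarrow> T i \<inter> T j = {} \<and> D i \<inter> D j = {}"
    and "finite W" "card W = r * m" "finite E" "card E = t * m"
    and "\<And>i. i \<in> J \<Longrightarrow> T i \<inter> W = {} \<and> D i \<inter> E = {}"
    and "\<And>Q P. Q \<subseteq> W \<Longrightarrow> card Q = r \<Longrightarrow> P \<subseteq> E \<Longrightarrow> card P = t \<Longrightarrow>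
        m \<le> card {i \<in> J. absorber F G Q P (T i) (D i)}"
  shows "rainbow_factor F G ((\<Union>i\<in>J. T i) \<union> W) ((\<Union>i\<in>J. D i) \<union> E)"
  using assms
proof (induction m arbitrary: J W E)
  case 0
  then have "W = {}" "E = {}" by auto
  then show ?case using rainbow_factor_UN[OF 0(1-3)] by simp
next
  case (Suc m)
  note pr = Suc.prems
  obtain Q where Q: "Q \<subseteq> W" "card Q = r" "finite Q"
    using obtain_subset_with_card_n[of r W] pr(5) by auto
  obtain P where P: "P \<subseteq> E" "card P = t" "finite P"
    using obtain_subset_with_card_n[of t E] pr(7) by auto
  have "0 < card {i \<in> J. absorber F G Q P (T i) (D i)}" using pr(9)[OF Q(1,2) P(1,2)] by simp
  then obtain i where i: "i \<in> J" "absorber F G Q P (T i) (D i)" by (auto simp: card_gt_0_iff)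
  have one: "rainbow_factor F G (T i \<union> Q) (D i \<union> P)" using i(2) by (simp add: absorber_def)
  have two: "rainbow_factor F G ((\<Union>i\<in>J - {i}. T i) \<union> (W - Q)) ((\<Union>i\<in>J - {i}. D i) \<union> (E - P))"
  proof (rule Suc.IH)
    show "card (W - Q) = r * m" "card (E - P) = t * m"
      using card_Diff_subset[OF Q(3,1)] card_Diff_subset[OF P(3,1)] pr(5,7) Q(2) P(2) by simp_all
    fix Q' P' assume a: "Q' \<subseteq> W - Q" "card Q' = r" "P' \<subseteq> E - P" "card P' = t"
    have "Suc m \<le> card {i \<in> J. absorber F G Q' P' (T i) (D i)}" using a by (intro pr(9)) auto
    also have "\<dots> \<le> card (insert i {j \<in> J - {i}. absorber F G Q' P' (T j) (D j)})"
      using pr(1) by (intro card_mono) auto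
    also have "\<dots> = Suc (card {j \<in> J - {i}. absorber F G Q' P' (T j) (D j)})"
      using pr(1) by (subst card_insert_disjoint) auto
    finally show "m \<le> card {j \<in> J - {i}. absorber F G Q' P' (T j) (D j)}" by simp
  next
    fix j assume "j \<in> J - {i}"
    then show "T j \<inter> (W - Q) = {} \<and> D j \<inter> (E - P) = {}" using pr(8)[of j] by blast
  qed (use pr in auto)
  have "rainbow_factor F G ((T i \<union> Q) \<union> ((\<Union>i\<in>J - {i}. T i) \<union> (W - Q))) ((D i \<union> P) \<union> ((\<Union>i\<in>J - {i}. D i) \<union> (E - P)))"
  proof (rule rainbow_factor_Un[OF one two])
    have disj: "T i \<inter> T j = {} \<and> D i \<inter> D j = {}" if "j \<in> J - {i}" for j using pr(3)[of i j] i(1) that by auto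
    have W: "T j \<inter> W = {} \<and> D j \<inter> E = {}" if "j \<in> J" for j using pr(8)[OF that] .
    show "(T i \<union> Q) \<inter> ((\<Union>i\<in>J - {i}. T i) \<union> (W - Q)) = {}"
      using disj W[OF i(1)] W Q(1) by blast
    show "(D i \<union> P) \<inter> ((\<Union>i\<in>J - {i}. D i) \<union> (E - P)) = {}"
      using disj W[OF i(1)] W P(1) by blast
  qed
  moreover have "(T i \<union> Q) \<union> ((\<Union>i\<in>J - {i}. T i) \<union> (W - Q)) = (\<Union>i\<in>J. T i) \<union> W" using i(1) Q(1) by blast
  moreover have "(D i \<union> P) \<union> ((\<Union>i\<in>J - {i}. D i) \<union> (E - P)) = (\<Union>i\<in>J. D i) \<union> E" using i(1) P(1) by blast
  ultimately show ?case by simp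
qed

lemma ex_poly_exp_decay:
  fixes a c e :: real
  assumes "a > 0" "c \<ge> 0" "e > 0"
  shows "\<exists>n0. \<forall>n\<ge>n0. c * real n ^ p * exp (- a * real n) < e"
proof -
  define e' where "e' = e * a ^ p / (c + 1)"
  have e': "e' > 0" using assms by (simp add: e'_def)
  have "((\<lambda>x::real. x ^ p / exp x) \<longlongrightarrow> 0) at_top" by (rule tendsto_power_div_exp_0)
  then have "eventually (\<lambda>x::real. dist (x ^ p / exp x) 0 < e') at_top"
    using e' unfolding tendsto_iff by blast
  then obtain x0 where x0: "\<And>x. x \<ge> x0 \<Longrightarrow> \<bar>x ^ p / exp x\<bar> < e'"
    unfolding eventually_at_top_linorder by (auto simp: dist_real_def)
  obtain n0 where n0: "\<And>n. n \<ge> n0 \<Longrightarrow> a * real n \<ge> x0" using ex_nat_mult_ge[OF assms(1)] by blast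
  have "c * real n ^ p * exp (- a * real n) < e" if "n \<ge> n0" for n
  proof -
    have "(a * real n) ^ p / exp (a * real n) < e'" using x0[OF n0[OF that]] by linarith
    then have "real n ^ p * exp (- a * real n) * a ^ p < e'"
      by (simp add: power_mult_distrib exp_minus field_simps)
    also have "e' = (e / (c + 1)) * a ^ p" by (simp add: e'_def)
    finally have "real n ^ p * exp (- a * real n) < e / (c + 1)"
      by (rule mult_right_less_imp_less) (use assms(1) in simp)
    then have "real n ^ p * exp (- a * real n) * (c + 1) < e"
      using assms(2) by (simp add: less_divide_eq)
    moreover have "real n ^ p * exp (- a * real n) \<ge> 0" by simp
    moreover have "real n ^ p * exp (- a * real n) * (c + 1) = c * real n ^ p * exp (- a * real n) + real n ^ p * exp (- a * real n)"
      by (simp add: algebra_simps)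
    ultimately show ?thesis by linarith
  qed
  then show ?thesis by blast
qed

lemma card_subsets_le:
  assumes "finite V" shows "card {Q. Q \<subseteq> V \<and> card Q = r} \<le> card V ^ r"
proof (cases "r \<le> card V")
  case True then show ?thesis using n_subsets[OF assms] binomial_le_pow by metis
next
  case False
  then have "{Q. Q \<subseteq> V \<and> card Q = r} = {}" using assms card_mono by fastforce
  then show ?thesis by (metis card.empty le0)
qed

context factor_thresholds
begin

lemma rainbow_factor_of_min_degree:
  fixes \<epsilon> :: real
  assumes \<epsilon>: "\<epsilon> > 0"
  shows "\<exists>n\<^sub>0. \<forall>n (V::nat set) (C::'c set) G. n\<^sub>0 \<le> n \<longrightarrow> finite V \<longrightarrow> card V = r * n \<longrightarrow>
      finite C \<longrightarrow> card C = t * n \<longrightarrow> (\<forall>c. simple_edges (G c)) \<longrightarrow>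
      (\<forall>c\<in>C. min_degree_ge (G c) V (\<delta> + \<epsilon>)) \<longrightarrow>
      rainbow_factor F G V C"
proof -
  obtain k' \<beta>0 n1 where k': "k' > 0" and \<beta>0: "\<beta>0 > 0" and
    dens: "\<forall>n (V::nat set) (C::'c set) G Q P. n1 \<le> n \<longrightarrow> finite V \<longrightarrow> card V = r * n \<longrightarrow>
      finite C \<longrightarrow> card C = t * n \<longrightarrow> (\<forall>c. simple_edges (G c)) \<longrightarrow>
      (\<forall>c\<in>C. min_degree_ge (G c) V (\<delta> + \<epsilon>)) \<longrightarrow>
      Q \<subseteq> V \<longrightarrow> card Q = r \<longrightarrow> P \<subseteq> C \<longrightarrow> card P = t \<longrightarrow>
      real (card {(f, g) \<in> ({..<r * k'} \<rightarrow>\<^sub>E V) \<times> ({..<t * k'} \<rightarrow>\<^sub>E C). inj_on f {..<r * k'} \<and> inj_on g {..<t * k'} \<and>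
          absorber F G Q P (f ` {..<r * k'}) (g ` {..<t * k'})})
        \<ge> \<beta>0 * real (card (({..<r * k'} \<rightarrow>\<^sub>E V) \<times> ({..<t * k'} \<rightarrow>\<^sub>E C)))"
    using absorber_density[OF \<epsilon>, where 'c = 'c] by (elim exE conjE)
  define k where "k = r * k'"
  define l where "l = t * k'"
  define \<beta> where "\<beta> = min \<beta>0 1"
  have \<beta>: "\<beta> > 0" "\<beta> \<le> 1" "\<beta> \<le> \<beta>0" using \<beta>0 by (auto simp: \<beta>_def)
  have kl: "k > 0" "l > 0" using k' r_pos t_pos by (auto simp: k_def l_def)
  \<comment> \<open>Two random candidates share a vertex with probability at most
    \<open>2 * k * k / n\<close> and a colour with probability at most
    \<open>2 * l * l / n\<close>.\<close>
  define K where "K = 2 * real k * real k + 2 * real l * real l"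
  have "2 * real k * real k > 0" using kl by simp
  then have K: "K > 0" unfolding K_def by (simp add: add_pos_nonneg)
  \<comment> \<open>The three bounds, in order: conflicts among \<open>\<mu> * n\<close> candidates
    stay within \<open>8 * M * \<kappa> \<le> \<beta>\<close>; the absorbers take at most a share
    \<open>\<epsilon> / 2\<close> of the vertices, so \<open>\<epsilon> / 2\<close> remains for the
    degrees; at least \<open>n / 2\<close> remains of \<open>n\<close>, as the covering needs a
    large instance.\<close>
  define \<mu> where "\<mu> = min (\<beta> / (8 * K)) (min (\<epsilon> / (2 * real k)) (1 / (2 * real k')))"
  have \<mu>: "\<mu> > 0" "\<mu> \<le> \<beta> / (8 * K)" "\<mu> \<le> \<epsilon> / (2 * real k)" "\<mu> \<le> 1 / (2 * real k')"
    using \<beta> K \<epsilon> kl k' by (auto simp: \<mu>_def)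
  \<comment> \<open>Each pair has \<open>\<beta> / 4 * M\<close> absorbers and
    \<open>M \<ge> \<mu> * n / 2\<close>, so a leftover of \<open>\<beta> * \<mu> / 8 * n\<close>
    can be absorbed.\<close>
  define \<eta> where "\<eta> = min 1 (\<beta> * \<mu> / 8)"
  have \<eta>: "\<eta> > 0" "\<eta> \<le> 1" "\<eta> \<le> \<beta> * \<mu> / 8" using \<beta> \<mu> by (auto simp: \<eta>_def)
  have \<epsilon>2: "\<epsilon> / 2 > 0" using \<epsilon> by simp
  obtain n2 where cover: "\<forall>n (V::nat set) (C::'c set) G. n2 \<le> n \<longrightarrow> finite V \<longrightarrow> card V = r * n \<longrightarrow> finite C \<longrightarrow> card C = t * n \<longrightarrow>
      (\<forall>c. simple_edges (G c)) \<longrightarrow>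
      (\<forall>c\<in>C. min_degree_ge (G c) V (\<delta> + \<epsilon> / 2)) \<longrightarrow>
      (\<exists>W D m. W \<subseteq> V \<and> D \<subseteq> C \<and> card W = r * m \<and> card D = t * m \<and> real m \<le> \<eta> * real n \<and>
         rainbow_factor F G (V - W) (C - D))"
    using almost_cover[OF \<epsilon>2 \<eta>(1,2), where 'c = 'c] by (elim exE)
  define b where "b = \<beta>\<^sup>2 / 16"
  have b: "b > 0" using \<beta> by (simp add: b_def)
  \<comment> \<open>There are at most \<open>r ^ r * t ^ t * n ^ (r + t)\<close> pairs
    \<open>(Q, P)\<close>; the factor \<open>exp b\<close> makes up for rounding
    \<open>\<mu> * n\<close> down to \<open>M\<close>.\<close>
  define c0 where "c0 = real r ^ r * real t ^ t * exp b"
  have "b * \<mu> > 0" "c0 \<ge> 0" using b \<mu> by (auto simp: c0_def)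
  then obtain n3 where n3: "\<And>n. n \<ge> n3 \<Longrightarrow> c0 * real n ^ (r + t) * exp (- (b * \<mu>) * real n) < 1 / 2"
    using ex_poly_exp_decay[of "b * \<mu>" c0 "1 / 2" "r + t"] by auto
  obtain n4 where n4: "\<And>n. n \<ge> n4 \<Longrightarrow> \<mu> * real n \<ge> 2" using ex_nat_mult_ge[OF \<mu>(1)] by blast
  define n0 where "n0 = Suc (n1 + 2 * n2 + n3 + n4)"
  have main: "rainbow_factor F G V C"
    if n: "n0 \<le> n" and V: "finite V" "card V = r * n" and C: "finite C" "card C = t * n"
      and G: "\<forall>c. simple_edges (G c)"
      and deg: "\<forall>c\<in>C. min_degree_ge (G c) V (\<delta> + \<epsilon>)"
    for n and V :: "nat set" and C :: "'c set" and G
  proof -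
    have n': "n > 0" "n1 \<le> n" "2 * n2 \<le> n" "n3 \<le> n" "n4 \<le> n" using n by (auto simp: n0_def)
    have Vne: "V \<noteq> {}" using V n'(1) r_pos by auto
    have Cne: "C \<noteq> {}" using C n'(1) t_pos by auto
    define M where "M = nat \<lfloor>\<mu> * real n\<rfloor>"
    have M: "real M \<le> \<mu> * real n" "\<mu> * real n < real M + 1"
      using n4[OF n'(5)] unfolding M_def by linarith+
    have M2: "real M \<ge> \<mu> * real n / 2" using M n4[OF n'(5)] by linarith
    define U where "U = {..<k} \<rightarrow>\<^sub>E V"
    define U' where "U' = {..<l} \<rightarrow>\<^sub>E C"
    define \<Omega> where "\<Omega> = U \<times> U'"
    have finU: "finite U" "finite U'" using V C by (auto simp: U_def U'_def intro: finite_PiE)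
    have \<Omega>: "finite \<Omega>" "\<Omega> \<noteq> {}" using finU Vne Cne by (auto simp: \<Omega>_def U_def U'_def PiE_eq_empty_iff)
    define T where "T = (\<lambda>x::(nat \<Rightarrow> nat) \<times> (nat \<Rightarrow> 'c). fst x ` {..<k})"
    define D where "D = (\<lambda>x::(nat \<Rightarrow> nat) \<times> (nat \<Rightarrow> 'c). snd x ` {..<l})"
    define conf where "conf = (\<lambda>x y. T x \<inter> T y \<noteq> {} \<or> D x \<inter> D y \<noteq> {})"
    define \<kappa> where "\<kappa> = K / real n"
    have \<kappa>: "\<kappa> > 0" using K n'(1) by (simp add: \<kappa>_def)
    have T: "T x \<subseteq> V" "card (T x) \<le> k" "finite (T x)" if "x \<in> \<Omega>" for x
    proof -
      have "fst x \<in> {..<k} \<rightarrow>\<^sub>E V" using that by (simp add: \<Omega>_def U_def mem_Times_iff)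
      then show "T x \<subseteq> V" by (auto simp: T_def)
      show "card (T x) \<le> k" using card_image_le[of "{..<k}" "fst x"] by (simp add: T_def)
      show "finite (T x)" by (simp add: T_def)
    qed
    have D: "D x \<subseteq> C" "card (D x) \<le> l" "finite (D x)" if "x \<in> \<Omega>" for x
    proof -
      have "snd x \<in> {..<l} \<rightarrow>\<^sub>E C" using that by (simp add: \<Omega>_def U'_def mem_Times_iff)
      then show "D x \<subseteq> C" by (auto simp: D_def)
      show "card (D x) \<le> l" using card_image_le[of "{..<l}" "snd x"] by (simp add: D_def)
      show "finite (D x)" by (simp add: D_def)
    qed
    have conf: "real (card {y \<in> \<Omega>. conf x y}) \<le> \<kappa> * real (card \<Omega>)" if x: "x \<in> \<Omega>" for x
    proof -
      define B1 where "B1 = {f \<in> U. \<not> (inj_on f {..<k} \<and> f ` {..<k} \<inter> T x = {})}"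
      define B2 where "B2 = {g \<in> U'. \<not> (inj_on g {..<l} \<and> g ` {..<l} \<inter> D x = {})}"
      have fin: "finite B1" "finite B2" using finU by (auto simp: B1_def B2_def)
      have rn: "real n \<le> real (card V)" "real n \<le> real (card C)"
        unfolding V(2) C(2) of_nat_le_iff using r_pos t_pos by simp_all
      have np: "real n > 0" using n'(1) by simp
      have b1: "real (card B1) \<le> 2 * real k * real k / real n * real (card U)"
      proof -
        have "real (card B1) \<le> real (k * (card (T x) + k)) / real (card V) * real (card V) ^ k"
          unfolding B1_def U_def by (rule card_not_inj_PiE_le[OF V(1) Vne T(1)[OF x]])
        also have "\<dots> \<le> (2 * real k * real k / real n) * real (card V) ^ k"
        proof (intro mult_right_mono frac_le)
          have "k * (card (T x) + k) \<le> k * (k + k)" using T(2)[OF x] by (intro mult_le_mono2) simp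
          then have "real (k * (card (T x) + k)) \<le> real (k * (k + k))" by (simp only: of_nat_le_iff)
          then show "real (k * (card (T x) + k)) \<le> 2 * real k * real k" by (simp add: algebra_simps)
        qed (use np rn in auto)
        finally show ?thesis by (simp add: U_def card_funcsetE)
      qed
      have b2: "real (card B2) \<le> 2 * real l * real l / real n * real (card U')"
      proof -
        have "real (card B2) \<le> real (l * (card (D x) + l)) / real (card C) * real (card C) ^ l"
          unfolding B2_def U'_def by (rule card_not_inj_PiE_le[OF C(1) Cne D(1)[OF x]])
        also have "\<dots> \<le> (2 * real l * real l / real n) * real (card C) ^ l"
        proof (intro mult_right_mono frac_le)
          have "l * (card (D x) + l) \<le> l * (l + l)" using D(2)[OF x] by (intro mult_le_mono2) simp
          then have "real (l * (card (D x) + l)) \<le> real (l * (l + l))" by (simp only: of_nat_le_iff)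
          then show "real (l * (card (D x) + l)) \<le> 2 * real l * real l" by (simp add: algebra_simps)
        qed (use np rn in auto)
        finally show ?thesis by (simp add: U'_def card_funcsetE)
      qed
      have "{y \<in> \<Omega>. conf x y} \<subseteq> B1 \<times> U' \<union> U \<times> B2"
      proof
        fix y assume "y \<in> {y \<in> \<Omega>. conf x y}"
        then have y: "fst y \<in> U" "snd y \<in> U'" "conf x y" by (auto simp: \<Omega>_def)
        then have "fst y \<in> B1 \<or> snd y \<in> B2"
          unfolding conf_def B1_def B2_def T_def D_def by blast
        then show "y \<in> B1 \<times> U' \<union> U \<times> B2" using y by (auto simp: mem_Times_iff)
      qed
      then have "card {y \<in> \<Omega>. conf x y} \<le> card (B1 \<times> U' \<union> U \<times> B2)"
        using fin finU by (intro card_mono) auto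
      also have "\<dots> \<le> card B1 * card U' + card U * card B2"
        using card_Un_le[of "B1 \<times> U'" "U \<times> B2"] by (simp add: card_cartesian_product)
      finally have "real (card {y \<in> \<Omega>. conf x y}) \<le> real (card B1 * card U' + card U * card B2)"
        by (simp only: of_nat_le_iff)
      also have "\<dots> = real (card B1) * real (card U') + real (card U) * real (card B2)" by simp
      also have "\<dots> \<le> (2 * real k * real k / real n * real (card U)) * real (card U')
          + real (card U) * (2 * real l * real l / real n * real (card U'))"
        using b1 b2 by (intro add_mono mult_right_mono mult_left_mono) auto
      also have "\<dots> = \<kappa> * real (card \<Omega>)"
        by (simp add: \<kappa>_def K_def \<Omega>_def card_cartesian_product add_divide_distrib algebra_simps)
      finally show ?thesis .
    qed
    define Z where "Z = {Q. Q \<subseteq> V \<and> card Q = r} \<times> {P. P \<subseteq> C \<and> card P = t}"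
    have finZ: "finite Z" using V C by (auto simp: Z_def)
    define A where "A = (\<lambda>z. {(f, g) \<in> \<Omega>. inj_on f {..<k} \<and> inj_on g {..<l} \<and>
          absorber F G (fst z) (snd z) (f ` {..<k}) (g ` {..<l})})"
    have densA: "real (card (A z)) \<ge> \<beta> * real (card \<Omega>)" if z: "z \<in> Z" for z
    proof -
      have "\<beta>0 * real (card \<Omega>) \<le> real (card (A z))"
        unfolding A_def \<Omega>_def U_def U'_def k_def l_def
        by (rule dens[rule_format (no_asm)]) (use n' V C G deg z in \<open>auto simp: Z_def\<close>)
      moreover have "\<beta> * real (card \<Omega>) \<le> \<beta>0 * real (card \<Omega>)" using \<beta>(3) by (intro mult_right_mono) auto
      ultimately show ?thesis by linarith
    qed
    have AZ: "A z \<subseteq> \<Omega>" for z by (auto simp: A_def)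
    have M8: "8 * real M * \<kappa> \<le> \<beta>"
    proof -
      have "8 * real M * \<kappa> \<le> 8 * (\<mu> * real n) * \<kappa>" using M(1) \<kappa> by (intro mult_right_mono mult_left_mono) auto
      also have "\<dots> = 8 * K * \<mu>" using n'(1) by (simp add: \<kappa>_def)
      also have "\<dots> \<le> \<beta>" using \<mu>(2) K by (simp add: le_divide_eq mult.commute)
      finally show ?thesis .
    qed
    have MZ: "real (card Z) * exp (- (\<beta>\<^sup>2 / 16) * real M) < 1 / 2"
    proof -
      have "card Z \<le> (card V ^ r) * (card C ^ t)"
        unfolding Z_def card_cartesian_product by (intro mult_le_mono card_subsets_le V(1) C(1))
      then have "real (card Z) \<le> real ((card V ^ r) * (card C ^ t))" by (simp only: of_nat_le_iff)
      also have "\<dots> = real r ^ r * real t ^ t * real n ^ (r + t)"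
        by (simp add: V(2) C(2) power_mult_distrib power_add)
      finally have cZ: "real (card Z) \<le> real r ^ r * real t ^ t * real n ^ (r + t)" .
      have "- b * real M \<le> b + - (b * \<mu>) * real n"
      proof -
        have "b * (\<mu> * real n) \<le> b * (real M + 1)" using M(2) b by (intro mult_left_mono) auto
        then show ?thesis by (simp add: algebra_simps)
      qed
      then have "exp (- b * real M) \<le> exp b * exp (- (b * \<mu>) * real n)" by (simp flip: exp_add)
      then have "real (card Z) * exp (- b * real M)
          \<le> (real r ^ r * real t ^ t * real n ^ (r + t)) * (exp b * exp (- (b * \<mu>) * real n))"
        using cZ by (intro mult_mono) auto
      also have "\<dots> = c0 * real n ^ (r + t) * exp (- (b * \<mu>) * real n)" by (simp add: c0_def)
      also have "\<dots> < 1 / 2" by (rule n3[OF n'(4)])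
      finally show ?thesis by (simp add: b_def)
    qed
    have Mpos: "M > 0" using M2 n4[OF n'(5)] by (cases "M = 0") auto
    have "\<exists>J f. J \<subseteq> {..<M} \<and> (\<forall>i\<in>J. f i \<in> \<Omega>) \<and> (\<forall>i\<in>J. \<forall>j\<in>J. i \<noteq> j \<longrightarrow> \<not> conf (f i) (f j)) \<and>
     (\<forall>z\<in>Z. real (card {i \<in> J. f i \<in> A z}) \<ge> \<beta> / 4 * real M)"
    proof (rule ex_conflict_free_family[OF \<Omega> finZ _ _ \<beta>(1,2) _ \<kappa> Mpos M8 MZ])
      show "A z \<subseteq> \<Omega>" for z by (rule AZ)
      show "\<beta> * real (card \<Omega>) \<le> real (card (A z))" if "z \<in> Z" for z by (rule densA[OF that])
      show "real (card {y \<in> \<Omega>. conf x y}) \<le> \<kappa> * real (card \<Omega>)" if "x \<in> \<Omega>" for x by (rule conf[OF that])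
    qed
    then obtain J0 f where J0: "J0 \<subseteq> {..<M}" "\<forall>i\<in>J0. f i \<in> \<Omega>"
      "\<forall>i\<in>J0. \<forall>j\<in>J0. i \<noteq> j \<longrightarrow> \<not> conf (f i) (f j)"
      "\<forall>z\<in>Z. real (card {i \<in> J0. f i \<in> A z}) \<ge> \<beta> / 4 * real M"
      by (elim exE conjE)
    \<comment> \<open>Only candidates that absorb some pair are known to be injective and to have a
      rainbow factor of their own; the others are dropped.\<close>
    define J where "J = {i \<in> J0. \<exists>z\<in>Z. f i \<in> A z}"
    have JM: "J \<subseteq> {..<M}" using J0(1) by (auto simp: J_def)
    then have finJ: "finite J" by (rule finite_subset) simp
    have cJ: "card J \<le> M" using card_mono[OF _ JM] by simp
    define TJ where "TJ = (\<lambda>i. T (f i))"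
    define DJ where "DJ = (\<lambda>i. D (f i))"
    have J: "rainbow_factor F G (TJ i) (DJ i)" "card (TJ i) = k" "card (DJ i) = l"
        "TJ i \<subseteq> V" "DJ i \<subseteq> C" if i: "i \<in> J" for i
    proof -
      obtain z where z: "f i \<in> A z" using i by (auto simp: J_def)
      then show "rainbow_factor F G (TJ i) (DJ i)" "card (TJ i) = k" "card (DJ i) = l"
        by (auto simp: A_def absorber_def TJ_def DJ_def T_def D_def card_image)
      show "TJ i \<subseteq> V" "DJ i \<subseteq> C" using i J0(2) T(1) D(1) by (auto simp: J_def TJ_def DJ_def)
    qed
    have Jdisj: "TJ i \<inter> TJ j = {} \<and> DJ i \<inter> DJ j = {}" if "i \<in> J" "j \<in> J" "i \<noteq> j" for i j
      using that J0(3) by (auto simp: J_def conf_def TJ_def DJ_def)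
    define VA where "VA = (\<Union>i\<in>J. TJ i)"
    define CA where "CA = (\<Union>i\<in>J. DJ i)"
    have VAsub: "VA \<subseteq> V" and CAsub: "CA \<subseteq> C" using J(4,5) by (auto simp: VA_def CA_def)
    note VA = VAsub finite_subset[OF VAsub V(1)] and CA = CAsub finite_subset[OF CAsub C(1)]
    have "card VA = (\<Sum>i\<in>J. card (TJ i))"
      unfolding VA_def
    proof (rule card_UN_disjoint[OF finJ])
      show "\<forall>i\<in>J. finite (TJ i)" using finite_subset[OF J(4) V(1)] by blast
      show "\<forall>i\<in>J. \<forall>j\<in>J. i \<noteq> j \<longrightarrow> TJ i \<inter> TJ j = {}" using Jdisj by simp
    qed
    then have cVA: "card VA = k * card J" using J(2) by simp
    have "card CA = (\<Sum>i\<in>J. card (DJ i))"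
      unfolding CA_def
    proof (rule card_UN_disjoint[OF finJ])
      show "\<forall>i\<in>J. finite (DJ i)" using finite_subset[OF J(5) C(1)] by blast
      show "\<forall>i\<in>J. \<forall>j\<in>J. i \<noteq> j \<longrightarrow> DJ i \<inter> DJ j = {}" using Jdisj by simp
    qed
    then have cCA: "card CA = l * card J" using J(3) by simp
    define p where "p = n - k' * card J"
    have kJ: "real (k' * card J) \<le> real n / 2"
    proof -
      have "real k' * real (card J) \<le> real k' * (\<mu> * real n)" using cJ M(1) by (intro mult_left_mono) auto
      also have "\<dots> = (real k' * \<mu>) * real n" by simp
      also have "\<dots> \<le> (1 / 2) * real n"
        using \<mu>(4) k' by (intro mult_right_mono) (auto simp: le_divide_eq mult.commute)
      finally show ?thesis by simp
    qed
    then have "k' * card J \<le> n" by linarith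
    then have rp: "real p = real n - real (k' * card J)" by (simp add: p_def of_nat_diff)
    then have p: "n2 \<le> p" "p \<le> n" using kJ n'(3) by linarith+
    have cV': "card (V - VA) = r * p"
      using card_Diff_subset[OF VA(2,1)] cVA V(2) by (simp add: p_def k_def diff_mult_distrib2 mult.assoc)
    have cC': "card (C - CA) = t * p"
      using card_Diff_subset[OF CA(2,1)] cCA C(2) by (simp add: p_def l_def diff_mult_distrib2 mult.assoc)
    have deg': "\<forall>c\<in>C - CA. \<forall>v\<in>V - VA. real (degree_into (G c) (V - VA) v) \<ge> (\<delta> + \<epsilon> / 2) * real (card (V - VA))"
    proof (intro ballI)
      fix c v assume cv: "c \<in> C - CA" "v \<in> V - VA"
      have "real (card VA) \<le> \<epsilon> / 2 * real (card V)"
      proof -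
        have "real k * real (card J) \<le> real k * (\<mu> * real n)" using cJ M(1) by (intro mult_left_mono) auto
        also have "\<dots> = (real k * \<mu>) * real n" by simp
        also have "\<dots> \<le> (\<epsilon> / 2) * real n"
          using \<mu>(3) kl by (intro mult_right_mono) (auto simp: le_divide_eq mult.commute)
        also have "\<dots> \<le> (\<epsilon> / 2) * real (card V)"
        proof (rule mult_left_mono)
          show "real n \<le> real (card V)" unfolding V(2) of_nat_le_iff using r_pos by simp
        qed (use \<epsilon> in simp)
        finally show ?thesis by (simp add: cVA)
      qed
      moreover have "(\<delta> + \<epsilon>) * real (card V) \<le> real (degree_into (G c) V v)" using deg cv by blast
      moreover have "real (degree_into (G c) (V - VA) v) \<ge> real (degree_into (G c) V v) - real (card VA)"
        by (rule degree_into_Diff[OF VA(2) V(1)])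
      moreover have "(\<delta> + \<epsilon> / 2) * real (card (V - VA)) \<le> (\<delta> + \<epsilon> / 2) * real (card V)"
        using \<delta>_nonneg \<epsilon> V(1) by (intro mult_left_mono) (auto intro: card_mono)
      moreover have "(\<delta> + \<epsilon>) * real (card V) = (\<delta> + \<epsilon> / 2) * real (card V) + \<epsilon> / 2 * real (card V)"
        by (simp add: field_simps)
      ultimately show "(\<delta> + \<epsilon> / 2) * real (card (V - VA)) \<le> real (degree_into (G c) (V - VA) v)" by linarith
    qed
    have "\<exists>W D m. W \<subseteq> V - VA \<and> D \<subseteq> C - CA \<and> card W = r * m \<and> card D = t * m \<and> real m \<le> \<eta> * real p \<and>
         rainbow_factor F G ((V - VA) - W) ((C - CA) - D)"
      by (rule cover[rule_format (no_asm), OF p(1) _ cV' _ cC' G deg']) (use V C in auto)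
    then obtain W E m where W: "W \<subseteq> V - VA" "E \<subseteq> C - CA" "card W = r * m" "card E = t * m" "real m \<le> \<eta> * real p"
         "rainbow_factor F G ((V - VA) - W) ((C - CA) - E)" by blast
    have mM: "real m \<le> \<beta> / 4 * real M"
    proof -
      have "real m \<le> \<eta> * real n" using W(5) p(2) \<eta>(1) by (meson mult_left_mono less_imp_le of_nat_mono order_trans)
      also have "\<dots> \<le> (\<beta> * \<mu> / 8) * real n" using \<eta>(3) by (intro mult_right_mono) auto
      also have "\<dots> = \<beta> / 4 * (\<mu> * real n / 2)" by simp
      also have "\<dots> \<le> \<beta> / 4 * real M" using M2 \<beta> by (intro mult_left_mono) auto
      finally show ?thesis .
    qed
    have "rainbow_factor F G ((\<Union>i\<in>J. TJ i) \<union> W) ((\<Union>i\<in>J. DJ i) \<union> E)"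
    proof (rule rainbow_factor_absorb[OF finJ J(1) Jdisj _ W(3) _ W(4)])
      show "finite W" "finite E" using W(1,2) V(1) C(1) finite_subset by blast+
      show "TJ i \<inter> W = {} \<and> DJ i \<inter> E = {}" if "i \<in> J" for i
        using that W(1,2) by (auto simp: VA_def CA_def)
      fix Q P assume QP: "Q \<subseteq> W" "card Q = r" "P \<subseteq> E" "card P = t"
      have z: "(Q, P) \<in> Z" using QP W(1,2) by (auto simp: Z_def)
      have "{i \<in> J0. f i \<in> A (Q, P)} \<subseteq> {i \<in> J. absorber F G Q P (TJ i) (DJ i)}"
        using z by (auto simp: J_def A_def TJ_def DJ_def T_def D_def intro!: bexI[of _ "(Q, P)"])
      then have "card {i \<in> J0. f i \<in> A (Q, P)} \<le> card {i \<in> J. absorber F G Q P (TJ i) (DJ i)}"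
        using finJ by (intro card_mono) auto
      moreover have "real m \<le> real (card {i \<in> J0. f i \<in> A (Q, P)})" using J0(4) z mM by fastforce
      ultimately show "m \<le> card {i \<in> J. absorber F G Q P (TJ i) (DJ i)}" by linarith
    qed
    then have "rainbow_factor F G ((VA \<union> W) \<union> ((V - VA) - W)) ((CA \<union> E) \<union> ((C - CA) - E))"
      using W(6) unfolding VA_def[symmetric] CA_def[symmetric] by (rule rainbow_factor_Un) auto
    moreover have "(VA \<union> W) \<union> ((V - VA) - W) = V" "(CA \<union> E) \<union> ((C - CA) - E) = C"
      using VA(1) CA(1) W(1,2) by auto
    ultimately show ?thesis by simp
  qed
  show ?thesis by (intro exI[of _ n0] allI impI) (rule main; assumption)
qed

end

section \<open>Graphs without edges, and the translation to transversals\<close>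

text \<open>For \<open>t = 0\<close> the collection is empty and the threshold unspecified, so the
  degree condition carries no information; any partition of \<open>V\<close> into sets of the right
  size is a factor.\<close>

lemma ex_edgeless_tiling:
  assumes F: "is_graph F" "edges F = {}" and V: "finite V" "card V = card (verts F) * n"
  shows "\<exists>K. tiling F V K \<and> (\<Union>C\<in>K. edges C) = {}"
  using V
proof (induction n arbitrary: V)
  case 0
  then have "V = {}" by simp
  then show ?case by (intro exI[of _ "{}"]) (auto simp: tiling_def)
next
  case (Suc n)
  obtain X where X: "X \<subseteq> V" "card X = card (verts F)" "finite X"
    using obtain_subset_with_card_n[of "card (verts F)" V] Suc.prems by auto
  obtain K where K: "tiling F (V - X) K" "(\<Union>C\<in>K. edges C) = {}"
    using Suc.IH[of "V - X"] Suc.prems card_Diff_subset[OF X(3,1)] X(2) by auto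
  obtain h where h: "bij_betw h (verts F) X"
    using finite_same_card_bij[of "verts F" X] F X by (auto simp: is_graph_def)
  define C where "C = Graph X ({} :: 'b set set)"
  have C: "is_graph C" "isomorphic F C"
    using X h F(2) unfolding C_def is_graph_def isomorphic_def by auto
  have "tiling F V (insert C K)"
    unfolding tiling_def
  proof (intro conjI)
    show "\<forall>C\<in>insert C K. is_graph C \<and> isomorphic F C" using C K unfolding tiling_def by blast
    show "(\<Union>C\<in>insert C K. verts C) = V" using K X unfolding tiling_def C_def by auto
    have "disjnt X (verts D)" if "D \<in> K" for D using K that unfolding tiling_def disjnt_def by blast
    then show "pairwise (\<lambda>C D. disjnt (verts C) (verts D)) (insert C K)"
      using K(1) unfolding tiling_def pairwise_insert C_def by (simp add: disjnt_sym)
  qed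
  then show ?case using K(2) by (intro exI[of _ "insert C K"]) (auto simp: C_def)
qed

lemma transversal_of_rainbow_factor:
  assumes V: "finite V" and H: "rainbow_factor F (\<lambda>i. edges (Gs ! i)) V {..<length Gs}"
  shows "\<exists>H. is_transversal V Gs H \<and> is_factor F V H"
proof -
  obtain K \<phi> where K: "tiling F V K" "bij_betw \<phi> (\<Union>C\<in>K. edges C) {..<length Gs}"
      "\<forall>e\<in>(\<Union>C\<in>K. edges C). e \<in> edges (Gs ! \<phi> e)"
    using H unfolding rainbow_factor_def by blast
  define H where "H = Graph V (\<Union>C\<in>K. edges C)"
  have "edges H \<subseteq> nsets V 2"
  proof
    fix e assume "e \<in> edges H"
    then obtain C where C: "C \<in> K" "e \<in> edges C" by (auto simp: H_def)
    then have "is_graph C" "verts C \<subseteq> V" using K(1) unfolding tiling_def by auto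
    then show "e \<in> nsets V 2" using C(2) nsets_mono unfolding is_graph_def by blast
  qed
  then have g: "is_graph H" using V by (simp add: is_graph_def H_def)
  have "card (edges H) = length Gs" using bij_betw_same_card[OF K(2)] by (simp add: H_def)
  then have "is_transversal V Gs H"
    unfolding is_transversal_def using g K(2,3)
    by (intro conjI exI[of _ \<phi>]) (auto simp: H_def bij_betw_def)
  moreover have "is_factor F V H"
    unfolding is_factor_def using K(1) unfolding tiling_def H_def by blast
  ultimately show ?thesis by blast
qed

lemma degree_into_ge_collection_min_degree:
  assumes G: "is_graph_collection V Gs" and V: "finite V" and i: "i < length Gs" and v: "v \<in> V"
  shows "collection_min_degree Gs \<le> degree_into (edges (Gs ! i)) V v"
proof -
  have Gi: "verts (Gs ! i) = V" using G i by (auto simp: is_graph_collection_def)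
  have "collection_min_degree Gs \<le> min_degree (Gs ! i)"
    unfolding collection_min_degree_def using i by (intro Min_le) auto
  also have "\<dots> \<le> degree (Gs ! i) v"
    unfolding min_degree_def Gi using V v by (intro Min_le) auto
  also have "\<dots> = degree_into (edges (Gs ! i)) V v" by (simp add: degree_def degree_into_def Gi)
  finally show ?thesis .
qed

theorem theorem1p2:
  fixes \<epsilon> :: real and F :: "'a graph" and r t :: nat
  assumes "\<epsilon> > 0"
    and "is_graph F" and "card (verts F) = r" and "card (edges F) = t"
  shows "\<exists>n\<^sub>0::nat. \<forall>n\<ge>n\<^sub>0. \<forall>Gs :: nat graph list.
           is_graph_collection {1..r * n} Gs \<longrightarrow>
           length Gs = t * n \<longrightarrow>
           real (collection_min_degree Gs) \<ge> (transversal_factor_threshold F + \<epsilon>) * real (r * n) \<longrightarrow>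
           (\<exists>H. is_transversal {1..r * n} Gs H \<and> is_factor F {1..r * n} H)"
proof (cases "t = 0")
  case True
  have "finite (edges F)"
    using assms(2) finite_subset[of "edges F" "Pow (verts F)"] is_graph_edge(1)[OF assms(2)]
    by (auto simp: is_graph_def)
  then have "edges F = {}" using True assms(4) by simp
  have "\<exists>H. is_transversal {1..r * n} Gs H \<and> is_factor F {1..r * n} H"
    if "length Gs = t * n" for n and Gs :: "nat graph list"
  proof (rule transversal_of_rainbow_factor)
    obtain K where "tiling F {1..r * n} K" "(\<Union>C\<in>K. edges C) = {}"
      using ex_edgeless_tiling[OF assms(2) \<open>edges F = {}\<close>, of "{1..r * n}" n] assms(3) by auto
    then show "rainbow_factor F (\<lambda>i. edges (Gs ! i)) {1..r * n} {..<length Gs}"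
      unfolding rainbow_factor_def using that True by (intro exI[of _ K]) (auto simp: bij_betw_def)
  qed simp
  then show ?thesis by blast
next
  case False
  then have ne: "edges F \<noteq> {}" using assms(4) by auto
  then obtain e where "e \<in> edges F" by blast
  then have "verts F \<noteq> {}" using is_graph_edge(1,3)[OF assms(2)] by blast
  then have rpos: "r > 0" using assms(2,3) by (auto simp: is_graph_def card_gt_0_iff)
  interpret factor_thresholds F "transversal_factor_threshold F" r t
    by unfold_locales
      (use assms rpos False transversal_factor_threshold_bounds[OF assms(2) ne] in auto)
  obtain n0 where n0: "\<forall>n (V::nat set) (C::nat set) G. n0 \<le> n \<longrightarrow> finite V \<longrightarrow> card V = r * n \<longrightarrow>
      finite C \<longrightarrow> card C = t * n \<longrightarrow> (\<forall>c. simple_edges (G c)) \<longrightarrow>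
      (\<forall>c\<in>C. min_degree_ge (G c) V (transversal_factor_threshold F + \<epsilon>)) \<longrightarrow>
      rainbow_factor F G V C"
    using rainbow_factor_of_min_degree[OF assms(1), where 'c = nat] by (elim exE)
  have "\<exists>H. is_transversal {1..r * n} Gs H \<and> is_factor F {1..r * n} H"
    if n: "n0 \<le> n" and G: "is_graph_collection {1..r * n} Gs" "length Gs = t * n"
      and d: "real (collection_min_degree Gs) \<ge> (transversal_factor_threshold F + \<epsilon>) * real (r * n)"
    for n and Gs :: "nat graph list"
  proof (rule transversal_of_rainbow_factor)
    \<comment> \<open>Simple edge sets are required for every index, and \<open>Gs ! i\<close> is
      unspecified beyond the list; the empty set is put there.\<close>
    let ?G = "\<lambda>i. if i < length Gs then edges (Gs ! i) else {}"
    have "rainbow_factor F ?G {1..r * n} {..<length Gs}"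
    proof (rule n0[rule_format (no_asm), OF n])
      have "card e = 2" if "c < length Gs" "e \<in> edges (Gs ! c)" for c e
      proof -
        have "is_graph (Gs ! c)" using G(1) nth_mem[OF that(1)] unfolding is_graph_collection_def by blast
        then show ?thesis using is_graph_edge(2) that(2) by blast
      qed
      then show "\<forall>c. \<forall>e\<in>?G c. card e = 2" by simp
      show "\<forall>c\<in>{..<length Gs}. \<forall>v\<in>{1..r * n}. (transversal_factor_threshold F + \<epsilon>) * real (card {1..r * n})
          \<le> real (degree_into (?G c) {1..r * n} v)"
      proof (intro ballI)
        fix c v assume cv: "c \<in> {..<length Gs}" "v \<in> {1..r * n}"
        have "real (collection_min_degree Gs) \<le> real (degree_into (edges (Gs ! c)) {1..r * n} v)"
          using degree_into_ge_collection_min_degree[OF G(1)] cv by simp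
        then show "(transversal_factor_threshold F + \<epsilon>) * real (card {1..r * n})
          \<le> real (degree_into (?G c) {1..r * n} v)" using cv d by simp
      qed
    qed (use G in auto)
    then show "rainbow_factor F (\<lambda>i. edges (Gs ! i)) {1..r * n} {..<length Gs}"
      unfolding rainbow_factor_def bij_betw_def by (smt (verit) imageI lessThan_iff)
  qed simp
  then show ?thesis by blast
qed

end
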